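(* Let $\ell$ be a prime and $d\ge2$, and let $q$ range over prime powers with $\gcd(q,2\ell)=1$. Let $X^{\sup}_d$ (resp. $X^{\inf}_d$) be the pointwise $\limsup$ (resp. $\liminf$) as $q\to\infty$ of the distribution of $\dim_{\mathbb{F}_\ell}\ker(g-1)$ for $g$ uniform in $H^d_{\ell,q}$, and let $P_\infty$ be the distribution on $\mathbb{Z}_{\ge0}$ with \[P_\infty(v)=\prod_{j\ge0}(1+\ell^{-j})^{-1}\frac{1}{\ell^{(v^2-v)/2}(1-\ell^{-1})(1-\ell^{-2})\cdots(1-\ell^{-v})}.\] Then $d_{\mathrm{TV}}(X^{\sup}_d,P_\infty)=O(\ell^{-(6d-2)^2})$ and $d_{\mathrm{TV}}(X^{\inf}_d,P_\infty)=O(\ell^{-(6d-2)^2})$, with absolute implied constants.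
   Context: Let $(V,Q)$ be the reduction mod $\ell$ of the lattice $U^{\oplus(2d-2)}\oplus(-E_8)^{\oplus d}$ ($U$ hyperbolic plane, $-E_8$ the $E_8$ lattice with negated form), a nondegenerate quadratic space of dimension $12d-4$ over $\mathbb{F}_\ell$. With $B(x,y)=Q(x+y)-Q(x)-Q(y)$ and reflections $r_v(w)=w-\frac{B(w,v)}{Q(v)}v$: the Dickson invariant $D(g)=\operatorname{rank}(g-1)\bmod 2$; the ($-1$-)spinor norm $\mathrm{sp}:\mathrm{O}(Q)\to\mathbb{F}_\ell^\times/(\mathbb{F}_\ell^\times)^2$ is the homomorphism with $r_v\mapsto[-Q(v)]$ (trivial if $\ell=2$). $H^d_{\ell,q}=\{g\in\mathrm{O}(Q):\mathrm{sp}(g)=[q^{d-1}]\}$ (no condition on $D$ since $\ell$ is a single prime). For functions $P,P'$ on a countable set $X$, $d_{\mathrm{TV}}(P,P')=\frac12\sum_{x\in X}|P(x)-P'(x)|$. *)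

theory Defs
  imports
    "HOL-Probability.Probability"
    "HOL-Number_Theory.Number_Theory"
    "HOL-Algebra.Bij"
    "Jordan_Normal_Form.Missing_VectorSpace"
begin

section \<open>Quadratic spaces\<close>

text \<open>
  A quadratic space is given by a field \<open>F\<close>, a vector space \<open>V\<close> over \<open>F\<close> and a function \<open>Q\<close>
  from \<open>V\<close> to \<open>F\<close>. Carriers are explicit because the field and the dimension both vary inside
  the main statement, whose constants must not depend on them.
\<close>

definition polar_form ::
  "'a ring \<Rightarrow> ('a, 'v) module \<Rightarrow> ('v \<Rightarrow> 'a) \<Rightarrow> 'v \<Rightarrow> 'v \<Rightarrow> 'a" where
  "polar_form F V Q x y = Q (x \<oplus>\<^bsub>V\<^esub> y) \<ominus>\<^bsub>F\<^esub> Q x \<ominus>\<^bsub>F\<^esub> Q y"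

definition reflection ::
  "'a ring \<Rightarrow> ('a, 'v) module \<Rightarrow> ('v \<Rightarrow> 'a) \<Rightarrow> 'v \<Rightarrow> 'v \<Rightarrow> 'v" where
  "reflection F V Q v =
     (\<lambda>w\<in>carrier V. w \<ominus>\<^bsub>V\<^esub> ((polar_form F V Q w v \<otimes>\<^bsub>F\<^esub> inv\<^bsub>F\<^esub> (Q v)) \<odot>\<^bsub>V\<^esub> v))"

definition orthogonal_group ::
  "'a ring \<Rightarrow> ('a, 'v) module \<Rightarrow> ('v \<Rightarrow> 'a) \<Rightarrow> ('v \<Rightarrow> 'v) monoid" where
  "orthogonal_group F V Q =
     (BijGroup (carrier V))
       \<lparr>carrier := {g \<in> Bij (carrier V).
          g \<in> module_hom F V V \<and> (\<forall>x\<in>carrier V. Q (g x) = Q x)}\<rparr>"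

definition unit_squares :: "'a ring \<Rightarrow> 'a set" where
  "unit_squares F = (\<lambda>x. x \<otimes>\<^bsub>F\<^esub> x) ` Units F"

definition square_class_group :: "'a ring \<Rightarrow> 'a set monoid" where
  "square_class_group F = units_of F Mod unit_squares F"

definition square_class :: "'a ring \<Rightarrow> 'a \<Rightarrow> 'a set" where
  "square_class F a = unit_squares F #>\<^bsub>units_of F\<^esub> a"

text \<open>
  Extensionality only pins down the irrelevant values outside the orthogonal group. For the
  spaces used below the homomorphism is unique because reflections generate the orthogonal
  group. Over the field with two elements the target is the trivial group, so that the spinor
  norm is automatically trivial there.
\<close>

definition spinor_norm ::
  "'a ring \<Rightarrow> ('a, 'v) module \<Rightarrow> ('v \<Rightarrow> 'a) \<Rightarrow> ('v \<Rightarrow> 'v) \<Rightarrow> 'a set" where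
  "spinor_norm F V Q =
     (THE sp. sp \<in> hom (orthogonal_group F V Q) (square_class_group F)
            \<and> sp \<in> extensional (carrier (orthogonal_group F V Q))
            \<and> (\<forall>v\<in>carrier V. Q v \<noteq> \<zero>\<^bsub>F\<^esub> \<longrightarrow>
                 sp (reflection F V Q v) = square_class F (\<ominus>\<^bsub>F\<^esub> Q v)))"

definition fixed_space_dim :: "'a ring \<Rightarrow> ('a, 'v) module \<Rightarrow> ('v \<Rightarrow> 'v) \<Rightarrow> nat" where
  "fixed_space_dim F V g =
     vectorspace.dim F (V\<lparr>carrier := mod_hom.ker V V (\<lambda>x. g x \<ominus>\<^bsub>V\<^esub> x)\<rparr>)"


section \<open>The lattice and its reduction\<close>

text \<open>
  Half the norm form of the \<open>E\<^sub>8\<close> lattice in a basis of simple roots: the Dynkin diagram is the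
  chain \<open>0 - 1 - 2 - 3 - 4 - 5 - 6\<close> together with the node \<open>7\<close> attached to the node \<open>2\<close>.
\<close>

definition e8_form :: "(nat \<Rightarrow> int) \<Rightarrow> int" where
  "e8_form x = (\<Sum>i<8. (x i)\<^sup>2) - (\<Sum>i<6. x i * x (Suc i)) - x 2 * x 7"

text \<open>
  The first \<open>4d - 4\<close> coordinates belong to the hyperbolic planes, each with form \<open>(a, b) \<mapsto> a b\<close>;
  the remaining \<open>8d\<close> coordinates belong to the negated \<open>E\<^sub>8\<close> lattices.
\<close>

definition lattice_form :: "nat \<Rightarrow> (nat \<Rightarrow> int) \<Rightarrow> int" where
  "lattice_form d x =
     (\<Sum>i<2*d - 2. x (2*i) * x (2*i + 1)) - (\<Sum>k<d. e8_form (\<lambda>i. x (4*d - 4 + 8*k + i)))"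

abbreviation prime_field :: "nat \<Rightarrow> int ring" where
  "prime_field l \<equiv> residue_ring (int l)"

definition reduced_space :: "nat \<Rightarrow> nat \<Rightarrow> (int, nat \<Rightarrow> int) module" where
  "reduced_space l d = ring.func_space (prime_field l) {..<12*d - 4}"

definition reduced_form :: "nat \<Rightarrow> nat \<Rightarrow> (nat \<Rightarrow> int) \<Rightarrow> int" where
  "reduced_form l d x = lattice_form d x mod int l"

definition H_set :: "nat \<Rightarrow> nat \<Rightarrow> nat \<Rightarrow> ((nat \<Rightarrow> int) \<Rightarrow> (nat \<Rightarrow> int)) set" where
  "H_set l d q =
     {g \<in> carrier (orthogonal_group (prime_field l) (reduced_space l d) (reduced_form l d)).
        spinor_norm (prime_field l) (reduced_space l d) (reduced_form l d) g
          = square_class (prime_field l) (int q ^ (d - 1) mod int l)}"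


section \<open>The distributions\<close>

definition fixed_dim_pmf :: "nat \<Rightarrow> nat \<Rightarrow> nat \<Rightarrow> nat pmf" where
  "fixed_dim_pmf l d q =
     map_pmf (fixed_space_dim (prime_field l) (reduced_space l d)) (pmf_of_set (H_set l d q))"

definition q_filter :: "nat \<Rightarrow> nat filter" where
  "q_filter l = inf at_top (principal {q. primepow q \<and> gcd q (2 * l) = 1})"

definition X_sup :: "nat \<Rightarrow> nat \<Rightarrow> nat \<Rightarrow> real" where
  "X_sup l d v = real_of_ereal (Limsup (q_filter l) (\<lambda>q. ereal (pmf (fixed_dim_pmf l d q) v)))"

definition X_inf :: "nat \<Rightarrow> nat \<Rightarrow> nat \<Rightarrow> real" where
  "X_inf l d v = real_of_ereal (Liminf (q_filter l) (\<lambda>q. ereal (pmf (fixed_dim_pmf l d q) v)))"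

definition P_infty :: "nat \<Rightarrow> nat \<Rightarrow> real" where
  "P_infty l v =
     prodinf (\<lambda>j. inverse (1 + 1 / real l ^ j)) *
     (1 / (real l ^ ((v\<^sup>2 - v) div 2) * (\<Prod>i=1..v. 1 - 1 / real l ^ i)))"

text \<open>Valued in the extended nonnegative reals, so that a divergent sum is not read as zero.\<close>

definition tv_dist :: "('a::countable \<Rightarrow> real) \<Rightarrow> ('a \<Rightarrow> real) \<Rightarrow> ennreal" where
  "tv_dist P P' = (\<Sum>\<^sub>\<infinity>x. ennreal \<bar>P x - P' x\<bar>) / 2"

end

theory Submission
  imports Defs "HOL-Combinatorics.Permutations" "HOL-Library.Function_Algebras"
begin

text \<open>
  Write \<open>n = 6d - 2\<close>. By Witt's theorem the orbits of \<open>O(Q)\<close> on linearly independent \<open>m\<close>-tuples are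
  classified by the restricted quadratic form, and for \<open>m < n\<close> every form occurs, so the average
  number of injections of an \<open>m\<close>-dimensional space into \<open>ker (g - 1)\<close> is \<open>\<ell>\<close> to the power \<open>m(m+1)/2\<close>.
  The perpendicular space of such a tuple contains vectors \<open>v\<close> with \<open>Q v\<close> in any nonzero square class;
  multiplying by \<open>r\<^sub>v\<close> flips the parity of \<open>dim ker (g - 1)\<close> and multiplies the spinor norm by
  \<open>[- Q v]\<close>, so the same average holds on every class of given parity and spinor norm. Euler's
  identity shows that the even and the odd part of \<open>P\<^sub>\<infinity>\<close> have the same moments.

  On a fixed parity the fixed space has size \<open>\<ell>\<close> to the power \<open>2k + \<pi>\<close>, with \<open>k < n\<close> except for \<open>g = 1\<close>.
  Lagrange interpolation at these \<open>n\<close> nodes expresses each probability through the moments of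
  order less than \<open>n\<close>, up to the tails \<open>k \<ge> n\<close>, which contribute \<open>O(\<ell>\<^bsup>-n\<^sup>2\<^esup>)\<close>; the weight of \<open>g = 1\<close> is
  controlled by a pigeonhole lower bound for the order of \<open>O(Q)\<close>.

  The spinor norm exists for odd \<open>\<ell>\<close> because \<open>O(Q)\<close> permutes the vectors with \<open>Q x = a\<close>: the sign of
  \<open>r\<^sub>w\<close> on this level set is determined by whether \<open>a Q(w)\<close> is a square.
\<close>

section \<open>Quadratic spaces over a finite prime field\<close>

text \<open>The parity split is what makes interpolation possible. The fixed dimension may take up
  to 2n + 1 values, while only n moments are available; on one parity the n nodes
  \<open>k < n\<close> match these n moments, and beyond them the group contributes nothing but the
  identity.

  The rate comes from one comparison. At the first uncontrolled node \<open>k = n\<close> the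
  identity and the limit both weigh about l to the power -n(2n - 1). The Lagrange coefficient that
  carries this mass back to the node 0 or 1 has size about l to the power n(n - 1). The product is l
  to the power of minus n squared; all other nodes and all later tail terms are smaller by geometric
  factors.

  The constants are absolute because every product of factors such as 1 - 1/l^i is bounded below by
  its counterpart with base 2 or 4. The number q enters only through a square class, so the
  estimates are uniform in q and pass to limsup and liminf.\<close>

text \<open>
  The scalars form a ring that need not be a field: the field with \<open>l\<close> elements is the ideal generated
  by the idempotent \<open>e\<close>, and \<open>V\<close> is a module over that ideal. All laws of \<open>Q\<close> and \<open>B\<close> then hold on whole
  types, without carrier conditions.
\<close>

locale quad_space = Modules.module scale
  for scale :: "'r::comm_ring_1 \<Rightarrow> 'v::ab_group_add \<Rightarrow> 'v" (infixr \<open>\<star>\<close> 75) +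
  fixes l n :: nat and e :: 'r and V :: "'v set" and Q :: "'v \<Rightarrow> 'r" and B :: "'v \<Rightarrow> 'v \<Rightarrow> 'r"
  assumes prime_l: "prime l"
    and e_idem: "e * e = e"
    and card_range_e: "card (range ((*) e)) = l"
    and e_inverse: "\<And>r. e * r \<noteq> 0 \<Longrightarrow> \<exists>s. s * r = e"
    and V_subspace: "subspace V"
    and e_scale: "\<And>v. v \<in> V \<Longrightarrow> e \<star> v = v"
    and card_V: "card V = l ^ (2 * n)"
    and B_add_left: "\<And>x y z. B (x + y) z = B x z + B y z"
    and B_scale_left: "\<And>r x z. B (r \<star> x) z = r * B x z"
    and B_sym: "\<And>x y. B x y = B y x"
    and Q_add: "\<And>x y. Q (x + y) = Q x + Q y + B x y"
    and Q_scale: "\<And>r x. Q (r \<star> x) = r * r * Q x"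
    and nondegenerate: "\<And>x. x \<in> V \<Longrightarrow> (\<And>y. y \<in> V \<Longrightarrow> B x y = 0) \<Longrightarrow> x = 0"
begin

section \<open>Arithmetic of the scalar field inside the ring\<close>

definition K :: "'r set" where "K = {r. e * r = r}"

lemma l_gt_1: "l > 1"
  using prime_l prime_gt_1_nat by blast

lemma l_pos [simp]: "l > 0"
  using l_gt_1 by simp

lemma K_eq_range: "K = range ((*) e)"
  unfolding K_def
proof (intro equalityI subsetI)
  fix r assume "r \<in> range ((*) e)"
  then show "r \<in> {r. e * r = r}"
    using e_idem by (auto simp: mult.assoc[symmetric])
next
  fix r assume "r \<in> {r. e * r = r}"
  then show "r \<in> range ((*) e)" by (intro range_eqI[of _ _ r]) simp
qed

lemma card_K: "card K = l"
  by (simp add: K_eq_range card_range_e)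

lemma finite_K: "finite K"
  using card_K l_pos by (metis card.infinite less_irrefl)

lemma finite_V: "finite V"
  using card_V l_pos by (metis card.infinite less_irrefl zero_less_power)

lemma e_in_K [simp]: "e \<in> K" and zero_in_K [simp]: "0 \<in> K"
  by (simp_all add: K_def e_idem)

lemma K_add: "a \<in> K \<Longrightarrow> b \<in> K \<Longrightarrow> a + b \<in> K"
  and K_diff: "a \<in> K \<Longrightarrow> b \<in> K \<Longrightarrow> a - b \<in> K"
  and K_uminus: "a \<in> K \<Longrightarrow> - a \<in> K"
  and K_mult_left: "a \<in> K \<Longrightarrow> a * r \<in> K"
  and K_mult_right: "a \<in> K \<Longrightarrow> r * a \<in> K"
  by (auto simp: K_def algebra_simps) (metis mult.assoc mult.commute)+

lemma e_nonzero: "e \<noteq> 0"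
proof
  assume e: "e = 0"
  have "e * r = r" if "r \<in> K" for r using that by (simp add: K_def)
  then have "r = 0" if "r \<in> K" for r using that e by (metis mult_zero_left)
  then have "K = {0}" using zero_in_K by blast
  then have "card K = 1" by simp
  then show False using card_K l_gt_1 by simp
qed

lemma K_inverse:
  assumes "a \<in> K" "a \<noteq> 0"
  obtains s where "s \<in> K" "s * a = e"
proof -
  have "e * a \<noteq> 0" using assms by (simp add: K_def)
  then obtain s where s: "s * a = e" using e_inverse by blast
  have "(e * s) * a = e" using s assms by (simp add: K_def mult.assoc e_idem)
  moreover have "e * s \<in> K" by (simp add: K_mult_left)
  ultimately show ?thesis using that by blast
qed

lemma K_no_zero_divisors:
  assumes "a \<in> K" "b \<in> K" "a * b = 0"
  shows "a = 0 \<or> b = 0"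
proof (rule ccontr)
  assume nz: "\<not> (a = 0 \<or> b = 0)"
  then obtain s where "s * a = e" using assms K_inverse by metis
  then have "e * b = 0" using assms by (metis mult.assoc mult_zero_right)
  then show False using assms nz by (simp add: K_def)
qed

lemma B_add_right: "B x (y + z) = B x y + B x z"
  and B_scale_right: "B x (r \<star> y) = r * B x y"
  using B_add_left B_scale_left B_sym by metis+

lemma B_zero [simp]: "B 0 x = 0" "B x 0 = 0"
  using B_scale_left[of 0 0 x] B_scale_right[of x 0 0] by simp_all

lemma Q_zero [simp]: "Q 0 = 0"
  using Q_scale[of 0 0] by simp

lemma B_minus_left: "B (- x) y = - B x y" and B_minus_right: "B x (- y) = - B x y"
  using B_scale_left[of "-1" x y] B_scale_right[of x "-1" y] by simp_all

lemma B_diff_left: "B (x - y) z = B x z - B y z" and B_diff_right: "B x (y - z) = B x y - B x z"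
  using B_add_left[of x "- y" z] B_add_right[of x y "- z"] by (simp_all add: B_minus_left B_minus_right)

lemma Q_minus: "Q (- x) = Q x"
  using Q_scale[of "-1" x] by simp

lemma Q_diff: "Q (x - y) = Q x + Q y - B x y"
  using Q_add[of x "- y"] by (simp add: Q_minus B_minus_right)

lemma B_self: "B x x = 2 * Q x"
proof -
  have "Q ((1 + 1) \<star> x) = Q x + Q x + B x x"
    unfolding scale_left_distrib by (simp add: Q_add)
  then show ?thesis by (simp add: Q_scale algebra_simps)
qed

lemmas form_simps = B_add_left B_add_right B_scale_left B_scale_right B_minus_left B_minus_right
  B_diff_left B_diff_right Q_add Q_diff Q_scale Q_minus B_self

lemma V_zero [simp]: "0 \<in> V"
  and V_add: "x \<in> V \<Longrightarrow> y \<in> V \<Longrightarrow> x + y \<in> V"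
  and V_diff: "x \<in> V \<Longrightarrow> y \<in> V \<Longrightarrow> x - y \<in> V"
  and V_uminus: "x \<in> V \<Longrightarrow> - x \<in> V"
  and V_scale: "x \<in> V \<Longrightarrow> r \<star> x \<in> V"
  using V_subspace by (auto simp: subspace_0 subspace_add subspace_diff subspace_neg subspace_scale)

lemmas V_closed = V_add V_diff V_uminus V_scale

lemma Q_in_K: "x \<in> V \<Longrightarrow> Q x \<in> K"
  using Q_scale[of e x] by (simp add: K_def e_scale e_idem)

lemma B_in_K: "x \<in> V \<Longrightarrow> B x y \<in> K"
  using B_scale_left[of e x y] by (simp add: K_def e_scale)

lemma span_in_V: "S \<subseteq> V \<Longrightarrow> span S \<subseteq> V"
  by (rule span_minimal) (auto simp: V_subspace)

text \<open>Dimensions are handled as exponents of \<open>l\<close> in cardinalities; this is the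
  step that adds one dimension. The line through \<open>v\<close> meets \<open>U\<close> only in 0,
  because a nonzero coefficient in \<open>K\<close> can be inverted.\<close>

lemma card_extend:
  assumes U: "subspace U" "U \<subseteq> V" and v: "v \<in> V" "v \<notin> U"
  shows "card {r \<star> v + u |r u. u \<in> U} = l * card U"
proof -
  let ?f = "\<lambda>(r, u). r \<star> v + u"
  have "r = r' \<and> u = u'"
    if "r \<in> K" "r' \<in> K" "u \<in> U" "u' \<in> U" "r \<star> v + u = r' \<star> v + u'" for r r' u u'
  proof -
    note rr = that(1,2)
    have eq: "(r - r') \<star> v = u' - u"
      using that(5) by (simp add: scale_left_diff_distrib algebra_simps) 
    have "r - r' = 0"
    proof (rule ccontr)
      assume "r - r' \<noteq> 0"
      then obtain s where "s * (r - r') = e"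
        using K_inverse[OF K_diff[OF rr]] by blast
      then have "v = s \<star> ((r - r') \<star> v)" by (simp add: e_scale v)
      also have "\<dots> \<in> U" unfolding eq using U that by (intro subspace_scale subspace_diff) auto
      finally show False using v by simp
    qed
    then show ?thesis using that(5) by simp
  qed
  then have "inj_on ?f (K \<times> U)" by (auto simp: inj_on_def)
  then have "card (?f ` (K \<times> U)) = l * card U"
    by (simp add: card_image card_cartesian_product card_K)
  moreover have "?f ` (K \<times> U) = {r \<star> v + u |r u. u \<in> U}"
  proof (intro equalityI subsetI)
    fix x assume "x \<in> {r \<star> v + u |r u. u \<in> U}"
    then obtain r u where x: "x = r \<star> v + u" "u \<in> U" by auto
    \<comment> \<open>\<open>r\<close> ranges over the whole ring, but it acts on \<open>V\<close>
      only through its part \<open>r * e\<close> in \<open>K\<close>.\<close>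
    have "x = ?f (r * e, u)" using x e_scale[OF v(1)] by (simp flip: scale_scale)
    moreover have "r * e \<in> K" by (simp add: K_mult_right)
    ultimately show "x \<in> ?f ` (K \<times> U)" using x by blast
  qed auto
  ultimately show ?thesis by simp
qed

text \<open>A functional that is nonzero at \<open>x0\<close> splits \<open>W\<close> into its
  kernel and the line of \<open>x0\<close>: subtract from \<open>x\<close> the multiple of
  \<open>x0\<close> with the same value.\<close>

lemma card_kernel:
  assumes W: "subspace W" "W \<subseteq> V"
    and f_add: "\<And>x y. x \<in> W \<Longrightarrow> y \<in> W \<Longrightarrow> f (x + y) = f x + f y"
    and f_scale: "\<And>r x. x \<in> W \<Longrightarrow> f (r \<star> x) = r * f x"
    and x0: "x0 \<in> W" "f x0 \<noteq> 0"
  shows "card W = l * card {x \<in> W. f x = 0}"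
proof -
  let ?U = "{x \<in> W. f x = 0}"
  have f0: "f 0 = 0" using f_scale[of x0 0] x0 by simp
  have U: "subspace ?U" "?U \<subseteq> V"
    using W f0 by (auto simp: subspace_def f_add f_scale)
  have fK: "f x \<in> K" if "x \<in> W" for x
    using f_scale[of x e] that W(2) by (auto simp: K_def e_scale)
  obtain s where s: "s * f x0 = e" using K_inverse fK x0 by metis
  have "W = {r \<star> x0 + u |r u. u \<in> ?U}"
  proof (intro equalityI subsetI)
    fix x assume x: "x \<in> W"
    have mem: "x + (- (f x * s)) \<star> x0 \<in> W" using W x x0 by (intro subspace_add subspace_scale) auto
    have "f (x + (- (f x * s)) \<star> x0) = f x - f x * (s * f x0)"
    proof -
      have "f (x + (- (f x * s)) \<star> x0) = f x + f ((- (f x * s)) \<star> x0)"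
        by (rule f_add[OF x subspace_scale[OF W(1) x0(1)]])
      also have "\<dots> = f x + (- (f x * s)) * f x0"
        by (simp only: f_scale[OF x0(1)])
      finally show ?thesis by (simp add: mult.assoc)
    qed
    also have "\<dots> = 0" using fK[OF x] s by (simp add: K_def mult.commute)
    finally have "f (x + (- (f x * s)) \<star> x0) = 0" .
    then have "x + (- (f x * s)) \<star> x0 \<in> ?U" using mem by simp
    moreover have "x = (f x * s) \<star> x0 + (x + (- (f x * s)) \<star> x0)" by simp
    ultimately show "x \<in> {r \<star> x0 + u |r u. u \<in> ?U}" by blast
  qed (use W x0 in \<open>auto intro!: subspace_add subspace_scale\<close>)
  then have "card W = card {r \<star> x0 + u |r u. u \<in> ?U}" by (rule arg_cong)
  also have "\<dots> = l * card ?U" using U x0 W(2) by (intro card_extend) auto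
  finally show ?thesis .
qed

section \<open>Perpendicular spaces and independent lists\<close>

definition perp :: "'v set \<Rightarrow> 'v set" where
  "perp S = {x \<in> V. \<forall>y\<in>S. B x y = 0}"

lemma perpD: "x \<in> perp S \<Longrightarrow> y \<in> S \<Longrightarrow> B x y = 0" "x \<in> perp S \<Longrightarrow> x \<in> V"
  by (auto simp: perp_def)

lemma subspace_perp: "subspace (perp S)" and perp_subset: "perp S \<subseteq> V"
  by (auto simp: perp_def subspace_def V_closed form_simps)

lemma perp_span: "perp (span S) = perp S"
proof
  show "perp S \<subseteq> perp (span S)"
  proof
    fix x assume x: "x \<in> perp S"
    have "subspace {y. B x y = 0}" by (auto simp: subspace_def form_simps)
    then have "span S \<subseteq> {y. B x y = 0}" using x by (intro span_minimal) (auto simp: perp_def)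
    then show "x \<in> perp (span S)" using x by (auto simp: perp_def)
  qed
qed (auto simp: perp_def span_base)

text \<open>Count the pairs \<open>(v, w)\<close> with \<open>B v w = 0\<close> in both orders.\<close>

lemma card_perp:
  assumes W: "subspace W" "W \<subseteq> V"
  shows "card W * card (perp W) = card V"
proof -
  have fW: "finite W" using W finite_V finite_subset by blast
  have W0: "0 \<in> W" using W subspace_0 by blast
  have a: "l * card {v \<in> V. B v w = 0} = (if w = 0 then l * card V else card V)" if w: "w \<in> W" for w
  proof (cases "w = 0")
    case False
    then obtain y where "y \<in> V" "B w y \<noteq> 0" using nondegenerate w W by blast
    then show ?thesis using False
      by (simp add: card_kernel[OF V_subspace order_refl, of "\<lambda>v. B v w" y] form_simps B_sym)
  qed simp
  have b: "l * card {w \<in> W. B v w = 0} = (if v \<in> perp W then l * card W else card W)" if v: "v \<in> V" for v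
  proof (cases "v \<in> perp W")
    case True
    then have "{w \<in> W. B v w = 0} = W" by (auto simp: perp_def)
    then show ?thesis using True by simp
  next
    case False
    then obtain y where "y \<in> W" "B v y \<noteq> 0" using v by (auto simp: perp_def)
    then show ?thesis using False
      by (simp add: card_kernel[OF W, of "\<lambda>w. B v w" y] form_simps)
  qed
  have "(\<Sum>w\<in>W. card {v \<in> V. B v w = 0}) = (\<Sum>v\<in>V. card {w \<in> W. B v w = 0})"
    using sum_multicount_gen[OF fW finite_V, of "\<lambda>w v. B v w = 0" "\<lambda>v. card {w \<in> W. B v w = 0}"] by simp
  \<comment> \<open>The factor \<open>l\<close> keeps both fibre counts free of division. The common
    term \<open>card V * card W\<close> cancels below and leaves the claim multiplied by
    \<open>l - 1\<close>.\<close>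
  then have "(\<Sum>w\<in>W. l * card {v \<in> V. B v w = 0}) = (\<Sum>v\<in>V. l * card {w \<in> W. B v w = 0})"
    by (simp flip: sum_distrib_left)
  then have "(\<Sum>w\<in>W. if w = 0 then l * card V else card V) =
      (\<Sum>v\<in>V. if v \<in> perp W then l * card W else card W)"
    by (simp add: a b cong: sum.cong)
  moreover have "(\<Sum>w\<in>W. if w = 0 then l * card V else card V) = card W * card V + (l - 1) * card V"
  proof -
    have "(\<Sum>w\<in>W. if w = 0 then l * card V else card V) = (\<Sum>w\<in>W. card V + (if w = 0 then (l - 1) * card V else 0))"
      using l_gt_1 by (intro sum.cong) (auto simp: algebra_simps)
    also have "\<dots> = card W * card V + (l - 1) * card V"
      using fW W0 by (simp add: sum.distrib)
    finally show ?thesis .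
  qed
  moreover have "(\<Sum>v\<in>V. if v \<in> perp W then l * card W else card W) = card V * card W + (l - 1) * (card W * card (perp W))"
  proof -
    have "(\<Sum>v\<in>V. if v \<in> perp W then l * card W else card W) = (\<Sum>v\<in>V. card W + (if v \<in> perp W then (l - 1) * card W else 0))"
      using l_gt_1 by (intro sum.cong) (auto simp: algebra_simps)
    also have "\<dots> = card V * card W + (l - 1) * (card W * card (perp W))"
      using finite_V perp_subset[of W] by (simp add: sum.distrib sum.If_cases Int_absorb1)
    finally show ?thesis .
  qed
  ultimately have "(l - 1) * card V = (l - 1) * (card W * card (perp W))" by (simp add: mult.commute)
  then show ?thesis using l_gt_1 by simp
qed

text \<open>Applying \<open>card_perp\<close> to \<open>W\<close> and to \<open>perp W\<close> gives
  equal sizes, so the evident inclusion is an equality, even if \<open>W\<close> meets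
  \<open>perp W\<close>.\<close>

lemma perp_perp:
  assumes W: "subspace W" "W \<subseteq> V"
  shows "perp (perp W) = W"
proof -
  have "W \<subseteq> perp (perp W)" using W by (auto simp: perp_def B_sym)
  moreover have "card W = card (perp (perp W))"
  proof -
    have "card (perp W) * card W = card (perp W) * card (perp (perp W))"
      using card_perp[OF W] card_perp[OF subspace_perp perp_subset, of W] by (simp add: mult.commute)
    moreover have "card (perp W) \<noteq> 0"
      using card_perp[OF W] card_V l_pos by (metis mult_0_right less_irrefl zero_less_power)
    ultimately show ?thesis by simp
  qed
  moreover have "finite (perp (perp W))" using finite_V perp_subset finite_subset by blast
  ultimately show ?thesis by (metis card_subset_eq)
qed

text \<open>Ordered lists with the newest vector in front: Witt extension and the orbit counts then
  advance one vector at a time by list induction.\<close>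

fun indep :: "'v list \<Rightarrow> bool" where
  "indep [] = True"
| "indep (v # vs) = (v \<in> V \<and> v \<notin> span (set vs) \<and> indep vs)"

lemma indep_subset: "indep vs \<Longrightarrow> set vs \<subseteq> V"
  by (induction vs) auto

lemma card_span_insert:
  assumes "S \<subseteq> V" "v \<in> V" "v \<notin> span S"
  shows "card (span (insert v S)) = l * card (span S)"
proof -
  have "span (insert v S) = {r \<star> v + u |r u. u \<in> span S}"
  proof (intro equalityI subsetI)
    fix x assume "x \<in> span (insert v S)"
    then obtain k where "x - k \<star> v \<in> span S" by (auto simp: span_insert)
    moreover have "x = k \<star> v + (x - k \<star> v)" by simp
    ultimately show "x \<in> {r \<star> v + u |r u. u \<in> span S}" by blast
  next
    fix x assume "x \<in> {r \<star> v + u |r u. u \<in> span S}"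
    then obtain r u where "x = r \<star> v + u" "u \<in> span S" by blast
    then have "x - r \<star> v \<in> span S" by simp
    then show "x \<in> span (insert v S)" by (auto simp: span_insert)
  qed
  then show ?thesis using card_extend[OF subspace_span span_in_V[OF assms(1)]] assms by simp
qed

lemma card_span_indep: "indep vs \<Longrightarrow> card (span (set vs)) = l ^ length vs"
  by (induction vs) (auto simp: card_span_insert indep_subset)

lemma card_perp_indep:
  assumes "indep vs"
  shows "card (perp (set vs)) = l ^ (2 * n - length vs)" "length vs \<le> 2 * n"
proof -
  have V: "span (set vs) \<subseteq> V" by (simp add: assms indep_subset span_in_V)
  have eq: "l ^ length vs * card (perp (set vs)) = l ^ (2 * n)"
    using card_perp[OF subspace_span V] by (simp add: perp_span card_span_indep assms card_V)
  have "l ^ length vs \<le> l ^ (2 * n)"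
    using card_mono[OF finite_V V] by (simp add: card_span_indep assms card_V)
  then show len: "length vs \<le> 2 * n" using l_gt_1 by simp
  have "l ^ length vs * card (perp (set vs)) = l ^ length vs * l ^ (2 * n - length vs)"
    using eq len by (simp flip: power_add)
  then show "card (perp (set vs)) = l ^ (2 * n - length vs)" using l_pos by auto
qed

lemma perp_perp_indep: "indep vs \<Longrightarrow> perp (perp (set vs)) = span (set vs)"
  using perp_perp[OF subspace_span span_in_V[OF indep_subset]] by (simp add: perp_span)

text \<open>Greedy extension; it stops because \<open>card_perp_indep\<close> bounds the length by
  \<open>2 * n\<close>.\<close>

lemma indep_spanning:
  assumes U: "subspace U" "U \<subseteq> V"
  obtains vs where "indep vs" "span (set vs) = U"
proof -
  have "\<exists>ws. indep ws \<and> span (set ws) = U" if "indep vs" "set vs \<subseteq> U" for vs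
    using that
  proof (induction "2 * n - length vs" arbitrary: vs rule: less_induct)
    case less
    have sub: "span (set vs) \<subseteq> U" using less.prems U by (intro span_minimal)
    show ?case
    proof (cases "span (set vs) = U")
      case False
      then obtain v where v: "v \<in> U" "v \<notin> span (set vs)" using sub by blast
      then have i: "indep (v # vs)" using less.prems U by auto
      then have "length (v # vs) \<le> 2 * n" by (rule card_perp_indep)
      then show ?thesis using less.hyps[of "v # vs"] i v less.prems by auto
    qed (use less.prems in blast)
  qed
  from this[of "[]"] show ?thesis using that by auto
qed

end

section \<open>The orthogonal group and Witt extension\<close>

lemma even_card_involution:
  assumes "finite A" "\<And>x. x \<in> A \<Longrightarrow> f x \<in> A" "\<And>x. x \<in> A \<Longrightarrow> f (f x) = x" "\<And>x. x \<in> A \<Longrightarrow> f x \<noteq> x"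
  shows "even (card A)"
  using assms
proof (induction A rule: finite_psubset_induct)
  case (psubset A)
  show ?case
  proof (cases "A = {}")
    case False
    then obtain x where x: "x \<in> A" by auto
    let ?A = "A - {x, f x}"
    have "even (card ?A)"
    proof (rule psubset.IH)
      fix y assume y: "y \<in> ?A"
      have "f (f y) = y" "f (f x) = x" using y x psubset.prems(2) by auto
      then have "f y \<noteq> x" "f y \<noteq> f x" using y by auto
      then show "f y \<in> ?A" using y psubset.prems(1) by auto
    qed (use x psubset.prems in auto)
    moreover have "card A = card ?A + card {x, f x}"
      using x psubset.prems(1) psubset.hyps
      by (metis card_Diff_subset card_mono empty_subsetI finite.insertI finite.emptyI insert_subset le_add_diff_inverse2)
    moreover have "card {x, f x} = 2" using psubset.prems(3)[OF x] by simp
    ultimately show ?thesis by simp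
  qed simp
qed

context quad_space begin

text \<open>If \<open>2 * e\<close> were 0, adding \<open>e\<close> would be a fixed-point-free
  involution of \<open>K\<close>, forcing \<open>l\<close> to be even.\<close>

lemma two_e_nonzero: assumes "odd l" shows "2 * e \<noteq> 0"
proof
  assume "2 * e = 0"
  then have e2: "e + e = 0" unfolding mult_2 .
  have "even (card K)"
    by (rule even_card_involution[OF finite_K, of "\<lambda>r. r + e"])
       (use e2 e_nonzero in \<open>auto simp: K_add add.assoc\<close>)
  then show False using assms card_K by simp
qed

lemma two_e_zero: assumes "l = 2" shows "e + e = 0" "K = {0, e}"
proof -
  have "card {0, e} = 2" using e_nonzero by (simp add: card_insert_if)
  then show K: "K = {0, e}"
    using assms card_K finite_K e_in_K zero_in_K
    by (metis card_subset_eq empty_subsetI insert_subset)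
  have "e + e \<in> K" by (rule K_add[OF e_in_K e_in_K])
  moreover have "e + e \<noteq> e" using e_nonzero by (metis add.right_neutral add_left_cancel)
  ultimately show "e + e = 0" using K by blast
qed

lemma two_mult_nonzero: assumes "odd l" "a \<in> K" "a \<noteq> 0" shows "2 * a \<noteq> 0"
proof -
  have "2 * a = (2 * e) * a" using assms(2) by (simp add: K_def mult.assoc)
  moreover have "2 * e \<in> K" by (rule K_mult_right[OF e_in_K])
  ultimately show ?thesis using two_e_nonzero[OF assms(1)] K_no_zero_divisors assms by metis
qed

section \<open>Isometries, reflections and Siegel transformations\<close>

definition kinv :: "'r \<Rightarrow> 'r" where
  "kinv a = (SOME s. s \<in> K \<and> s * a = e)"

lemma kinv: assumes "a \<in> K" "a \<noteq> 0" shows "kinv a \<in> K" "kinv a * a = e"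
proof -
  have "\<exists>s. s \<in> K \<and> s * a = e" using K_inverse[OF assms] by metis
  then have "kinv a \<in> K \<and> kinv a * a = e" unfolding kinv_def by (rule someI_ex)
  then show "kinv a \<in> K" "kinv a * a = e" by auto
qed

text \<open>Elements are functions on the whole type that are the identity off \<open>V\<close>. The
  group operations are thus plain composition and inversion, and equality of isometries is equality
  of functions.\<close>

definition Og :: "('v \<Rightarrow> 'v) set" where
  "Og = {g. g permutes V \<and> (\<forall>x\<in>V. \<forall>y\<in>V. g (x + y) = g x + g y)
        \<and> (\<forall>r. \<forall>x\<in>V. g (r \<star> x) = r \<star> g x) \<and> (\<forall>x\<in>V. Q (g x) = Q x)}"

lemma OgD:
  assumes "g \<in> Og"
  shows "g permutes V" "\<And>x y. x \<in> V \<Longrightarrow> y \<in> V \<Longrightarrow> g (x + y) = g x + g y"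
    "\<And>r x. x \<in> V \<Longrightarrow> g (r \<star> x) = r \<star> g x" "\<And>x. x \<in> V \<Longrightarrow> Q (g x) = Q x"
    "\<And>x. x \<in> V \<Longrightarrow> g x \<in> V" "\<And>x. x \<notin> V \<Longrightarrow> g x = x" "inj g"
proof -
  show p: "g permutes V" using assms by (simp add: Og_def)
  show "inj g" using p by (rule permutes_inj)
  show "\<And>x. x \<in> V \<Longrightarrow> g x \<in> V" using p by (simp add: permutes_in_image)
  show "\<And>x. x \<notin> V \<Longrightarrow> g x = x" using p by (simp add: permutes_not_in)
qed (use assms in \<open>auto simp: Og_def\<close>)

lemma Og_minus: "g \<in> Og \<Longrightarrow> x \<in> V \<Longrightarrow> g (- x) = - g x"
  using OgD(3)[of g x "-1"] by simp

lemma Og_diff: "g \<in> Og \<Longrightarrow> x \<in> V \<Longrightarrow> y \<in> V \<Longrightarrow> g (x - y) = g x - g y"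
  using OgD(2)[of g x "- y"] by (simp add: Og_minus V_uminus)

lemma Og_zero: "g \<in> Og \<Longrightarrow> g 0 = 0"
  using OgD(3)[of g 0 0] by simp

lemma Og_B: "g \<in> Og \<Longrightarrow> x \<in> V \<Longrightarrow> y \<in> V \<Longrightarrow> B (g x) (g y) = B x y"
  using Q_add[of "g x" "g y"] Q_add[of x y] OgD(2,4)[of g] by (metis V_add add_left_cancel)

lemma Og_id: "id \<in> Og"
  by (auto simp: Og_def permutes_id)

lemma Og_comp: "g \<in> Og \<Longrightarrow> h \<in> Og \<Longrightarrow> g \<circ> h \<in> Og"
  unfolding Og_def by (auto simp: permutes_compose permutes_in_image)

lemma Og_inv: assumes g: "g \<in> Og" shows "Hilbert_Choice.inv g \<in> Og"
proof -
  have p: "Hilbert_Choice.inv g permutes V" using OgD(1)[OF g] by (rule permutes_inv)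
  have V: "Hilbert_Choice.inv g x \<in> V" if "x \<in> V" for x using p that by (simp add: permutes_in_image)
  have gi: "g (Hilbert_Choice.inv g x) = x" for x using OgD(1)[OF g] by (rule permutes_inverses)
  have ig: "Hilbert_Choice.inv g y = x" if "y = g x" for x y using that OgD(7)[OF g] by (simp add: inv_f_f)
  show ?thesis unfolding Og_def
    using p by (auto simp: V V_closed gi OgD(2,3)[OF g] intro!: ig) (metis OgD(4)[OF g] V gi)
qed

lemma finite_Og: "finite Og"
  by (rule finite_subset[OF _ finite_permutations[OF finite_V]]) (auto simp: Og_def)

text \<open>Preserving \<open>Q\<close> implies preserving \<open>B\<close>, so nondegeneracy makes
  \<open>f\<close> injective and finiteness makes it bijective. A candidate isometry therefore never
  needs an explicit inverse.\<close>

lemma Og_extend: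
  assumes "\<And>x. x \<in> V \<Longrightarrow> f x \<in> V" "\<And>x y. x \<in> V \<Longrightarrow> y \<in> V \<Longrightarrow> f (x + y) = f x + f y"
    "\<And>r x. x \<in> V \<Longrightarrow> f (r \<star> x) = r \<star> f x" "\<And>x. x \<in> V \<Longrightarrow> Q (f x) = Q x"
  shows "(\<lambda>x. if x \<in> V then f x else x) \<in> Og"
proof -
  have fB: "B (f x) (f y) = B x y" if "x \<in> V" "y \<in> V" for x y
    using Q_add[of "f x" "f y"] Q_add[of x y] assms that by (metis V_add add_left_cancel)
  have "inj_on f V"
  proof (rule inj_onI)
    fix x y assume xy: "x \<in> V" "y \<in> V" "f x = f y"
    have "x - y = 0"
    proof (rule nondegenerate)
      fix z assume z: "z \<in> V"
      have "B x z = B y z" using fB[OF xy(1) z] fB[OF xy(2) z] xy(3) by simp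
      then show "B (x - y) z = 0" by (simp add: form_simps)
    qed (use xy V_diff in auto)
    then show "x = y" by simp
  qed
  then have inj: "inj_on (\<lambda>x. if x \<in> V then f x else x) V" by (auto simp: inj_on_def)
  have "(\<lambda>x. if x \<in> V then f x else x) ` V = V"
    using endo_inj_surj[OF finite_V _ inj] assms(1) by auto
  then have "bij_betw (\<lambda>x. if x \<in> V then f x else x) V V" using inj by (simp add: bij_betw_def)
  then have "(\<lambda>x. if x \<in> V then f x else x) permutes V" by (rule bij_imp_permutes) auto
  then show ?thesis unfolding Og_def using assms by (auto simp: V_closed)
qed

definition refl :: "'v \<Rightarrow> 'v \<Rightarrow> 'v" where
  "refl v = (\<lambda>x. if x \<in> V then x - (B x v * kinv (Q v)) \<star> v else x)"

lemma refl_in_Og: assumes v: "v \<in> V" "Q v \<noteq> 0" shows "refl v \<in> Og"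
  unfolding refl_def
proof (rule Og_extend)
  fix x assume x: "x \<in> V"
  have k: "kinv (Q v) * Q v = e" using kinv[OF Q_in_K] v by simp
  have ek: "e * kinv (Q v) = kinv (Q v)" using kinv[OF Q_in_K] v by (simp add: K_def)
  have "Q (x - (B x v * kinv (Q v)) \<star> v) = Q x + B x v * B x v * (kinv (Q v) * (kinv (Q v) * Q v)) - B x v * kinv (Q v) * B x v"
    by (simp add: form_simps algebra_simps)
  also have "\<dots> = Q x" by (simp only: k) (simp add: ek algebra_simps)
  finally show "Q (x - (B x v * kinv (Q v)) \<star> v) = Q x" .
qed (use v in \<open>auto simp: V_closed form_simps scale_left_distrib scale_right_diff_distrib algebra_simps\<close>)

lemma refl_perp: "B x v = 0 \<Longrightarrow> refl v x = x"
  by (simp add: refl_def)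

text \<open>Since \<open>Q x = Q y\<close>, the pairing \<open>B x (x - y)\<close> equals
  \<open>Q (x - y)\<close>. The coefficient of the reflection is then \<open>e\<close>, and exactly
  \<open>x - y\<close> is subtracted.\<close>

lemma refl_swap:
  assumes "x \<in> V" "y \<in> V" "Q x = Q y" "Q (x - y) \<noteq> 0"
  shows "refl (x - y) x = y"
proof -
  have "B x (x - y) = Q (x - y)" using assms(3) by (simp add: form_simps)
  then show ?thesis using assms kinv(2)[OF Q_in_K, of "x - y"] e_scale[of "x - y"]
    by (simp add: refl_def V_diff mult.commute)
qed

lemma refl_refl: assumes v: "v \<in> V" "Q v \<noteq> 0" shows "refl v (refl v x) = x"
proof (cases "x \<in> V")
  case True
  have k: "kinv (Q v) * Q v = e" using kinv[OF Q_in_K] v by simp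
  have x': "x - (B x v * kinv (Q v)) \<star> v \<in> V" using True v by (simp add: V_closed)
  have "B (x - (B x v * kinv (Q v)) \<star> v) v = B x v - 2 * (B x v * (kinv (Q v) * Q v))"
    by (simp add: form_simps algebra_simps)
  also have "\<dots> = - B x v" using B_in_K[OF True, of v] unfolding k by (simp add: K_def mult.commute)
  finally have "B (x - (B x v * kinv (Q v)) \<star> v) v = - B x v" .
  then show ?thesis using True x' by (simp add: refl_def)
qed (simp add: refl_def)

text \<open>The Siegel (or Eichler) transformation of a singular \<open>u\<close> and a vector
  \<open>y\<close> perpendicular to it. It replaces the reflection in \<open>witt_step\<close> when
  the difference of the two vectors is singular.\<close>

definition siegel :: "'v \<Rightarrow> 'v \<Rightarrow> 'v \<Rightarrow> 'v" where
  "siegel u y = (\<lambda>x. if x \<in> V then x + (B x u \<star> y - (B x y + Q y * B x u) \<star> u) else x)"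

lemma siegel_in_Og:
  assumes "u \<in> V" "y \<in> V" "Q u = 0" "B u y = 0"
  shows "siegel u y \<in> Og"
  unfolding siegel_def
proof (rule Og_extend)
  fix x assume x: "x \<in> V"
  show "Q (x + (B x u \<star> y - (B x y + Q y * B x u) \<star> u)) = Q x"
    using assms B_sym[of y u] by (simp add: form_simps algebra_simps)
qed (use assms in \<open>auto simp: V_closed form_simps scale_left_distrib scale_right_diff_distrib
  scale_right_distrib algebra_simps\<close>)

text \<open>For fixed \<open>u\<close> these transformations compose additively in \<open>y\<close>;
  doubling is the case from which a square root is extracted.\<close>

lemma siegel_square:
  assumes "u \<in> V" "y \<in> V" "Q u = 0" "B u y = 0"
  shows "siegel u y \<circ> siegel u y = siegel u (2 \<star> y)"
proof
  fix x
  show "(siegel u y \<circ> siegel u y) x = siegel u (2 \<star> y) x"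
  proof (cases "x \<in> V")
    case True
    let ?x = "x + (B x u \<star> y - (B x y + Q y * B x u) \<star> u)"
    have "?x \<in> V" using True assms by (simp add: V_closed)
    moreover have "B ?x u = B x u" "B ?x y = B x y + 2 * (Q y * B x u)"
      using assms B_sym[of y u] by (simp_all add: form_simps algebra_simps)
    moreover have "B x u \<star> y + B x u \<star> y = (B x u * 2) \<star> y"
      by (simp add: mult.commute flip: scale_left_distrib)
    moreover have "(B x y + Q y * B x u) \<star> u + (B x y + 2 * (Q y * B x u) + Q y * B x u) \<star> u
      = (B x (2 \<star> y) + Q (2 \<star> y) * B x u) \<star> u"
      by (simp add: form_simps algebra_simps flip: scale_left_distrib)
    ultimately show ?thesis using True by (simp add: siegel_def algebra_simps)
  qed (simp add: siegel_def)
qed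

text \<open>
  Squares are admitted because Siegel transformations are squares for odd \<open>l\<close>, and homomorphisms to a
  group of exponent two do not see them.
\<close>

inductive_set R2 :: "('v \<Rightarrow> 'v) set" where
  R2_id: "id \<in> R2"
| R2_refl: "g \<in> R2 \<Longrightarrow> v \<in> V \<Longrightarrow> Q v \<noteq> 0 \<Longrightarrow> refl v \<circ> g \<in> R2"
| R2_square: "g \<in> R2 \<Longrightarrow> s \<in> Og \<Longrightarrow> (s \<circ> s) \<circ> g \<in> R2"

lemma R2_subset: "g \<in> R2 \<Longrightarrow> g \<in> Og"
  by (induction rule: R2.induct) (intro Og_id Og_comp refl_in_Og | assumption)+

lemma R2_comp: "g \<in> R2 \<Longrightarrow> h \<in> R2 \<Longrightarrow> g \<circ> h \<in> R2"
proof (induction rule: R2.induct)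
  case (R2_refl g v)
  then show ?case using R2.R2_refl[of "g \<circ> h" v] unfolding comp_assoc by blast
next
  case (R2_square g s)
  then show ?case using R2.R2_square[of "g \<circ> h" s] unfolding comp_assoc by blast
qed simp

lemma refl_in_R2: "v \<in> V \<Longrightarrow> Q v \<noteq> 0 \<Longrightarrow> refl v \<in> R2"
  using R2_refl[OF R2_id] by simp

lemma siegel_in_R2:
  assumes "odd l" "u \<in> V" "y \<in> V" "Q u = 0" "B u y = 0"
  shows "siegel u y \<in> R2"
proof -
  have "2 * e \<in> K" by (rule K_mult_right[OF e_in_K])
  \<comment> \<open>\<open>s\<close> is one half in \<open>K\<close>, so the transformation of
    \<open>y\<close> is the square of that of \<open>s \<star> y\<close>.\<close>
  then obtain s where s: "s \<in> K" "s * (2 * e) = e" using K_inverse two_e_nonzero[OF assms(1)] by metis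
  have "s * (2 * e) = 2 * (s * e)" by (rule mult.left_commute)
  also have "s * e = s" using s(1) by (simp add: K_def mult.commute)
  finally have "2 \<star> (s \<star> y) = (s * (2 * e)) \<star> y" by simp
  also have "\<dots> = y" using s assms by (simp add: e_scale)
  finally have "siegel u y = siegel u (s \<star> y) \<circ> siegel u (s \<star> y) \<circ> id"
    using assms by (simp add: siegel_square V_closed form_simps)
  also have "\<dots> \<in> R2" using assms by (intro R2_square R2_id siegel_in_Og) (auto simp: V_closed form_simps)
  finally show ?thesis .
qed

section \<open>Witt extension by one vector\<close>

lemma perp_separates:
  assumes "S \<subseteq> V" "v \<in> V" "v \<notin> span S"
  obtains y where "y \<in> perp S" "B v y = e"
proof -
  have "v \<notin> perp (perp S)"
    using perp_perp[OF subspace_span span_in_V[OF assms(1)]] assms by (simp add: perp_span)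
  then obtain y where y: "y \<in> perp S" "B v y \<noteq> 0" using assms by (auto simp: perp_def)
  then obtain s where "s * B v y = e" using K_inverse B_in_K assms by metis
  then have "B v (s \<star> y) = e" by (simp add: form_simps)
  moreover have "s \<star> y \<in> perp S" using y subspace_perp subspace_scale by blast
  ultimately show ?thesis using that by blast
qed

text \<open>Everything depends on \<open>u = v' - v\<close>, which lies in \<open>perp S\<close>. A
  nonsingular \<open>u\<close> gives a reflection. A singular \<open>u\<close> with \<open>v\<close>
  outside \<open>span (insert u S)\<close> gives a Siegel transformation. If \<open>v\<close> lies
  in that span, two reflections through an intermediate vector do it. Membership in
  \<open>R2\<close> is claimed for odd \<open>l\<close>, where Siegel transformations are
  squares.\<close>

lemma witt_step:
  assumes S: "S \<subseteq> V" and v: "v \<in> V" "v \<notin> span S" and v': "v' \<in> V" "v' \<notin> span S"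
    and Qv: "Q v = Q v'" and Bv: "\<And>w. w \<in> S \<Longrightarrow> B v w = B v' w"
  shows "\<exists>g\<in>Og. (\<forall>w\<in>S. g w = w) \<and> g v = v' \<and> (odd l \<longrightarrow> g \<in> R2)"
proof -
  define u where "u = v' - v"
  have uV: "u \<in> V" using v v' by (simp add: u_def V_diff)
  have uS: "u \<in> perp S" using uV Bv by (auto simp: perp_def u_def form_simps)
  have fixes_S: "refl z w = w" if "z \<in> perp S" "w \<in> S" for z w
    using perpD(1)[OF that] by (simp add: refl_perp B_sym)
  consider "Q u \<noteq> 0" | "Q u = 0" "v \<notin> span (insert u S)" | "Q u = 0" "v \<in> span (insert u S)" by blast
  then show ?thesis
  proof cases
    case 1
    then have Q1: "Q (v - v') \<noteq> 0" using Q_minus[of u] by (simp add: u_def)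
    have "v - v' \<in> perp S" using uS subspace_neg[OF subspace_perp uS] by (simp add: u_def)
    then show ?thesis
      using refl_swap[OF v(1) v'(1) Qv Q1] refl_in_Og[OF V_diff[OF v(1) v'(1)] Q1]
        refl_in_R2[OF V_diff[OF v(1) v'(1)] Q1] fixes_S by blast
  next
    case 2
    obtain y where y: "y \<in> perp (insert u S)" "B v y = e"
      using perp_separates[of "insert u S" v] S uV v 2 by auto
    have yV: "y \<in> V" and yS: "y \<in> perp S" and uy: "B u y = 0"
      using y B_sym by (auto simp: perp_def)
    \<comment> \<open>With \<open>B v u = 0\<close> and \<open>B v y = e\<close>, the Siegel
      transformation of \<open>u\<close> and \<open>- y\<close> adds exactly \<open>u\<close> to
      \<open>v\<close>; it fixes \<open>S\<close> because \<open>u\<close> and \<open>y\<close> are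
      perpendicular to \<open>S\<close>.\<close>
    have Bvu: "B v u = 0" using 2(1) Qv by (simp add: u_def form_simps B_sym[of v' v])
    let ?y = "- y"
    have y'V: "?y \<in> V" and uy': "B u ?y = 0" using yV uy by (auto simp: V_uminus form_simps)
    have "siegel u ?y v = v'"
      using v(1) y(2) e_scale[OF uV] by (simp add: siegel_def Bvu form_simps) (simp add: u_def)
    moreover have "siegel u ?y w = w" if "w \<in> S" for w
      using perpD(1)[OF yS that] perpD(1)[OF uS that] by (simp add: siegel_def B_sym form_simps)
    ultimately show ?thesis
      using siegel_in_Og[OF uV y'V 2(1) uy'] siegel_in_R2[OF _ uV y'V 2(1) uy'] by blast
  next
    case 3
    \<comment> \<open>Now every vector of \<open>perp S\<close> pairs with \<open>v\<close> and
      \<open>v'\<close> through \<open>u\<close> alone, with factors \<open>c\<close> and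
      \<open>c + 1\<close>. Both are nonzero on \<open>K\<close>, since neither \<open>v\<close> nor
      \<open>v'\<close> lies in \<open>span S\<close>.\<close>
    then obtain c where c: "v - c \<star> u \<in> span S" by (auto simp: span_insert)
    have Bz: "B v z = c * B u z" if "z \<in> perp S" for z
    proof -
      have "z \<in> perp (span S)" using that by (simp add: perp_span)
      then have "B z (v - c \<star> u) = 0" using c by (auto simp: perp_def)
      then show ?thesis by (simp add: form_simps B_sym)
    qed
    have Bz': "B v' z = (c + 1) * B u z" if "z \<in> perp S" for z
    proof -
      have "B v' z = B v z + B u z" by (simp add: u_def form_simps)
      then show ?thesis using Bz[OF that] by (simp add: algebra_simps)
    qed
    obtain s where s: "s \<in> perp S" "B v s = e" using perp_separates[OF S v] .
    obtain s' where s': "s' \<in> perp S" "B v' s' = e" using perp_separates[OF S v'] .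
    have sV: "s \<in> V" using s by (simp add: perp_def)
    have us: "B u s \<noteq> 0" using s Bz e_nonzero by force
    \<comment> \<open>If \<open>s\<close> is itself singular, adding the singular \<open>u\<close>
      changes \<open>Q\<close> by \<open>B s u\<close>, which is nonzero.\<close>
    obtain z0 where z0: "z0 \<in> perp S" "Q z0 \<noteq> 0" "B u z0 \<noteq> 0"
    proof (cases "Q s = 0")
      case True
      have "Q (s + u) \<noteq> 0" "B u (s + u) \<noteq> 0" using True us 3 by (simp_all add: form_simps B_sym)
      moreover have "s + u \<in> perp S" using s uS subspace_perp subspace_add by blast
      ultimately show ?thesis using that by blast
    qed (use s us that in blast)
    have z0V: "z0 \<in> V" using z0 by (simp add: perp_def)
    have nzv: "B v z0 \<noteq> 0"
    proof
      assume "B v z0 = 0"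
      then have "(e * c) * B u z0 = 0" using Bz[OF z0(1)] by (simp add: mult.assoc)
      then have "e * c = 0" using K_no_zero_divisors[of "e * c" "B u z0"] z0 uV by (simp add: K_mult_left B_in_K)
      moreover have "B v s = (e * c) * B u s"
        using Bz[OF s(1)] B_in_K[OF uV, of s] by (simp add: K_def algebra_simps)
      ultimately show False using s e_nonzero by simp
    qed
    have nzv': "B v' z0 \<noteq> 0"
    proof
      assume "B v' z0 = 0"
      then have "(e * (c + 1)) * B u z0 = 0" using Bz'[OF z0(1)] by (simp add: mult.assoc)
      then have "e * (c + 1) = 0" using K_no_zero_divisors[of "e * (c + 1)" "B u z0"] z0 uV by (simp add: K_mult_left B_in_K)
      moreover have "B v' s' = (e * (c + 1)) * B u s'"
        using Bz'[OF s'(1)] B_in_K[OF uV, of s'] by (simp add: K_def mult.assoc mult.left_commute[of e])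
      ultimately show False using s' e_nonzero by simp
    qed
    have k: "kinv (Q z0) * Q z0 = e" "kinv (Q z0) \<in> K" using kinv[OF Q_in_K[OF z0V]] z0 by auto
    \<comment> \<open>The scale \<open>t\<close> solves \<open>Q z = - B v z\<close>, so that
      \<open>x = v + z\<close> has the same value of \<open>Q\<close> as \<open>v\<close> and
      \<open>v'\<close>. Then \<open>Q (v - x) = - B v z\<close> and
      \<open>Q (x - v') = - B v' z\<close>, both nonzero by the choice of \<open>z0\<close>.\<close>
    define t where "t = - (B v z0 * kinv (Q z0))"
    define z where "z = t \<star> z0"
    have zS: "z \<in> perp S" unfolding z_def using z0 subspace_perp subspace_scale by blast
    have zV: "z \<in> V" using zS by (simp add: perp_def)
    have tK: "t \<in> K" by (simp add: t_def K_uminus K_mult_right k)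
    have t0: "t \<noteq> 0"
    proof
      assume "t = 0"
      then have "B v z0 * (kinv (Q z0) * Q z0) = 0" by (simp add: t_def mult.assoc[symmetric])
      then show False using k nzv B_in_K[OF v(1), of z0] by (simp add: K_def mult.commute)
    qed
    have tQ: "t * Q z0 = - B v z0"
    proof -
      have "t * Q z0 = - (B v z0 * (kinv (Q z0) * Q z0))" by (simp add: t_def mult.assoc)
      then show ?thesis using k B_in_K[OF v(1), of z0] by (simp add: K_def mult.commute)
    qed
    have Qz: "Q z = - B v z" by (simp add: z_def form_simps tQ mult.assoc)
    have Bvz: "B v z \<noteq> 0" using K_no_zero_divisors[OF tK B_in_K[OF v(1), of z0]] t0 nzv
      by (auto simp: z_def form_simps)
    have Bvz': "B v' z \<noteq> 0" using K_no_zero_divisors[OF tK B_in_K[OF v'(1), of z0]] t0 nzv'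
      by (auto simp: z_def form_simps)
    define x where "x = v + z"
    have xV: "x \<in> V" using v zV by (simp add: x_def V_add)
    have Qx: "Q x = Q v" by (simp add: x_def form_simps Qz)
    have vx: "v - x = - z" by (simp add: x_def)
    have Qvx: "Q (v - x) \<noteq> 0" using Bvz by (simp add: vx Q_minus Qz)
    have xv': "x - v' = z - u" by (simp add: x_def u_def)
    have "Q (x - v') = - B v' z" unfolding xv' using 3(1) Qz by (simp add: u_def form_simps B_sym)
    then have Qxv': "Q (x - v') \<noteq> 0" using Bvz' by simp
    have p1: "v - x \<in> perp S" unfolding vx by (rule subspace_neg[OF subspace_perp zS])
    have p2: "x - v' \<in> perp S" unfolding xv' by (rule subspace_diff[OF subspace_perp zS uS])
    let ?g = "refl (x - v') \<circ> refl (v - x)"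
    have "?g v = v'" using refl_swap[OF v(1) xV Qx[symmetric] Qvx] refl_swap[OF xV v'(1) _ Qxv'] Qx Qv by simp
    moreover have "?g w = w" if "w \<in> S" for w using fixes_S[OF p1 that] fixes_S[OF p2 that] by simp
    moreover have "?g \<in> R2" by (intro R2_comp refl_in_R2 V_diff xV v v' Qvx Qxv')
    ultimately show ?thesis using R2_subset by blast
  qed
qed

end

section \<open>Counting frames\<close>

context quad_space begin

section \<open>Values of the form on perpendicular spaces\<close>

lemma indep_perp_not_isotropic:
  assumes vs: "indep vs" and P: "perp (set vs) \<subseteq> span (set vs)"
  shows "n \<le> length vs"
proof -
  have "finite (span (set vs))" using span_in_V[OF indep_subset[OF vs]] finite_V finite_subset by blast
  then have "card (perp (set vs)) \<le> card (span (set vs))" using P by (rule card_mono)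
  then have "2 * n - length vs \<le> length vs"
    using vs l_gt_1 by (simp add: card_perp_indep card_span_indep)
  then show ?thesis by simp
qed

text \<open>Polarisation: if \<open>Q\<close> vanishes on a subspace, so does \<open>B\<close>. The
  perpendicular space then lies in its own perpendicular space, which is the span.\<close>

lemma singular_perp_isotropic:
  assumes vs: "indep vs" and Q0: "\<And>z. z \<in> perp (set vs) \<Longrightarrow> Q z = 0"
  shows "perp (set vs) \<subseteq> span (set vs)"
proof -
  have "B x y = 0" if "x \<in> perp (set vs)" "y \<in> perp (set vs)" for x y
    using Q0[OF that(1)] Q0[OF that(2)] Q0[OF subspace_add[OF subspace_perp that]] by (simp add: form_simps)
  then have "perp (set vs) \<subseteq> perp (perp (set vs))" by (auto simp: perp_def)
  then show ?thesis by (simp add: perp_perp_indep vs)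
qed

lemma nonsingular_in_perp:
  assumes "indep vs" "length vs < n"
  obtains z where "z \<in> perp (set vs)" "Q z \<noteq> 0"
  using indep_perp_not_isotropic singular_perp_isotropic assms by (metis not_le)

text \<open>Squaring has fibres of size at most two, and the fibre over 0 is a single point because
  \<open>K\<close> has no zero divisors.\<close>

lemma card_squares: "l + 1 \<le> 2 * card ((\<lambda>r. r * r) ` K)"
proof -
  let ?Sq = "(\<lambda>r. r * r) ` K"
  have fib: "card {r \<in> K. r * r = y} \<le> (if y = 0 then 1 else 2)" for y
  proof (cases "\<exists>r0\<in>K. r0 * r0 = y")
    case True
    then obtain r0 where r0: "r0 \<in> K" "r0 * r0 = y" by blast
    have "{r \<in> K. r * r = y} \<subseteq> {r0, - r0}"
    proof
      fix r assume "r \<in> {r \<in> K. r * r = y}"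
      then have r: "r \<in> K" "(r - r0) * (r + r0) = 0" using r0 by (auto simp: algebra_simps)
      then have "r - r0 = 0 \<or> r + r0 = 0" using K_no_zero_divisors K_add K_diff r0 by blast
      then show "r \<in> {r0, - r0}" by (auto simp: add_eq_0_iff2)
    qed
    then have c: "card {r \<in> K. r * r = y} \<le> card {r0, - r0}" by (intro card_mono) auto
    have "r0 = 0" if "y = 0" using r0 that K_no_zero_divisors by blast
    then show ?thesis using c card_insert_le_m1[of 2 "{- r0}" r0] by (auto split: if_splits)
  next
    case False
    then have "{r \<in> K. r * r = y} = {}" by blast
    then show ?thesis by (simp only: card.empty)
  qed
  have f: "finite ?Sq" using finite_K by simp
  have 0: "0 \<in> ?Sq" by (rule image_eqI[of _ _ 0]) auto
  have "l = card K" by (simp add: card_K)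
  also have "\<dots> = (\<Sum>y\<in>?Sq. card {r \<in> K. r * r = y})"
    using sum.image_gen[OF finite_K, of "\<lambda>_. 1::nat" "\<lambda>r. r * r"] by simp
  also have "\<dots> \<le> (\<Sum>y\<in>?Sq. if y = 0 then 1 else 2)" by (intro sum_mono fib)
  also have "\<dots> = 1 + (\<Sum>y\<in>?Sq - {0}. 2)" using f 0 by (subst sum.remove[OF f 0]) simp
  also have "\<dots> = 1 + 2 * (card ?Sq - 1)" using f 0 by simp
  finally have "l \<le> 1 + 2 * (card ?Sq - 1)" .
  moreover have "card ?Sq \<noteq> 0" using f 0 by (metis card_0_eq empty_iff)
  ultimately show ?thesis by simp
qed

text \<open>The values \<open>a * (r * r)\<close> and the values \<open>c - b * (s * s)\<close> each
  fill more than half of \<open>K\<close>, so by the pigeonhole principle they meet.\<close>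

lemma binary_form_universal:
  assumes a: "a \<in> K" "a \<noteq> 0" and b: "b \<in> K" "b \<noteq> 0" and c: "c \<in> K"
  obtains r s where "a * (r * r) + b * (s * s) = c"
proof -
  let ?Sq = "(\<lambda>r. r * r) ` K"
  have SqK: "?Sq \<subseteq> K" by (auto intro: K_mult_left)
  have inj: "inj_on ((*) x) ?Sq" if x: "x \<in> K" "x \<noteq> 0" for x
  proof (rule inj_onI)
    fix y z assume yz: "y \<in> ?Sq" "z \<in> ?Sq" "x * y = x * z"
    then have "x * (y - z) = 0" by (simp add: algebra_simps)
    moreover have "y - z \<in> K" using yz SqK by (intro K_diff) auto
    ultimately show "y = z" using K_no_zero_divisors[OF x(1), of "y - z"] x by auto
  qed
  let ?A = "(*) a ` ?Sq" and ?C = "(\<lambda>y. c - b * y) ` ?Sq"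
  have "inj_on (\<lambda>y. c - b * y) ?Sq" using inj[OF b] by (auto simp: inj_on_def)
  then have cards: "card ?A = card ?Sq" "card ?C = card ?Sq" using inj[OF a] by (simp_all add: card_image)
  have "?A \<inter> ?C \<noteq> {}"
  proof
    assume "?A \<inter> ?C = {}"
    then have "card (?A \<union> ?C) = 2 * card ?Sq"
      using cards finite_K by (subst card_Un_disjoint) auto
    moreover have "?A \<union> ?C \<subseteq> K" using SqK c by (auto intro!: K_mult_right K_diff)
    then have "card (?A \<union> ?C) \<le> l" using card_mono[OF finite_K] card_K by metis
    ultimately show False using card_squares by simp
  qed
  then obtain r s where "a * (r * r) = c - b * (s * s)" by auto
  then show ?thesis using that[of r s] by (simp add: algebra_simps)
qed

text \<open>Two orthogonal nonsingular vectors of the perpendicular space give a diagonal binary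
  form, which is universal. The point is that the perpendicular space, though possibly degenerate,
  has rank at least two.\<close>

lemma perp_represents:
  assumes odd: "odd l" and vs: "indep vs" "length vs < n" and c: "c \<in> K"
  obtains z where "z \<in> perp (set vs)" "Q z = c"
proof -
  obtain x where x: "x \<in> perp (set vs)" "Q x \<noteq> 0" using nonsingular_in_perp[OF vs] .
  have xV: "x \<in> V" using x by (simp add: perp_def)
  have Bxx: "B x x \<noteq> 0" using two_mult_nonzero[OF odd Q_in_K[OF xV] x(2)] by (simp add: B_self)
  have "x \<notin> perp (perp (set vs))" using x Bxx by (auto simp: perp_def)
  then have xs: "x \<notin> span (set vs)" by (simp add: perp_perp_indep vs)
  then have vs': "indep (x # vs)" using vs xV by simp
  \<comment> \<open>Otherwise the perpendicular space lies in the span, which is possible only at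
    the critical length \<open>n\<close>. There the two coincide, and \<open>x\<close> would be
    perpendicular to itself.\<close>
  have "\<exists>y\<in>perp (set (x # vs)). Q y \<noteq> 0"
  proof (rule ccontr)
    assume "\<not> ?thesis"
    then have sub: "perp (set (x # vs)) \<subseteq> span (set (x # vs))"
      using singular_perp_isotropic[OF vs'] by blast
    then have "n \<le> length (x # vs)" using indep_perp_not_isotropic[OF vs'] by blast
    then have "2 * n - length (x # vs) = length (x # vs)" using vs by simp
    then have "card (perp (set (x # vs))) = card (span (set (x # vs)))"
      by (simp only: card_perp_indep[OF vs'] card_span_indep[OF vs'])
    moreover have "finite (span (set (x # vs)))"
      using span_in_V[OF indep_subset[OF vs']] finite_V finite_subset by blast
    ultimately have "perp (set (x # vs)) = span (set (x # vs))" using sub card_subset_eq by blast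
    then have "x \<in> perp (set (x # vs))" by (simp add: span_base)
    then show False using Bxx by (simp add: perp_def)
  qed
  then obtain y where y: "y \<in> perp (set (x # vs))" "Q y \<noteq> 0" by blast
  have yV: "y \<in> V" and yvs: "y \<in> perp (set vs)" and xy: "B x y = 0"
    using y B_sym by (auto simp: perp_def)
  obtain r s where rs: "Q x * (r * r) + Q y * (s * s) = c"
    using binary_form_universal[OF Q_in_K[OF xV] x(2) Q_in_K[OF yV] y(2) c] .
  have "Q (r \<star> x + s \<star> y) = c" using rs xy by (simp add: form_simps algebra_simps)
  moreover have "r \<star> x + s \<star> y \<in> perp (set vs)"
    using x yvs by (intro subspace_add subspace_scale subspace_perp)
  ultimately show ?thesis using that by blast
qed

text \<open>For odd \<open>l\<close>, add orthogonal vectors with values \<open>e\<close> and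
  \<open>- e\<close>. For \<open>l = 2\<close>, of two orthogonal vectors either one is singular, or
  both have value \<open>e\<close> and their sum is singular. Being outside the span lets the vector
  have a dual partner in \<open>perp (set vs)\<close>.\<close>

lemma singular_in_perp:
  assumes vs: "indep vs" "Suc (length vs) < n"
  obtains t where "t \<in> perp (set vs)" "t \<notin> span (set vs)" "Q t = 0"
proof (cases "l = 2")
  case True
  obtain x where x: "x \<in> perp (set vs)" "x \<notin> span (set vs)"
    using indep_perp_not_isotropic[OF vs(1)] vs(2) by fastforce
  then have vs': "indep (x # vs)" using vs by (simp add: perp_def)
  obtain y where y: "y \<in> perp (set (x # vs))" "y \<notin> span (set (x # vs))"
    using indep_perp_not_isotropic[OF vs'] vs(2) by fastforce
  have yvs: "y \<in> perp (set vs)" and xy: "B x y = 0" using y B_sym by (auto simp: perp_def)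
  have ysp: "y \<notin> span (set vs)" using y(2) span_mono[of "set vs" "set (x # vs)"] by auto
  have QK: "Q x = 0 \<or> Q x = e" "Q y = 0 \<or> Q y = e"
    using Q_in_K perpD(2) x(1) y(1) two_e_zero(2)[OF True] by blast+
  show ?thesis
  proof (cases "Q x = 0 \<or> Q y = 0")
    case False
    then have "Q x = e" "Q y = e" using QK by auto
    then have "Q (x + y) = 0" using two_e_zero(1)[OF True] by (simp only: Q_add xy add_0_right)
    moreover have "x + y \<in> perp (set vs)" using x yvs by (intro subspace_add subspace_perp)
    moreover have "x + y \<notin> span (set vs)"
    proof
      assume "x + y \<in> span (set vs)"
      then have "x + y \<in> span (set (x # vs))" using span_mono[of "set vs" "set (x # vs)"] by auto
      moreover have "x \<in> span (set (x # vs))" by (simp add: span_base)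
      ultimately have "(x + y) - x \<in> span (set (x # vs))" by (rule span_diff)
      then show False using y(2) by simp
    qed
    ultimately show ?thesis using that by blast
  qed (use that x yvs ysp in blast)
next
  case False
  then have odd: "odd l" using prime_l prime_odd_nat l_gt_1 by (metis le_neq_implies_less less_eq_Suc_le numeral_2_eq_2 One_nat_def)
  obtain z where z: "z \<in> perp (set vs)" "Q z = e"
    using perp_represents[OF odd vs(1) _ e_in_K] vs(2) by (metis Suc_lessD)
  have zV: "z \<in> V" using z by (simp add: perp_def)
  have Bzz: "B z z \<noteq> 0" using two_e_nonzero[OF odd] by (simp add: B_self z)
  have "z \<notin> perp (perp (set vs))" using z Bzz by (auto simp: perp_def)
  then have "z \<notin> span (set vs)" by (simp add: perp_perp_indep vs)
  then have vs': "indep (z # vs)" using vs zV by simp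
  obtain y where y: "y \<in> perp (set (z # vs))" "Q y = - e"
    using perp_represents[OF odd vs' _ K_uminus[OF e_in_K]] vs(2) by auto
  have yvs: "y \<in> perp (set vs)" and zy: "B z y = 0" using y B_sym by (auto simp: perp_def)
  have t: "z + y \<in> perp (set vs)" using z yvs by (intro subspace_add subspace_perp)
  have "B (z + y) z \<noteq> 0" using Bzz zy by (simp add: form_simps B_sym)
  then have "z + y \<notin> perp (perp (set vs))" using z by (auto simp: perp_def)
  then have "z + y \<notin> span (set vs)" by (simp add: perp_perp_indep vs)
  moreover have "Q (z + y) = 0" using z y zy by (simp add: form_simps)
  ultimately show ?thesis using that t by blast
qed

text \<open>Induction on the list: the pairing with the newest \<open>w\<close> is corrected by a
  vector dual to \<open>w\<close> and perpendicular to the rest.\<close>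

lemma linear_system_solvable:
  assumes "indep vs" "length as = length vs" "set as \<subseteq> K"
  shows "\<exists>v\<in>V. map (B v) vs = as"
  using assms
proof (induction vs arbitrary: as)
  case (Cons w vs)
  then obtain a as' where as: "as = a # as'" by (cases as) auto
  then obtain v where v: "v \<in> V" "map (B v) vs = as'" using Cons by force
  obtain y where y: "y \<in> perp (set vs)" "B w y = e"
    using perp_separates[of "set vs" w] Cons.prems indep_subset by auto
  define c where "c = a - B v w"
  have "c \<in> K" using as Cons.prems v by (simp add: c_def K_diff B_in_K)
  then have "B (v + c \<star> y) w = a" using y by (simp add: form_simps B_sym[of y w] K_def c_def mult.commute)
  moreover have "map (B (v + c \<star> y)) vs = as'"
  proof -
    have "B (v + c \<star> y) x = B v x" if "x \<in> set vs" for x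
      using perpD(1)[OF y(1) that] by (simp add: form_simps)
    then show ?thesis using v(2) by (metis map_cong)
  qed
  moreover have "v + c \<star> y \<in> V" using v y by (simp add: V_closed perp_def)
  ultimately show ?case using as by (auto intro!: bexI[of _ "v + c \<star> y"])
qed (use V_zero in \<open>auto intro: exI[of _ 0]\<close>)

text \<open>A vector \<open>v0\<close> with the right pairings is corrected twice inside
  \<open>perp (set vs)\<close>, which leaves those pairings alone. A multiple of \<open>s\<close>
  makes the pairing with the singular \<open>t\<close> equal to \<open>e\<close>; then adding
  \<open>x \<star> t\<close> changes \<open>Q\<close> by exactly \<open>x\<close>. The pairing with
  \<open>t\<close> also keeps the result outside the span.\<close>

lemma data_realised:
  assumes vs: "indep vs" "Suc (length vs) < n" and as: "length as = length vs" "set as \<subseteq> K" and c: "c \<in> K"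
  shows "\<exists>v\<in>V - span (set vs). Q v = c \<and> map (B v) vs = as"
proof -
  obtain v0 where v0: "v0 \<in> V" "map (B v0) vs = as" using linear_system_solvable[OF vs(1) as] by blast
  obtain t where t: "t \<in> perp (set vs)" "t \<notin> span (set vs)" "Q t = 0" using singular_in_perp[OF vs] .
  have tV: "t \<in> V" using t by (simp add: perp_def)
  obtain s where s: "s \<in> perp (set vs)" "B t s = e"
    using perp_separates[OF indep_subset[OF vs(1)] tV t(2)] .
  have sV: "s \<in> V" using s by (simp add: perp_def)
  define y where "y = e - B v0 t"
  define v1 where "v1 = v0 + y \<star> s"
  have "y \<in> K" using v0 by (simp add: y_def K_diff B_in_K)
  then have v1t: "B v1 t = e"
    using s by (simp add: v1_def form_simps B_sym[of s t] K_def mult.commute y_def)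
  define x where "x = c - Q v1"
  define v where "v = v1 + x \<star> t"
  have v1V: "v1 \<in> V" using v0 sV by (simp add: v1_def V_closed)
  have vV: "v \<in> V" using v1V tV by (simp add: v_def V_closed)
  have "x \<in> K" using c v1V by (simp add: x_def K_diff Q_in_K)
  then have "Q v = c" using t v1t by (simp add: v_def form_simps K_def mult.commute x_def)
  moreover have "map (B v) vs = as"
  proof -
    have "B v w = B v0 w" if "w \<in> set vs" for w
      using perpD(1)[OF t(1) that] perpD(1)[OF s(1) that] by (simp add: v_def v1_def form_simps)
    then show ?thesis using v0(2) by (metis map_cong)
  qed
  moreover have "v \<notin> span (set vs)"
  proof
    assume "v \<in> span (set vs)"
    then have "B t v = 0" using t(1) perpD(1) by (metis perp_span)
    moreover have "B t v = e" using v1t t by (simp add: v_def form_simps B_sym[of t v1])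
    ultimately show False using e_nonzero by simp
  qed
  ultimately show ?thesis using vV by blast
qed

section \<open>Orbits of pointwise stabilisers\<close>

definition Stab :: "'v list \<Rightarrow> ('v \<Rightarrow> 'v) set" where
  "Stab vs = {g \<in> Og. \<forall>w\<in>set vs. g w = w}"

lemma finite_Stab: "finite (Stab vs)"
  by (rule finite_subset[OF _ finite_Og]) (auto simp: Stab_def)

lemma Stab_comp: "g \<in> Stab vs \<Longrightarrow> h \<in> Stab vs \<Longrightarrow> g \<circ> h \<in> Stab vs"
  by (auto simp: Stab_def Og_comp)

lemma Stab_inv: "g \<in> Stab vs \<Longrightarrow> Hilbert_Choice.inv g \<in> Stab vs"
  by (auto simp: Stab_def Og_inv) (metis OgD(7) inv_f_f)

lemma Stab_fix_span:
  assumes "g \<in> Stab vs" "set vs \<subseteq> V" "x \<in> span (set vs)"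
  shows "g x = x"
proof -
  have g: "g \<in> Og" using assms by (simp add: Stab_def)
  have "subspace {x \<in> V. g x = x}"
    by (auto simp: subspace_def V_closed Og_zero[OF g] OgD(2,3)[OF g])
  then have "span (set vs) \<subseteq> {x \<in> V. g x = x}"
    using assms by (intro span_minimal) (auto simp: Stab_def)
  then show ?thesis using assms by blast
qed

text \<open>A complete invariant: by \<open>witt_step\<close>, two vectors outside
  \<open>span (set vs)\<close> lie in one orbit of \<open>Stab vs\<close> exactly if these data
  agree.\<close>

definition data :: "'v list \<Rightarrow> 'v \<Rightarrow> 'r \<times> 'r list" where
  "data vs v = (Q v, map (B v) vs)"

text \<open>Orbit-stabiliser theorem: over one orbit the orders of the point stabilisers add up to
  the order of \<open>Stab vs\<close>, and the orbits are the fibres of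
  \<open>data vs\<close>.\<close>

lemma orbit_sum:
  assumes vs: "indep vs"
  shows "(\<Sum>v\<in>V - span (set vs). card (Stab (v # vs)))
    = card (Stab vs) * card (data vs ` (V - span (set vs)))"
proof -
  let ?A = "V - span (set vs)"
  have fA: "finite ?A" using finite_V by simp
  have vsV: "set vs \<subseteq> V" by (rule indep_subset[OF vs])
  have fibre: "(\<Sum>v\<in>{v \<in> ?A. data vs v = d}. card (Stab (v # vs))) = card (Stab vs)"
    if d: "d \<in> data vs ` ?A" for d
  proof -
    obtain v0 where v0: "v0 \<in> ?A" "d = data vs v0" using d by blast
    let ?F = "{v \<in> ?A. data vs v = d}"
    have "card (Stab (v # vs)) = card {g \<in> Stab vs. g v0 = v}" if v: "v \<in> ?F" for v
    proof -
      have "Q v0 = Q v" "\<And>w. w \<in> set vs \<Longrightarrow> B v0 w = B v w"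
        using v v0(2) by (auto simp: data_def)
      \<comment> \<open>Composing with a transporter \<open>h\<close> from \<open>v0\<close> to
        \<open>v\<close> turns \<open>Stab (v # vs)\<close> into the coset that sends
        \<open>v0\<close> to \<open>v\<close>; these cosets partition
        \<open>Stab vs\<close>.\<close>
      then obtain h where h: "h \<in> Stab vs" "h v0 = v"
        using witt_step[OF vsV, of v0 v] v v0 by (auto simp: Stab_def)
      have hinv: "Hilbert_Choice.inv h v = v0" using h by (metis (no_types, lifting) Stab_def OgD(7) inv_f_f mem_Collect_eq)
      have hi: "h \<circ> Hilbert_Choice.inv h = id" "Hilbert_Choice.inv h \<circ> h = id"
        using h OgD(1)[of h] permutes_inv_o by (auto simp: Stab_def)
      have "bij_betw (\<lambda>g. g \<circ> h) (Stab (v # vs)) {g \<in> Stab vs. g v0 = v}"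
      proof (rule bij_betwI[where g = "\<lambda>g. g \<circ> Hilbert_Choice.inv h"])
        show "(\<lambda>g. g \<circ> h) \<in> Stab (v # vs) \<rightarrow> {g \<in> Stab vs. g v0 = v}"
          using h Stab_comp by (auto simp: Stab_def Og_comp)
        show "(\<lambda>g. g \<circ> Hilbert_Choice.inv h) \<in> {g \<in> Stab vs. g v0 = v} \<rightarrow> Stab (v # vs)"
        proof
          fix g assume "g \<in> {g \<in> Stab vs. g v0 = v}"
          then have "g \<circ> Hilbert_Choice.inv h \<in> Stab vs" "(g \<circ> Hilbert_Choice.inv h) v = v"
            using h hinv Stab_comp Stab_inv by auto
          then show "g \<circ> Hilbert_Choice.inv h \<in> Stab (v # vs)" by (simp add: Stab_def)
        qed
      qed (simp_all only: comp_assoc hi comp_id)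
      then show ?thesis by (rule bij_betw_same_card)
    qed
    then have "(\<Sum>v\<in>?F. card (Stab (v # vs))) = (\<Sum>v\<in>?F. \<Sum>g\<in>{g \<in> Stab vs. g v0 = v}. 1)"
      by (intro sum.cong) auto
    also have "\<dots> = (\<Sum>g\<in>Stab vs. 1)"
    proof (rule sum.group[OF finite_Stab])
      show "finite ?F" by (rule finite_subset[OF _ finite_V]) auto
      show "(\<lambda>g. g v0) ` Stab vs \<subseteq> ?F"
      proof clarify
        fix g assume g: "g \<in> Stab vs"
        then have gO: "g \<in> Og" by (simp add: Stab_def)
        have v0V: "v0 \<in> V" using v0 by simp
        have "g v0 \<notin> span (set vs)"
        proof
          assume a: "g v0 \<in> span (set vs)"
          then have "g (g v0) = g v0" using Stab_fix_span[OF g vsV] by blast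
          then have "g v0 = v0" using OgD(7)[OF gO] by (simp add: inj_eq)
          then show False using a v0 by simp
        qed
        moreover have "B (g v0) w = B v0 w" if "w \<in> set vs" for w
        proof -
          have "g w = w" "w \<in> V" using g that vsV by (auto simp: Stab_def)
          then show ?thesis using Og_B[OF gO v0V, of w] by simp
        qed
        ultimately show "g v0 \<in> ?A \<and> data vs (g v0) = d"
          using v0 OgD(4,5)[OF gO v0V] by (auto simp: data_def)
      qed
    qed
    finally show ?thesis by simp
  qed
  have "(\<Sum>v\<in>?A. card (Stab (v # vs)))
      = (\<Sum>d\<in>data vs ` ?A. \<Sum>v\<in>{v \<in> ?A. data vs v = d}. card (Stab (v # vs)))"
    by (rule sum.image_gen[OF fA])
  also have "\<dots> = (\<Sum>d\<in>data vs ` ?A. card (Stab vs))" by (rule sum.cong[OF HOL.refl fibre])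
  finally show ?thesis by (simp add: mult.commute)
qed

text \<open>The unconditional upper bound feeds the lower bound for the order of \<open>Og\<close>;
  the equality, which rests on \<open>data_realised\<close>, feeds the moments.\<close>

lemma card_data:
  assumes "indep vs"
  shows "card (data vs ` (V - span (set vs))) \<le> l ^ Suc (length vs)"
    and "Suc (length vs) < n \<Longrightarrow> card (data vs ` (V - span (set vs))) = l ^ Suc (length vs)"
proof -
  let ?D = "K \<times> {as. set as \<subseteq> K \<and> length as = length vs}"
  have D: "card ?D = l ^ Suc (length vs)" "finite ?D"
    using finite_K card_lists_length_eq[OF finite_K] finite_lists_length_eq[OF finite_K]
    by (simp_all add: card_cartesian_product card_K)
  have sub: "data vs ` (V - span (set vs)) \<subseteq> ?D" by (auto simp: data_def Q_in_K B_in_K)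
  show "card (data vs ` (V - span (set vs))) \<le> l ^ Suc (length vs)"
    using card_mono[OF D(2) sub] D(1) by simp
  assume len: "Suc (length vs) < n"
  have "?D \<subseteq> data vs ` (V - span (set vs))"
  proof
    fix p assume "p \<in> ?D"
    then obtain c as where p: "p = (c, as)" "c \<in> K" "length as = length vs" "set as \<subseteq> K" by auto
    then obtain v where "v \<in> V - span (set vs)" "Q v = c" "map (B v) vs = as"
      using data_realised[OF assms len] by blast
    then show "p \<in> data vs ` (V - span (set vs))" using p by (auto simp: data_def intro!: image_eqI)
  qed
  then have "data vs ` (V - span (set vs)) = ?D" using sub by blast
  then show "card (data vs ` (V - span (set vs))) = l ^ Suc (length vs)" using D(1) by simp
qed

section \<open>Summation over frames\<close>

definition frames :: "'v set \<Rightarrow> nat \<Rightarrow> 'v list set" where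
  "frames U m = {vs. length vs = m \<and> indep vs \<and> set vs \<subseteq> U}"

lemma frames_0: "frames U 0 = {[]}"
  by (auto simp: frames_def)

lemma frames_Suc:
  assumes "U \<subseteq> V"
  shows "frames U (Suc m) = (\<lambda>(vs, v). v # vs) ` (SIGMA vs:frames U m. U - span (set vs))"
proof (intro equalityI subsetI)
  fix ws assume "ws \<in> frames U (Suc m)"
  then show "ws \<in> (\<lambda>(vs, v). v # vs) ` (SIGMA vs:frames U m. U - span (set vs))"
    by (cases ws) (auto simp: frames_def intro!: image_eqI)
qed (use assms in \<open>auto simp: frames_def\<close>)

lemma finite_frames: "U \<subseteq> V \<Longrightarrow> finite (frames U m)"
  by (rule finite_subset[OF _ finite_lists_length_eq[OF finite_V, of m]]) (auto simp: frames_def)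

lemma sum_frames_Suc:
  assumes "U \<subseteq> V"
  shows "(\<Sum>ws\<in>frames U (Suc m). f ws) = (\<Sum>vs\<in>frames U m. \<Sum>v\<in>U - span (set vs). f (v # vs))"
proof -
  have "(\<Sum>ws\<in>frames U (Suc m). f ws) = (\<Sum>p\<in>(SIGMA vs:frames U m. U - span (set vs)). f (snd p # fst p))"
    unfolding frames_Suc[OF assms] by (subst sum.reindex) (auto simp: inj_on_def case_prod_beta)
  also have "\<dots> = (\<Sum>vs\<in>frames U m. \<Sum>v\<in>U - span (set vs). f (v # vs))"
    using finite_frames[OF assms] finite_subset[OF assms finite_V]
    by (subst sum.Sigma) (auto simp: case_prod_beta)
  finally show ?thesis .
qed

lemma card_frames:
  assumes U: "subspace U" "U \<subseteq> V"
  shows "card (frames U m) = (\<Prod>i<m. card U - l ^ i)"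
proof (induction m)
  case (Suc m)
  have "card (U - span (set vs)) = card U - l ^ m" if "vs \<in> frames U m" for vs
  proof -
    have vs: "indep vs" "set vs \<subseteq> U" "length vs = m" using that by (auto simp: frames_def)
    have "span (set vs) \<subseteq> U" using vs U by (intro span_minimal)
    then show ?thesis using vs card_span_indep[OF vs(1)] finite_subset[OF U(2) finite_V]
      by (metis card_Diff_subset finite_subset)
  qed
  then have "(\<Sum>vs\<in>frames U m. card (U - span (set vs))) = card (frames U m) * (card U - l ^ m)"
    by simp
  then show ?case using sum_frames_Suc[OF U(2), of "\<lambda>_. 1::nat" m] Suc by simp
qed (simp add: frames_0)

lemma sum_card_Stab_Suc:
  "(\<Sum>vs\<in>frames V (Suc m). card (Stab vs)) \<le> l ^ Suc m * (\<Sum>vs\<in>frames V m. card (Stab vs))"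
  "Suc m < n \<Longrightarrow> (\<Sum>vs\<in>frames V (Suc m). card (Stab vs)) = l ^ Suc m * (\<Sum>vs\<in>frames V m. card (Stab vs))"
proof -
  have eq: "(\<Sum>vs\<in>frames V (Suc m). card (Stab vs))
      = (\<Sum>vs\<in>frames V m. card (Stab vs) * card (data vs ` (V - span (set vs))))"
    unfolding sum_frames_Suc[OF order_refl] by (intro sum.cong) (auto simp: orbit_sum frames_def)
  show "(\<Sum>vs\<in>frames V (Suc m). card (Stab vs)) \<le> l ^ Suc m * (\<Sum>vs\<in>frames V m. card (Stab vs))"
    unfolding eq sum_distrib_left
  proof (rule sum_mono)
    fix vs assume "vs \<in> frames V m"
    then have "card (data vs ` (V - span (set vs))) \<le> l ^ Suc m"
      using card_data(1)[of vs] by (auto simp: frames_def)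
    then show "card (Stab vs) * card (data vs ` (V - span (set vs))) \<le> l ^ Suc m * card (Stab vs)"
      by (subst mult.commute) (rule mult_right_mono, auto)
  qed
  assume m: "Suc m < n"
  show "(\<Sum>vs\<in>frames V (Suc m). card (Stab vs)) = l ^ Suc m * (\<Sum>vs\<in>frames V m. card (Stab vs))"
    unfolding eq sum_distrib_left
  proof (rule sum.cong)
    fix vs assume "vs \<in> frames V m"
    then have "card (data vs ` (V - span (set vs))) = l ^ Suc m"
      using card_data(2)[of vs] m by (auto simp: frames_def)
    then show "card (Stab vs) * card (data vs ` (V - span (set vs))) = l ^ Suc m * card (Stab vs)"
      by (simp add: mult.commute)
  qed simp
qed

lemma triangle_Suc: "Suc m * (Suc m + 1) div 2 = m * (m + 1) div 2 + Suc m"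
proof -
  have "Suc m * (Suc m + 1) = m * (m + 1) + Suc m * 2" by (simp add: algebra_simps)
  then show ?thesis by simp
qed

text \<open>The sum counts pairs of an isometry and an \<open>m\<close>-frame fixed by it. The step
  to \<open>Suc m\<close> multiplies it by the number of orbits, \<open>l ^ Suc m\<close>, whence
  the triangular exponent.\<close>

lemma sum_card_Stab:
  "(\<Sum>vs\<in>frames V m. card (Stab vs)) \<le> l ^ (m * (m + 1) div 2) * card Og"
  "m < n \<Longrightarrow> (\<Sum>vs\<in>frames V m. card (Stab vs)) = l ^ (m * (m + 1) div 2) * card Og"
proof (induction m)
  case 0
  { case 1 show ?case by (simp add: frames_0 Stab_def)
  next case 2 show ?case by (simp add: frames_0 Stab_def) }
next
  case (Suc m)
  { case 1
    have "(\<Sum>vs\<in>frames V (Suc m). card (Stab vs)) \<le> l ^ Suc m * (l ^ (m * (m + 1) div 2) * card Og)"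
      using sum_card_Stab_Suc(1)[of m] Suc.IH(1) by (meson le_trans mult_le_mono2)
    then show ?case unfolding triangle_Suc power_add by (simp add: mult_ac)
  next
    case 2
    have "(\<Sum>vs\<in>frames V (Suc m). card (Stab vs)) = l ^ Suc m * (l ^ (m * (m + 1) div 2) * card Og)"
      using sum_card_Stab_Suc(2)[of m] Suc.IH(2) 2 by simp
    then show ?case unfolding triangle_Suc power_add by (simp add: mult_ac)
  }
qed

text \<open>For \<open>m = 2 * n\<close> the frames are bases of \<open>V\<close>, and each
  stabiliser contains \<open>id\<close>. The upper bound in \<open>sum_card_Stab\<close> therefore
  bounds the number of bases.\<close>

lemma card_Og_lower: "(\<Prod>i<2*n. l ^ (2*n) - l ^ i) \<le> l ^ (n * (2 * n + 1)) * card Og"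
proof -
  have "(\<Prod>i<2*n. l ^ (2*n) - l ^ i) = (\<Sum>vs\<in>frames V (2*n). 1)"
    using card_frames[OF V_subspace order_refl] by (simp add: card_V)
  also have "\<dots> \<le> (\<Sum>vs\<in>frames V (2*n). card (Stab vs))"
  proof (rule sum_mono)
    fix vs
    have "id \<in> Stab vs" by (simp add: Stab_def Og_id)
    then show "1 \<le> card (Stab vs)" using finite_Stab[of vs] by (metis One_nat_def Suc_leI card_gt_0_iff empty_iff)
  qed
  also have "\<dots> \<le> l ^ ((2*n) * (2*n + 1) div 2) * card Og" by (rule sum_card_Stab)
  also have "(2*n) * (2*n + 1) div 2 = n * (2 * n + 1)" by (simp add: mult.assoc)
  finally show ?thesis .
qed

end

section \<open>Fixed spaces and generation by reflections\<close>

text \<open>Two commuting involutions generate a Klein four-group, which acts freely here; the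
  induction removes one orbit at a time.\<close>

lemma four_dvd_card:
  assumes "finite A" "\<And>x. x \<in> A \<Longrightarrow> f x \<in> A" "\<And>x. x \<in> A \<Longrightarrow> g x \<in> A"
    "\<And>x. x \<in> A \<Longrightarrow> f (f x) = x" "\<And>x. x \<in> A \<Longrightarrow> g (g x) = x" "\<And>x. x \<in> A \<Longrightarrow> f (g x) = g (f x)"
    "\<And>x. x \<in> A \<Longrightarrow> f x \<noteq> x" "\<And>x. x \<in> A \<Longrightarrow> g x \<noteq> x" "\<And>x. x \<in> A \<Longrightarrow> f x \<noteq> g x"
  shows "4 dvd card A"
  using assms
proof (induction A rule: finite_psubset_induct)
  case (psubset A)
  note p = psubset.prems
  show ?case
  proof (cases "A = {}")
    case False
    then obtain x where x: "x \<in> A" by auto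
    let ?X = "{x, f x, g x, f (g x)}"
    have X: "?X \<subseteq> A" using x p by auto
    have fX: "f y \<in> ?X" "g y \<in> ?X" if "y \<in> ?X" for y using that x p by auto
    have "4 dvd card (A - ?X)"
    proof (rule psubset.IH)
      fix y assume y: "y \<in> A - ?X"
      have "f y \<notin> ?X" using fX(1)[of "f y"] p(3)[of y] y by auto
      then show "f y \<in> A - ?X" using y p(1) by auto
      have "g y \<notin> ?X" using fX(2)[of "g y"] p(4)[of y] y by auto
      then show "g y \<in> A - ?X" using y p(2) by auto
    qed (use x p in auto)
    moreover have "card A = card (A - ?X) + card ?X"
      using X psubset.hyps by (metis card_Diff_subset card_mono finite_subset le_add_diff_inverse2)
    moreover have "card ?X = 4"
    proof -
      have gx: "g x \<in> A" using x p by auto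
      have "f (g x) \<noteq> x" using p(3)[OF gx] p(8)[OF x] by metis
      moreover have "f (g x) \<noteq> f x" using p(3)[OF gx] p(3)[OF x] p(7)[OF x] by metis
      ultimately have "distinct [x, f x, g x, f (g x)]" using p(6)[OF x] p(7)[OF x] p(8)[OF x] p(6)[OF gx] by auto
      then have "card (set [x, f x, g x, f (g x)]) = length [x, f x, g x, f (g x)]" by (rule distinct_card)
      then show ?thesis by simp
    qed
    ultimately show ?thesis by simp
  qed simp
qed

text \<open>An involution is a product of disjoint transpositions, one for each pair of moved
  points; the induction splits off one of them.\<close>

lemma sign_involution:
  assumes "finite S" "p permutes S" "\<And>x. p (p x) = x"
  shows "sign p = (- 1) ^ (card {x. p x \<noteq> x} div 2)"
  using assms
proof (induction "card {x. p x \<noteq> x}" arbitrary: p rule: less_induct)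
  case less
  have sub: "{x. p x \<noteq> x} \<subseteq> S" using less.prems(2) by (auto simp: permutes_def)
  have fin: "finite {x. p x \<noteq> x}" by (rule finite_subset[OF sub less.prems(1)])
  show ?case
  proof (cases "{x. p x \<noteq> x} = {}")
    case True
    then have "p = id" by auto
    then show ?thesis by simp
  next
    case False
    then obtain a where a: "p a \<noteq> a" by auto
    let ?t = "Transposition.transpose a (p a)"
    define q where "q = ?t \<circ> p"
    have aS: "a \<in> S" "p a \<in> S" using a sub less.prems(2) by (auto simp: permutes_in_image)
    have tS: "?t permutes S" using aS by (intro permutes_swap_id)
    have qS: "q permutes S" unfolding q_def by (rule permutes_compose[OF less.prems(2) tS])
    have px: "p x = a \<longleftrightarrow> x = p a" "p x = p a \<longleftrightarrow> x = a" for x using less.prems(3) by metis+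
    have q: "q x = (if x = a \<or> x = p a then x else p x)" for x
      unfolding q_def o_def using px[of x] less.prems(3)[of a]
      by (auto simp: Transposition.transpose_def)
    have qq: "q (q x) = x" for x using px[of x] less.prems(3) by (auto simp: q)
    have mv: "{x. p x \<noteq> x} = insert a (insert (p a) {x. q x \<noteq> x})"
      using a less.prems(3) by (auto simp: q)
    have finq: "finite {x. q x \<noteq> x}" using fin mv by simp
    have card: "card {x. p x \<noteq> x} = Suc (Suc (card {x. q x \<noteq> x}))"
      unfolding mv using finq a by (auto simp: q)
    have "sign q = (- 1) ^ (card {x. q x \<noteq> x} div 2)"
      by (rule less.hyps) (use card less.prems(1) qS qq in auto)
    moreover have "p = ?t \<circ> q" unfolding q_def by (simp add: comp_assoc[symmetric])
    then have "sign p = sign ?t * sign q"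
      using sign_compose permutes_imp_permutation[OF less.prems(1)] tS qS by metis
    moreover have "sign ?t = - 1" using a by (simp add: sign_swap_id)
    ultimately show ?thesis using card by simp
  qed
qed

context quad_space begin

section \<open>Fixed spaces and their change under a reflection\<close>

definition Fix :: "('v \<Rightarrow> 'v) \<Rightarrow> 'v set" where
  "Fix g = {x \<in> V. g x = x}"

lemma subspace_Fix: "g \<in> Og \<Longrightarrow> subspace (Fix g)"
  by (auto simp: Fix_def subspace_def V_closed Og_zero OgD(2,3))

lemma Fix_subset: "Fix g \<subseteq> V"
  by (auto simp: Fix_def)

text \<open>The isometry property puts the image of g - 1 into the perpendicular space. The fibres
  of \<open>x \<mapsto> g x - x\<close> are cosets of \<open>Fix g\<close>, so by
  \<open>card_perp\<close> both sides have the same size.\<close>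

lemma perp_Fix: assumes g: "g \<in> Og" shows "perp (Fix g) = (\<lambda>x. g x - x) ` V"
proof -
  let ?I = "(\<lambda>x. g x - x) ` V"
  have sub: "?I \<subseteq> perp (Fix g)"
  proof clarify
    fix x assume x: "x \<in> V"
    have "B (g x - x) f = 0" if "f \<in> Fix g" for f
    proof -
      have f: "f \<in> V" "g f = f" using that by (auto simp: Fix_def)
      then show ?thesis using Og_B[OF g x f(1)] by (simp add: form_simps)
    qed
    then show "g x - x \<in> perp (Fix g)" using x OgD(5)[OF g x] by (auto simp: perp_def V_diff)
  qed
  have fib: "card {x \<in> V. g x - x = y} = card (Fix g)" if y: "y \<in> ?I" for y
  proof -
    obtain x0 where x0: "x0 \<in> V" "y = g x0 - x0" using y by blast
    have "bij_betw (\<lambda>x. x + x0) (Fix g) {x \<in> V. g x - x = y}"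
    proof (rule bij_betwI[where g = "\<lambda>x. x - x0"])
      show "(\<lambda>x. x + x0) \<in> Fix g \<rightarrow> {x \<in> V. g x - x = y}"
        using x0 g by (auto simp: Fix_def V_closed OgD(2))
      show "(\<lambda>x. x - x0) \<in> {x \<in> V. g x - x = y} \<rightarrow> Fix g"
        using x0 g by (auto simp: Fix_def V_closed Og_diff algebra_simps) 
    qed auto
    then show ?thesis by (simp add: bij_betw_same_card)
  qed
  have "card V = (\<Sum>y\<in>?I. card {x \<in> V. g x - x = y})"
    using sum.image_gen[OF finite_V, of "\<lambda>_. 1::nat" "\<lambda>x. g x - x"] by simp
  also have "\<dots> = card ?I * card (Fix g)" using fib by simp
  finally have "card (Fix g) * card ?I = card (Fix g) * card (perp (Fix g))"
    using card_perp[OF subspace_Fix[OF g] Fix_subset] by (metis mult.commute)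
  moreover have "card (Fix g) \<noteq> 0"
    using card_perp[OF subspace_Fix[OF g] Fix_subset] card_V l_pos by (metis mult_0 less_irrefl zero_less_power)
  ultimately have "card ?I = card (perp (Fix g))" by simp
  then show ?thesis using sub card_subset_eq[OF finite_subset[OF perp_subset finite_V]] by metis
qed

text \<open>The cases are whether \<open>v\<close> lies in the image of g - 1, that is in
  \<open>perp (Fix g)\<close>. If not, the fixed space shrinks to its vectors perpendicular to
  \<open>v\<close>; if \<open>v = g u - u\<close>, it grows by the line of \<open>u\<close>. The
  fixed dimension thus always moves by exactly one.\<close>

lemma card_Fix_refl:
  assumes g: "g \<in> Og" and v: "v \<in> V" "Q v \<noteq> 0"
  shows "card (Fix (refl v \<circ> g)) = l * card (Fix g) \<or> card (Fix g) = l * card (Fix (refl v \<circ> g))"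
proof -
  let ?k = "kinv (Q v)"
  have k: "?k \<in> K" "?k * Q v = e" using kinv[OF Q_in_K] v by auto
  have iff: "x \<in> Fix (refl v \<circ> g) \<longleftrightarrow> x \<in> V \<and> g x = x - (B x v * ?k) \<star> v" for x
  proof -
    have "refl v (g x) = x \<longleftrightarrow> g x = refl v x" using refl_refl[OF v] by metis
    then show ?thesis by (auto simp: Fix_def refl_def)
  qed
  show ?thesis
  proof (cases "v \<in> perp (Fix g)")
    case False
    have "Fix (refl v \<circ> g) = {x \<in> Fix g. B x v = 0}"
    proof (intro equalityI subsetI)
      fix x assume "x \<in> Fix (refl v \<circ> g)"
      then have x: "x \<in> V" "g x = x - (B x v * ?k) \<star> v" using iff by auto
      let ?c = "B x v * ?k"
      \<comment> \<open>For a fixed vector of the product, \<open>g x - x\<close> is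
        \<open>- ?c\<close> times \<open>v\<close>, so a nonzero \<open>?c\<close> would put
        \<open>v\<close> into the image of g - 1.\<close>
      have "?c = 0"
      proof (rule ccontr)
        assume "?c \<noteq> 0"
        then obtain s where s: "s * ?c = e" using K_inverse[of ?c] k K_mult_right by metis
        have "v = (s * ?c) \<star> v" by (simp add: s e_scale v)
        also have "\<dots> = (- s) \<star> (g x - x)" using x(2) by simp
        also have "\<dots> = g ((- s) \<star> x) - (- s) \<star> x"
          by (simp only: OgD(3)[OF g x(1)] scale_right_diff_distrib)
        finally have "v \<in> perp (Fix g)"
          unfolding perp_Fix[OF g] using x(1) V_scale by blast
        then show False using False by simp
      qed
      moreover have "B x v = 0"
      proof -
        have "?c * Q v = B x v * e" by (simp only: mult.assoc k(2))
        also have "\<dots> = B x v" using B_in_K[OF x(1), of v] by (simp add: K_def mult.commute)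
        finally have "?c * Q v = B x v" .
        then show ?thesis using \<open>?c = 0\<close> by simp
      qed
      ultimately show "x \<in> {x \<in> Fix g. B x v = 0}" using x by (simp add: Fix_def)
    next
      fix x assume "x \<in> {x \<in> Fix g. B x v = 0}"
      then show "x \<in> Fix (refl v \<circ> g)" unfolding iff by (simp add: Fix_def)
    qed
    moreover obtain x0 where "x0 \<in> Fix g" "B x0 v \<noteq> 0" using False v B_sym by (auto simp: perp_def)
    then have "card (Fix g) = l * card {x \<in> Fix g. B x v = 0}"
      by (intro card_kernel subspace_Fix g Fix_subset) (auto simp: form_simps)
    ultimately show ?thesis by simp
  next
    case True
    then obtain u where u: "u \<in> V" "v = g u - u" unfolding perp_Fix[OF g] by blast
    have gu: "g u = u + v" using u by simp
    have "Q (u + v) = Q u" using OgD(4)[OF g u(1)] gu by simp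
    \<comment> \<open>Because of this value the reflection coefficient of
      \<open>r \<star> u + f\<close> acts as \<open>- r\<close>, which compensates for
      \<open>g u = u + v\<close>.\<close>
    then have Buv: "B u v = - Q v" by (simp add: form_simps eq_neg_iff_add_eq_0 add.commute)
    have u_nF: "u \<notin> Fix g" using v u by (auto simp: Fix_def)
    have "Fix (refl v \<circ> g) = {r \<star> u + f |r f. f \<in> Fix g}"
    proof (intro equalityI subsetI)
      fix x assume "x \<in> Fix (refl v \<circ> g)"
      then have x: "x \<in> V" "g x = x - (B x v * ?k) \<star> v" using iff by auto
      let ?c = "B x v * ?k"
      have "g (x + ?c \<star> u) = x - ?c \<star> v + ?c \<star> (u + v)"
        using OgD(2)[OF g x(1) V_scale[OF u(1)]] OgD(3)[OF g u(1)] x(2) gu by simp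
      also have "\<dots> = x + ?c \<star> u" by (simp add: scale_right_distrib)
      finally have "x + ?c \<star> u \<in> Fix g" using x u by (simp add: Fix_def V_closed)
      moreover have "x = (- ?c) \<star> u + (x + ?c \<star> u)" by simp
      ultimately show "x \<in> {r \<star> u + f |r f. f \<in> Fix g}" by blast
    next
      fix x assume "x \<in> {r \<star> u + f |r f. f \<in> Fix g}"
      then obtain r f where x: "x = r \<star> u + f" "f \<in> Fix g" by blast
      have f: "f \<in> V" "g f = f" using x by (auto simp: Fix_def)
      have "B f v = 0" using True x by (auto simp: perp_def B_sym)
      then have "B x v * ?k = - (r * (?k * Q v))" by (simp add: x form_simps Buv mult.commute mult.left_commute)
      then have c: "(B x v * ?k) \<star> v = - (r \<star> v)" using e_scale[OF v(1)] by (simp add: k flip: scale_scale)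
      have "g x = r \<star> (u + v) + f"
        unfolding x(1) using OgD(2)[OF g V_scale[OF u(1)] f(1)] OgD(3)[OF g u(1)] gu f by simp
      also have "\<dots> = x - (B x v * ?k) \<star> v" unfolding c by (simp add: x scale_right_distrib)
      finally show "x \<in> Fix (refl v \<circ> g)" unfolding iff using x u f by (simp add: V_closed)
    qed
    then show ?thesis using card_extend[OF subspace_Fix[OF g] Fix_subset u(1) u_nF] by simp
  qed
qed

definition fdim :: "('v \<Rightarrow> 'v) \<Rightarrow> nat" where
  "fdim g = (THE k. card (Fix g) = l ^ k)"

lemma fdim_eqI: assumes "card (Fix g) = l ^ k" shows "fdim g = k"
  unfolding fdim_def using assms l_gt_1 by (intro the_equality) auto

lemma card_Fix: assumes "g \<in> Og" shows "card (Fix g) = l ^ fdim g"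
proof -
  obtain vs where "indep vs" "span (set vs) = Fix g"
    using indep_spanning[OF subspace_Fix[OF assms] Fix_subset] .
  then have "card (Fix g) = l ^ length vs" using card_span_indep by metis
  then show ?thesis using fdim_eqI by metis
qed

lemma fdim_le: assumes "g \<in> Og" shows "fdim g \<le> 2 * n"
proof -
  have "l ^ fdim g \<le> l ^ (2 * n)"
    using card_mono[OF finite_V Fix_subset] by (simp add: card_Fix[OF assms, symmetric] card_V[symmetric])
  then show ?thesis using l_gt_1 by simp
qed

lemma fdim_full: assumes "g \<in> Og" "fdim g = 2 * n" shows "g = id"
proof -
  have "Fix g = V" using card_Fix[OF assms(1)] assms(2) card_V card_subset_eq[OF finite_V Fix_subset] by metis
  then have "g x = x" for x using OgD(6)[OF assms(1)] by (cases "x \<in> V") (auto simp: Fix_def)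
  then show ?thesis by auto
qed

lemma even_fdim_refl:
  assumes "g \<in> Og" "v \<in> V" "Q v \<noteq> 0"
  shows "even (fdim (refl v \<circ> g)) \<longleftrightarrow> odd (fdim g)"
proof -
  have "refl v \<circ> g \<in> Og" using assms by (intro Og_comp refl_in_Og)
  then have "l ^ fdim (refl v \<circ> g) = l ^ Suc (fdim g) \<or> l ^ fdim g = l ^ Suc (fdim (refl v \<circ> g))"
    using card_Fix_refl[OF assms] card_Fix assms by simp
  then have "fdim (refl v \<circ> g) = Suc (fdim g) \<or> fdim g = Suc (fdim (refl v \<circ> g))"
    using l_gt_1 by (metis power_inject_exp)
  then show ?thesis by auto
qed

text \<open>A weak form of the Cartan-Dieudonne theorem. If \<open>h\<close> already agrees with
  \<open>g\<close> on \<open>vs\<close>, then the inverse of \<open>h\<close> composed with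
  \<open>g\<close> fixes \<open>vs\<close>, and \<open>witt_step\<close> supplies an element of
  \<open>R2\<close> that fixes \<open>vs\<close> and moves \<open>v\<close> in the same way.\<close>

lemma R2_agrees:
  assumes "odd l" "indep vs" "g \<in> Og"
  shows "\<exists>h\<in>R2. \<forall>w\<in>set vs. h w = g w"
  using assms(2)
proof (induction vs)
  case Nil
  then show ?case using R2_id by auto
next
  case (Cons v vs)
  then obtain h where h: "h \<in> R2" "\<forall>w\<in>set vs. h w = g w" by auto
  have hO: "h \<in> Og" by (rule R2_subset[OF h(1)])
  define k where "k = Hilbert_Choice.inv h \<circ> g"
  have kO: "k \<in> Og" unfolding k_def by (intro Og_comp Og_inv hO assms)
  have "Hilbert_Choice.inv h (g w) = w" if "w \<in> set vs" for w
    using h(2) that OgD(7)[OF hO] by (metis inv_f_f)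
  then have kS: "k \<in> Stab vs" using kO by (simp add: Stab_def k_def)
  have v: "v \<in> V" "v \<notin> span (set vs)" and vsV: "set vs \<subseteq> V" using Cons.prems indep_subset by auto
  have kv: "k v \<notin> span (set vs)"
  proof
    assume a: "k v \<in> span (set vs)"
    then have "k (k v) = k v" using Stab_fix_span[OF kS vsV] by blast
    then have "k v = v" using OgD(7)[OF kO] by (simp add: inj_eq)
    then show False using a v by simp
  qed
  have Bk: "B v w = B (k v) w" if "w \<in> set vs" for w
  proof -
    have "k w = w" "w \<in> V" using kS that vsV by (auto simp: Stab_def)
    then show ?thesis using Og_B[OF kO v(1), of w] by simp
  qed
  obtain t where t: "t \<in> R2" "\<forall>w\<in>set vs. t w = w" "t v = k v"
    using witt_step[OF vsV v OgD(5)[OF kO v(1)] kv OgD(4)[OF kO v(1), symmetric] Bk] assms(1) by blast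
  have "h (k v) = g v" unfolding k_def using permutes_inverses(1)[OF OgD(1)[OF hO]] by simp
  then show ?case using h t R2_comp[OF h(1) t(1)] by (intro bexI[of _ "h \<circ> t"]) auto
qed

lemma Og_eq_R2: assumes "odd l" shows "Og = R2"
proof
  show "Og \<subseteq> R2"
  proof
    fix g assume g: "g \<in> Og"
    obtain vs where vs: "indep vs" "span (set vs) = V" using indep_spanning[OF V_subspace order_refl] .
    obtain h where h: "h \<in> R2" "\<forall>w\<in>set vs. h w = g w" using R2_agrees[OF assms vs(1) g] by blast
    have hO: "h \<in> Og" by (rule R2_subset[OF h(1)])
    have "subspace {x \<in> V. h x = g x}"
      by (auto simp: subspace_def V_closed Og_zero[OF g] OgD(2,3)[OF g] Og_zero[OF hO] OgD(2,3)[OF hO])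
    then have "span (set vs) \<subseteq> {x \<in> V. h x = g x}"
      using h indep_subset[OF vs(1)] by (intro span_minimal) auto
    then have "h x = g x" for x
      using vs OgD(6)[OF g] OgD(6)[OF hO] by (cases "x \<in> V") auto
    then have "h = g" by auto
    then show "g \<in> R2" using h by simp
  qed
qed (use R2_subset in blast)

end

section \<open>The spinor norm as a permutation sign\<close>

context quad_space begin

definition is_sq :: "'r \<Rightarrow> bool" where
  "is_sq a \<longleftrightarrow> (\<exists>r\<in>K. r * r = a)"

text \<open>Squaring identifies \<open>e\<close> and \<open>- e\<close>, which differ for odd
  \<open>l\<close>; on the finite set \<open>K\<close> it is then not onto either.\<close>

lemma nonsquare_exists: assumes "odd l" obtains b where "b \<in> K" "\<not> is_sq b"
proof -
  let ?Sq = "(\<lambda>r. r * r) ` K"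
  have "e \<noteq> - e" using two_e_nonzero[OF assms] by (metis add.right_inverse mult_2)
  then have "\<not> inj_on (\<lambda>r. r * r) K" using K_uminus[OF e_in_K] e_in_K unfolding inj_on_def by force
  then have "card ?Sq \<noteq> card K" using finite_K by (metis eq_card_imp_inj_on)
  then have "?Sq \<noteq> K" by auto
  moreover have "?Sq \<subseteq> K" by (auto intro: K_mult_left)
  ultimately have "\<exists>b\<in>K. b \<notin> ?Sq" by (meson subset_antisym subsetI)
  then obtain b where "b \<in> K" "b \<notin> ?Sq" ..
  then show ?thesis using that[of b] unfolding is_sq_def by blast
qed

text \<open>The nonzero squares have index two: multiplying them by \<open>c\<close> gives only
  nonsquares, and by \<open>card_squares\<close> there are no more nonsquares than that.\<close>

lemma nonsquare_ratio:
  assumes odd: "odd l" and c: "c \<in> K" "\<not> is_sq c" and d: "d \<in> K" "\<not> is_sq d"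
  obtains r where "r \<in> K" "r \<noteq> 0" "d = c * (r * r)"
proof -
  have sq0: "is_sq 0" unfolding is_sq_def by (intro bexI[of _ 0]) auto
  let ?S = "(\<lambda>r. r * r) ` K - {0}" and ?N = "{a \<in> K. \<not> is_sq a}"
  have Sq: "(\<lambda>r. r * r) ` K = {a \<in> K. is_sq a}" by (auto simp: is_sq_def intro: K_mult_left)
  have fS: "finite ?S" using finite_K by simp
  have "0 \<in> (\<lambda>r. r * r) ` K" using sq0 Sq by auto
  then have cS: "card ?S = card ((\<lambda>r. r * r) ` K) - 1" using finite_K by simp
  have c0: "c \<noteq> 0" using c sq0 by auto
  have inj: "inj_on ((*) c) ?S"
  proof (rule inj_onI)
    fix y z assume yz: "y \<in> ?S" "z \<in> ?S" "c * y = c * z"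
    have "c * (y - z) = 0" using yz by (simp add: algebra_simps)
    moreover have "y - z \<in> K" using yz by (auto intro!: K_diff K_mult_left)
    ultimately show "y = z" using K_no_zero_divisors[OF c(1), of "y - z"] c0 by auto
  qed
  have sub: "(*) c ` ?S \<subseteq> ?N"
  proof clarify
    fix r assume r: "r \<in> K" "r * r \<noteq> 0"
    have r0: "r \<noteq> 0" using r by auto
    obtain s where s: "s \<in> K" "s * r = e" using K_inverse[OF r(1) r0] .
    have "\<not> is_sq (c * (r * r))"
    proof
      assume "is_sq (c * (r * r))"
      then obtain t where t: "t \<in> K" "t * t = c * (r * r)" by (auto simp: is_sq_def)
      have "(t * s) * (t * s) = (t * t) * (s * s)" by (simp add: mult_ac)
      also have "\<dots> = c * ((s * r) * (s * r))" unfolding t by (simp add: mult_ac)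
      also have "\<dots> = c" unfolding s(2) e_idem using c by (simp add: K_def mult.commute)
      finally have "is_sq c" using t by (auto simp: is_sq_def intro!: bexI[of _ "t * s"] K_mult_left)
      then show False using c by simp
    qed
    then show "c * (r * r) \<in> K \<and> \<not> is_sq (c * (r * r))" using c by (simp add: K_mult_left)
  qed
  have "card ?N + card ((\<lambda>r. r * r) ` K) = l"
  proof -
    have "K = ?N \<union> (\<lambda>r. r * r) ` K" "?N \<inter> (\<lambda>r. r * r) ` K = {}" unfolding Sq by auto
    then show ?thesis using finite_K card_K by (metis card_Un_disjoint finite_Un)
  qed
  then have "card ?N \<le> card ((*) c ` ?S)"
    using card_squares cS by (simp add: card_image[OF inj])
  then have "(*) c ` ?S = ?N" using sub finite_K by (intro card_seteq) auto
  then have "d \<in> (*) c ` ?S" using d by auto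
  then obtain r where r: "r \<in> K" "r * r \<noteq> 0" "d = c * (r * r)" by auto
  then have "r \<noteq> 0" by auto
  then show ?thesis using that[OF r(1) _ r(3)] by blast
qed

text \<open>
  For \<open>Q x = a\<close> and \<open>Q w = b\<close>, the vectors of the level set moved by the reflection in \<open>w\<close> fall into
  orbits of size four under the reflection and \<open>x \<mapsto> - x\<close>, except for the multiples of \<open>w\<close>. Hence the
  reflection is odd exactly if \<open>a = s\<^sup>2 b\<close> is solvable. Taking \<open>- a\<close> to be a nonsquare makes this the
  character of \<open>- b\<close>.
\<close>

definition level :: "'v set" where
  "level = {x \<in> V. Q x = - (SOME b. b \<in> K \<and> \<not> is_sq b)}"

definition sp :: "('v \<Rightarrow> 'v) \<Rightarrow> int" where
  "sp g = (if odd l then sign_on level g else 1)"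

lemma level_bij: "g \<in> Og \<Longrightarrow> bij_betw g level level"
proof -
  assume g: "g \<in> Og"
  have fin: "finite level" using finite_V by (simp add: level_def)
  have "g ` level \<subseteq> level" using OgD(4,5)[OF g] by (auto simp: level_def)
  moreover have "inj_on g level" using OgD(7)[OF g] by (rule inj_on_subset) simp
  ultimately show ?thesis using endo_inj_surj[OF fin] by (simp add: bij_betw_def)
qed

lemma sp_comp: "g \<in> Og \<Longrightarrow> h \<in> Og \<Longrightarrow> sp (g \<circ> h) = sp g * sp h"
  unfolding sp_def using sign_on_compose[OF level_bij level_bij] finite_V by (simp add: level_def)

lemma sp_cases: "sp g = 1 \<or> sp g = - 1"
  unfolding sp_def sign_on_def sign_def by auto

lemma sp_refl:
  assumes odd: "odd l" and w: "w \<in> V" "Q w \<noteq> 0"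
  shows "sp (refl w) = (if is_sq (- Q w) then 1 else - 1)"
proof -
  define c where "c = (SOME b. b \<in> K \<and> \<not> is_sq b)"
  have "\<exists>b. b \<in> K \<and> \<not> is_sq b" using nonsquare_exists[OF odd] by blast
  then have c: "c \<in> K" "\<not> is_sq c" unfolding c_def by (metis (mono_tags, lifting) someI_ex)+
  have sq0: "is_sq 0" unfolding is_sq_def by (intro bexI[of _ 0]) auto
  have c0: "c \<noteq> 0" using c sq0 by auto
  have S: "level = {x \<in> V. Q x = - c}" by (simp add: level_def c_def)
  have fS: "finite level" using finite_V by (simp add: level_def)
  have rO: "refl w \<in> Og" by (rule refl_in_Og[OF w])
  define p where "p = restrict_id (refl w) level"
  have p: "p permutes level" unfolding p_def using level_bij[OF rO] by (rule permutes_restrict_id)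
  have px: "p x = (if x \<in> level then refl w x else x)" for x by (simp add: p_def restrict_id_def)
  have rl: "refl w x \<in> level" if "x \<in> level" for x using level_bij[OF rO] that by (rule bij_betwE[rule_format])
  have pp: "p (p x) = x" for x using rl refl_refl[OF w] by (simp add: px)
  have sp_p: "sp (refl w) = (- 1) ^ (card {x. p x \<noteq> x} div 2)"
    using sign_involution[OF fS p pp] odd by (simp add: sp_def sign_on_def p_def)
  let ?k = "kinv (Q w)"
  have k: "?k \<in> K" "?k * Q w = e" using kinv[OF Q_in_K] w by auto
  define M where "M = {x. p x \<noteq> x}"
  have M: "x \<in> M \<longleftrightarrow> x \<in> level \<and> refl w x \<noteq> x" for x by (auto simp: px M_def)
  have fM: "finite M" by (rule finite_subset[OF _ fS]) (use M in blast)
  have neg_ne: "- x \<noteq> x" if "x \<in> level" for x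
  proof
    assume "- x = x"
    then have "B x x = - B x x" using B_minus_left[of x x] by simp
    then have "2 * B x x = 0" unfolding mult_2 by (simp only: eq_neg_iff_add_eq_0)
    moreover have xK: "Q x \<in> K" "Q x \<noteq> 0" using that c c0 by (simp_all add: S K_uminus)
    moreover have "2 * Q x \<in> K" using xK(1) by (rule K_mult_right)
    ultimately show False using two_mult_nonzero[OF odd] unfolding B_self by blast
  qed
  have refl_neg: "refl w (- x) = - refl w x" if "x \<in> level" for x
    using Og_minus[OF rO] that by (simp add: S)
  have neg_level: "- x \<in> level" if "x \<in> level" for x using that by (simp add: S V_uminus Q_minus)
  \<comment> \<open>On the moved vectors outside \<open>M0\<close>, the reflection and negation act
    freely, in orbits of size four. The vectors of \<open>M0\<close> are the multiples of
    \<open>w\<close> in the level set; there are two or none, and this decides the sign.\<close>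
  define M0 where "M0 = {x \<in> M. refl w x = - x}"
  have MM: "x \<in> M - M0 \<longleftrightarrow> x \<in> level \<and> refl w x \<noteq> x \<and> refl w x \<noteq> - x" for x
    unfolding M0_def using M[of x] by blast
  have "4 dvd card (M - M0)"
  proof (rule four_dvd_card[where f = "refl w" and g = uminus])
    fix x assume x: "x \<in> M - M0"
    then have xl: "x \<in> level" "refl w x \<noteq> x" "refl w x \<noteq> - x" unfolding MM by auto
    have rr: "refl w (refl w x) = x" by (rule refl_refl[OF w])
    have ne: "x \<noteq> - refl w x" using xl(3) by (metis minus_minus)
    then show "refl w x \<in> M - M0" unfolding MM using xl(2) rl[OF xl(1)] rr by simp
    show "- x \<in> M - M0" unfolding MM refl_neg[OF xl(1)] using xl neg_level ne by simp
    show "refl w (- x) = - refl w x" by (rule refl_neg[OF xl(1)])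
    show "refl w (refl w x) = x" "refl w x \<noteq> x" "- x \<noteq> x" "refl w x \<noteq> - x" "- (- x) = x"
      using rr xl neg_ne by auto
  qed (use fM in simp)
  then obtain j where j: "card (M - M0) = 4 * j" by blast
  have cM: "card M = 4 * j + card M0"
  proof -
    have "card M = card (M - M0) + card M0"
    proof -
      have "card (M - M0) = card M - card M0" by (rule card_Diff_subset) (use fM in \<open>auto simp: M0_def\<close>)
      moreover have "card M0 \<le> card M" by (rule card_mono) (use fM in \<open>auto simp: M0_def\<close>)
      ultimately show ?thesis by simp
    qed
    then show ?thesis using j by simp
  qed
  have M0: "x \<in> M0 \<longleftrightarrow> (\<exists>s\<in>K. x = s \<star> w \<and> s * s * Q w = - c)" for x
  proof
    assume "x \<in> M0"
    then have x: "x \<in> level" "refl w x = - x" using M by (auto simp: M0_def)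
    then have xV: "x \<in> V" by (simp add: S)
    have "2 * e \<in> K" by (rule K_mult_right[OF e_in_K])
    then obtain h where h: "h \<in> K" "h * (2 * e) = e" using K_inverse two_e_nonzero[OF odd] by metis
    have "x + x = (B x w * ?k) \<star> w" using x(2) xV by (simp add: refl_def algebra_simps)
    moreover have "x + x = (2 * e) \<star> x"
      by (simp only: mult_2 scale_left_distrib e_scale[OF xV])
    ultimately have "h \<star> ((2 * e) \<star> x) = h \<star> ((B x w * ?k) \<star> w)" by simp
    then have xw: "x = (h * (B x w * ?k)) \<star> w" using h e_scale[OF xV] by simp
    then have "Q x = (h * (B x w * ?k)) * (h * (B x w * ?k)) * Q w" using Q_scale by metis
    then show "\<exists>s\<in>K. x = s \<star> w \<and> s * s * Q w = - c"
      using xw x(1) h by (intro bexI[of _ "h * (B x w * ?k)"]) (auto simp: S K_mult_left)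
  next
    assume "\<exists>s\<in>K. x = s \<star> w \<and> s * s * Q w = - c"
    then obtain s where s: "s \<in> K" "x = s \<star> w" "s * s * Q w = - c" by blast
    have xl: "x \<in> level" using s w by (simp add: S V_scale Q_scale)
    have "B x w * ?k = s * 2 * (?k * Q w)" by (simp add: s form_simps mult_ac)
    then have "(B x w * ?k) \<star> w = (s * 2) \<star> w" using e_scale[OF w(1)] by (simp add: k flip: scale_scale)
    also have "(s * 2) \<star> w = x + x" by (simp only: mult_2_right scale_left_distrib s(2))
    finally have "refl w x = - x" using xl by (simp add: refl_def S)
    then show "x \<in> M0" using M xl neg_ne[OF xl] by (simp add: M0_def)
  qed
  show ?thesis
  proof (cases "is_sq (- Q w)")
    case True
    then obtain t where t: "t \<in> K" "t * t = - Q w" by (auto simp: is_sq_def)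
    have "M0 = {}"
    proof (rule ccontr)
      assume "M0 \<noteq> {}"
      then obtain s where s: "s \<in> K" "s * s * Q w = - c" using M0 by blast
      have "(s * t) * (s * t) = s * s * (t * t)" by (simp add: mult_ac)
      also have "\<dots> = c" unfolding t using s(2) by simp
      finally have "is_sq c" using s(1) by (auto simp: is_sq_def intro!: bexI[of _ "s * t"] K_mult_left)
      then show False using c by simp
    qed
    then have "card M = 4 * j" using cM by (simp only: card.empty)
    then show ?thesis using True sp_p by (simp flip: M_def)
  next
    case False
    have "- Q w \<in> K" using Q_in_K[OF w(1)] by (rule K_uminus)
    then obtain r where r: "r \<in> K" "r \<noteq> 0" "- Q w = c * (r * r)" using nonsquare_ratio[OF odd c _ False] by metis
    obtain s where s: "s \<in> K" "s * r = e" using K_inverse[OF r(1,2)] .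
    have "s * s * Q w = - (s * s * (- Q w))" by simp
    also have "\<dots> = - (c * ((s * r) * (s * r)))" unfolding r by (simp add: mult_ac)
    also have "\<dots> = - c" unfolding s(2) e_idem using c by (simp add: K_def mult.commute)
    finally have ss: "s * s * Q w = - c" .
    have "M0 = {s \<star> w, - (s \<star> w)}"
    proof (intro equalityI subsetI)
      fix x assume "x \<in> M0"
      then obtain s' where s': "s' \<in> K" "x = s' \<star> w" "s' * s' * Q w = - c" using M0 by blast
      have "(s' * s' - s * s) * Q w = 0" using ss s' by (simp add: algebra_simps)
      moreover have "s' * s' - s * s \<in> K" using s s' by (intro K_diff K_mult_left)
      ultimately have "s' * s' - s * s = 0" using K_no_zero_divisors Q_in_K w by blast
      then have "(s' - s) * (s' + s) = 0" by (simp add: algebra_simps)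
      then have "s' - s = 0 \<or> s' + s = 0" using K_no_zero_divisors K_add K_diff s s' by blast
      then have "s' = s \<or> s' = - s" by (auto simp: add_eq_0_iff2)
      then show "x \<in> {s \<star> w, - (s \<star> w)}" using s' by auto
    next
      fix x assume "x \<in> {s \<star> w, - (s \<star> w)}"
      then have "x = s \<star> w \<or> x = (- s) \<star> w" by auto
      moreover have "- s \<in> K" "(- s) * (- s) * Q w = - c" using s(1) ss by (simp_all add: K_uminus)
      ultimately show "x \<in> M0" unfolding M0 using s(1) ss by blast
    qed
    moreover have "s \<star> w \<in> level" using ss w by (simp add: S V_scale Q_scale)
    then have "s \<star> w \<noteq> - (s \<star> w)" using neg_ne by metis
    ultimately have "card M0 = 2" by (simp only: card_2_iff) blast
    then have "card M = 4 * j + 2" using cM by simp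
    then show ?thesis using False sp_p by (simp flip: M_def)
  qed
qed

end

section \<open>Moments on the spinor and parity classes\<close>

context quad_space begin

definition sp_values :: "int set" where
  "sp_values = (if odd l then {1, - 1} else {1})"

lemma sp_in_values: "sp g \<in> sp_values"
  using sp_cases[of g] by (auto simp: sp_values_def) (simp add: sp_def)

text \<open>For odd \<open>l\<close>, \<open>perp_represents\<close> provides a vector with
  \<open>- Q z\<close> of the desired square class. For \<open>l = 2\<close> there is a single sign,
  and any nonsingular vector will do.\<close>

lemma refl_with_sp:
  assumes "indep vs" "length vs < n" "\<epsilon> \<in> sp_values"
  obtains z where "z \<in> perp (set vs)" "Q z \<noteq> 0" "sp (refl z) = \<epsilon>"
proof (cases "odd l")
  case False
  then have "sp g = 1" for g by (simp add: sp_def)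
  then show ?thesis using nonsingular_in_perp[OF assms(1,2)] that assms(3) False
    by (metis sp_values_def singletonD)
next
  case True
  obtain b where b: "b \<in> K" "\<not> is_sq b" using nonsquare_exists[OF True] .
  have sqe: "is_sq e" unfolding is_sq_def by (intro bexI[of _ e]) (auto simp: e_idem)
  have sq0: "is_sq 0" unfolding is_sq_def by (intro bexI[of _ 0]) auto
  have "\<epsilon> = 1 \<or> \<epsilon> = - 1" using assms(3) by (auto simp: sp_values_def split: if_splits)
  then obtain c where c: "c \<in> K" "c \<noteq> 0" "\<epsilon> = (if is_sq c then 1 else - 1)"
  proof
    assume "\<epsilon> = 1"
    then show ?thesis using that[of e] sqe e_nonzero by simp
  next
    assume "\<epsilon> = - 1"
    then show ?thesis using that[of b] b sq0 by auto
  qed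
  obtain z where z: "z \<in> perp (set vs)" "Q z = - c"
    using perp_represents[OF True assms(1,2) K_uminus[OF c(1)]] .
  have "z \<in> V" using z by (simp add: perp_def)
  then have "sp (refl z) = \<epsilon>" using sp_refl[OF True, of z] z c by simp
  then show ?thesis using that z c by simp
qed

definition cls :: "int \<Rightarrow> bool \<Rightarrow> ('v \<Rightarrow> 'v) set" where
  "cls \<epsilon> \<delta> = {g \<in> Og. sp g = \<epsilon> \<and> even (fdim g) = \<delta>}"

lemma finite_cls: "finite (cls \<epsilon> \<delta>)"
  using finite_Og by (simp add: cls_def)

text \<open>Composition with \<open>refl z\<close> is an involution of \<open>Stab vs\<close>, since
  \<open>z\<close> is perpendicular to \<open>vs\<close>. It multiplies the spinor sign by that of
  \<open>refl z\<close> and, by \<open>even_fdim_refl\<close>, reverses the parity.\<close>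

lemma card_cls_Stab_refl:
  assumes "z \<in> perp (set vs)" "Q z \<noteq> 0"
  shows "card (cls \<epsilon> \<delta> \<inter> Stab vs) = card (cls (sp (refl z) * \<epsilon>) (\<not> \<delta>) \<inter> Stab vs)"
proof -
  have z: "z \<in> V" using assms by (simp add: perp_def)
  have rO: "refl z \<in> Og" by (rule refl_in_Og[OF z assms(2)])
  have rS: "refl z \<in> Stab vs"
    using rO perpD(1)[OF assms(1)] by (auto simp: Stab_def B_sym intro!: refl_perp)
  have maps: "refl z \<circ> g \<in> cls (sp (refl z) * \<epsilon>) (\<not> \<delta>) \<inter> Stab vs" if "g \<in> cls \<epsilon> \<delta> \<inter> Stab vs" for g \<epsilon> \<delta>
    using that sp_comp[OF rO, of g] even_fdim_refl[OF _ z assms(2), of g] Og_comp[OF rO, of g] Stab_comp[OF rS, of g]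
    by (auto simp: cls_def)
  have ss: "sp (refl z) * (sp (refl z) * \<epsilon>) = \<epsilon>" using sp_cases[of "refl z"] by auto
  have rr: "refl z \<circ> (refl z \<circ> g) = g" for g using refl_refl[OF z assms(2)] by auto
  have "bij_betw ((\<circ>) (refl z)) (cls \<epsilon> \<delta> \<inter> Stab vs) (cls (sp (refl z) * \<epsilon>) (\<not> \<delta>) \<inter> Stab vs)"
  proof (rule bij_betwI[where g = "(\<circ>) (refl z)"])
    show "(\<circ>) (refl z) \<in> cls (sp (refl z) * \<epsilon>) (\<not> \<delta>) \<inter> Stab vs \<rightarrow> cls \<epsilon> \<delta> \<inter> Stab vs"
      using maps[of _ "sp (refl z) * \<epsilon>" "\<not> \<delta>"] ss by auto
  qed (use maps rr in blast)+
  then show ?thesis by (rule bij_betw_same_card)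
qed

lemma card_cls_Stab_eq:
  assumes vs: "indep vs" "length vs < n" and \<epsilon>: "\<epsilon> \<in> sp_values" "\<epsilon>' \<in> sp_values"
  shows "card (cls \<epsilon> \<delta> \<inter> Stab vs) = card (cls \<epsilon>' \<delta>' \<inter> Stab vs)"
proof -
  \<comment> \<open>One reflection of sign \<open>a * b\<close> leads from \<open>a\<close> to
    \<open>b\<close> but always reverses the parity; classes of equal parity are compared by two
    flips.\<close>
  have flip: "card (cls a \<delta> \<inter> Stab vs) = card (cls b (\<not> \<delta>) \<inter> Stab vs)"
    if "a \<in> sp_values" "b \<in> sp_values" for a b \<delta>
  proof -
    have "a * b \<in> sp_values" "(a * b) * a = b" using that by (auto simp: sp_values_def split: if_splits)
    then show ?thesis using refl_with_sp[OF vs] card_cls_Stab_refl by metis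
  qed
  show ?thesis
  proof (cases "\<delta> = \<delta>'")
    case True
    then show ?thesis using flip[OF \<epsilon>(1) \<epsilon>(1), of \<delta>] flip[OF \<epsilon>(1) \<epsilon>(2), of "\<not> \<delta>"] by simp
  next
    case False
    then have "\<delta>' = (\<not> \<delta>)" by auto
    then show ?thesis using flip[OF \<epsilon>, of \<delta>] by simp
  qed
qed

lemma card_cls_Stab:
  assumes vs: "indep vs" "length vs < n" and \<epsilon>: "\<epsilon> \<in> sp_values"
  shows "2 * card sp_values * card (cls \<epsilon> \<delta> \<inter> Stab vs) = card (Stab vs)"
proof -
  let ?I = "sp_values \<times> (UNIV :: bool set)"
  have "Stab vs = (\<Union>i\<in>?I. cls (fst i) (snd i) \<inter> Stab vs)"
    using sp_in_values by (auto simp: cls_def Stab_def)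
  then have "card (Stab vs) = card (\<Union>i\<in>?I. cls (fst i) (snd i) \<inter> Stab vs)" by simp
  also have "\<dots> = (\<Sum>i\<in>?I. card (cls (fst i) (snd i) \<inter> Stab vs))"
    by (rule card_UN_disjoint) (auto simp: finite_Stab cls_def sp_values_def)
  also have "\<dots> = (\<Sum>i\<in>?I. card (cls \<epsilon> \<delta> \<inter> Stab vs))"
  proof (rule sum.cong)
    fix i assume "i \<in> ?I"
    then have "fst i \<in> sp_values" by auto
    then show "card (cls (fst i) (snd i) \<inter> Stab vs) = card (cls \<epsilon> \<delta> \<inter> Stab vs)"
      by (rule card_cls_Stab_eq[OF vs _ \<epsilon>])
  qed simp
  also have "\<dots> = 2 * card sp_values * card (cls \<epsilon> \<delta> \<inter> Stab vs)"
    by (simp add: card_cartesian_product mult.commute)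
  finally show ?thesis by simp
qed

lemma card_cls:
  assumes "\<epsilon> \<in> sp_values" "n > 0"
  shows "2 * card sp_values * card (cls \<epsilon> \<delta>) = card Og"
  using card_cls_Stab[of "[]" \<epsilon> \<delta>] assms by (simp add: Stab_def Int_absorb2 cls_def)

text \<open>The product counts the \<open>m\<close>-frames inside \<open>Fix g\<close>, so
  exchanging the sums leaves the orders of \<open>cls \<epsilon> \<delta> \<inter> Stab vs\<close>,
  a fixed fraction of those in \<open>sum_card_Stab\<close>. For \<open>fdim g < m\<close> the
  factor at \<open>i = fdim g\<close> is 0, so truncated subtraction does no harm.\<close>

lemma cls_moment:
  assumes \<epsilon>: "\<epsilon> \<in> sp_values" and m: "m < n"
  shows "(\<Sum>g\<in>cls \<epsilon> \<delta>. \<Prod>i<m. l ^ fdim g - l ^ i) = l ^ (m * (m + 1) div 2) * card (cls \<epsilon> \<delta>)"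
proof -
  let ?N = "2 * card sp_values"
  have N: "?N > 0" by (simp add: sp_values_def)
  have "(\<Sum>g\<in>cls \<epsilon> \<delta>. \<Prod>i<m. l ^ fdim g - l ^ i) = (\<Sum>g\<in>cls \<epsilon> \<delta>. card {vs \<in> frames V m. g \<in> Stab vs})"
  proof (rule sum.cong)
    fix g assume "g \<in> cls \<epsilon> \<delta>"
    then have g: "g \<in> Og" by (simp add: cls_def)
    have "{vs \<in> frames V m. g \<in> Stab vs} = frames (Fix g) m"
      using g by (auto simp: frames_def Stab_def Fix_def)
    then show "(\<Prod>i<m. l ^ fdim g - l ^ i) = card {vs \<in> frames V m. g \<in> Stab vs}"
      by (simp add: card_frames[OF subspace_Fix[OF g] Fix_subset] card_Fix[OF g])
  qed simp
  also have "\<dots> = (\<Sum>vs\<in>frames V m. card {g \<in> cls \<epsilon> \<delta>. g \<in> Stab vs})"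
    using sum_multicount_gen[OF finite_cls[of \<epsilon> \<delta>] finite_frames[OF order_refl, of m], of "\<lambda>g vs. g \<in> Stab vs"
      "\<lambda>vs. card {g \<in> cls \<epsilon> \<delta>. g \<in> Stab vs}"] by simp
  also have "\<dots> = (\<Sum>vs\<in>frames V m. card (cls \<epsilon> \<delta> \<inter> Stab vs))" by (simp add: Int_def)
  finally have "?N * (\<Sum>g\<in>cls \<epsilon> \<delta>. \<Prod>i<m. l ^ fdim g - l ^ i) = (\<Sum>vs\<in>frames V m. ?N * card (cls \<epsilon> \<delta> \<inter> Stab vs))"
    by (simp add: sum_distrib_left)
  also have "\<dots> = (\<Sum>vs\<in>frames V m. card (Stab vs))"
    using m \<epsilon> by (intro sum.cong card_cls_Stab) (auto simp: frames_def)
  also have "\<dots> = l ^ (m * (m + 1) div 2) * card Og" by (rule sum_card_Stab(2)[OF m])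
  also have "\<dots> = ?N * (l ^ (m * (m + 1) div 2) * card (cls \<epsilon> \<delta>))"
    using card_cls[OF \<epsilon>, of \<delta>] m by (simp add: mult_ac)
  finally show ?thesis using N by simp
qed

lemma card_full_fdim: "card {g \<in> cls \<epsilon> \<delta>. fdim g = 2 * n} \<le> 1"
proof -
  have "{g \<in> cls \<epsilon> \<delta>. fdim g = 2 * n} \<subseteq> {id}" using fdim_full by (auto simp: cls_def)
  then have "card {g \<in> cls \<epsilon> \<delta>. fdim g = 2 * n} \<le> card {id :: 'v \<Rightarrow> 'v}" by (intro card_mono) auto
  then show ?thesis by simp
qed

end

section \<open>The reduced lattice\<close>

text \<open>
  One type containing all prime fields: in the product of all rings \<open>\<int>/p\<close>, the field with \<open>l\<close> elements
  is the ideal generated by \<open>inc l 1\<close>. The factor at \<open>0\<close> is \<open>\<int>\<close>, since \<open>a mod 0 = a\<close>.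
\<close>

typedef residue_product = "{f :: nat \<Rightarrow> int. \<forall>p. f p mod int p = f p}"
  by (rule exI[of _ "\<lambda>_. 0"]) simp

setup_lifting type_definition_residue_product

instantiation residue_product :: comm_ring_1
begin

lift_definition zero_residue_product :: residue_product is "\<lambda>_. 0" by simp
lift_definition one_residue_product :: residue_product is "\<lambda>p. 1 mod int p" by simp
lift_definition plus_residue_product :: "residue_product \<Rightarrow> residue_product \<Rightarrow> residue_product"
  is "\<lambda>f g p. (f p + g p) mod int p" by simp
lift_definition minus_residue_product :: "residue_product \<Rightarrow> residue_product \<Rightarrow> residue_product"
  is "\<lambda>f g p. (f p - g p) mod int p" by simp
lift_definition uminus_residue_product :: "residue_product \<Rightarrow> residue_product"
  is "\<lambda>f p. (- f p) mod int p" by simp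
lift_definition times_residue_product :: "residue_product \<Rightarrow> residue_product \<Rightarrow> residue_product"
  is "\<lambda>f g p. (f p * g p) mod int p" by simp

instance
proof
  fix a b c :: residue_product
  show "a * b * c = a * (b * c)" by transfer (simp add: mod_simps mult.assoc)
  show "a * b = b * a" by transfer (simp add: mult.commute)
  show "1 * a = a" by transfer (simp add: mod_simps)
  show "a + b + c = a + (b + c)" by transfer (simp add: mod_simps add.assoc)
  show "a + b = b + a" by transfer (simp add: add.commute)
  show "0 + a = a" by transfer simp
  show "- a + a = 0" by transfer (simp add: mod_simps)
  show "a - b = a + - b" by transfer (simp add: mod_simps)
  show "(a + b) * c = a * c + b * c" by transfer (simp add: mod_simps distrib_right)
  show "(0::residue_product) \<noteq> 1" by transfer (auto simp: fun_eq_iff intro!: exI[of _ 0])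
qed

end

lift_definition inc :: "nat \<Rightarrow> int \<Rightarrow> residue_product" is "\<lambda>l a p. if p = l then a mod int l else 0"
  by auto

lift_definition component :: "nat \<Rightarrow> residue_product \<Rightarrow> int" is "\<lambda>l f. f l" .

lemma inc_add: "inc l (a + b) = inc l a + inc l b"
  by transfer (auto simp: fun_eq_iff mod_simps)

lemma inc_mult: "inc l (a * b) = inc l a * inc l b"
  by transfer (auto simp: fun_eq_iff mod_simps)

lemma inc_minus: "inc l (- a) = - inc l a"
  by transfer (auto simp: fun_eq_iff mod_simps)

lemma inc_diff: "inc l (a - b) = inc l a - inc l b"
  by transfer (auto simp: fun_eq_iff mod_simps)

lemma inc_0 [simp]: "inc l 0 = 0"
  by transfer auto

lemma inc_mod [simp]: "inc l (a mod int l) = inc l a"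
  by transfer auto

lemma inc_eq_iff: "inc l a = inc l b \<longleftrightarrow> a mod int l = b mod int l"
  by transfer (auto simp: fun_eq_iff)

lemma inc_sum: "inc l (sum f A) = (\<Sum>i\<in>A. inc l (f i))"
  by (induction A rule: infinite_finite_induct) (auto simp: inc_add)

lemma component_inc: "component l (inc l a) = a mod int l"
  by transfer simp

lemma component_mod: "component l r mod int l = component l r"
  by transfer simp

lemma inc_1_mult: "inc l 1 * r = inc l (component l r)"
  by transfer (auto simp: fun_eq_iff mod_simps)

section \<open>The lattice form over an arbitrary commutative ring\<close>

definition scale_fun :: "'a::comm_ring_1 \<Rightarrow> (nat \<Rightarrow> 'a) \<Rightarrow> nat \<Rightarrow> 'a" where
  "scale_fun r x = (\<lambda>i. r * x i)"

definition e8_q :: "(nat \<Rightarrow> 'a::comm_ring_1) \<Rightarrow> 'a" where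
  "e8_q x = (\<Sum>i<8. x i * x i) - (\<Sum>i<6. x i * x (Suc i)) - x 2 * x 7"

text \<open>The polarisation of \<open>e8_q\<close>, written out; its Gram matrix is the Cartan
  matrix of E8.\<close>

definition e8_b :: "(nat \<Rightarrow> 'a::comm_ring_1) \<Rightarrow> (nat \<Rightarrow> 'a) \<Rightarrow> 'a" where
  "e8_b x y = (\<Sum>i<8. x i * y i + y i * x i) - (\<Sum>i<6. x i * y (Suc i) + y i * x (Suc i))
     - (x 2 * y 7 + y 2 * x 7)"

definition lat_q :: "nat \<Rightarrow> (nat \<Rightarrow> 'a::comm_ring_1) \<Rightarrow> 'a" where
  "lat_q d x = (\<Sum>i<2*d - 2. x (2*i) * x (2*i + 1)) - (\<Sum>k<d. e8_q (\<lambda>i. x (4*d - 4 + 8*k + i)))"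

definition lat_b :: "nat \<Rightarrow> (nat \<Rightarrow> 'a::comm_ring_1) \<Rightarrow> (nat \<Rightarrow> 'a) \<Rightarrow> 'a" where
  "lat_b d x y = (\<Sum>i<2*d - 2. x (2*i) * y (2*i + 1) + y (2*i) * x (2*i + 1))
     - (\<Sum>k<d. e8_b (\<lambda>i. x (4*d - 4 + 8*k + i)) (\<lambda>i. y (4*d - 4 + 8*k + i)))"

lemma e8_b_add: "e8_b (\<lambda>i. x i + y i) z = e8_b x z + e8_b y z"
  unfolding e8_b_def by (simp add: sum.distrib algebra_simps)

lemma e8_b_scale: "e8_b (\<lambda>i. r * x i) z = r * e8_b x z"
  unfolding e8_b_def by (simp add: sum_distrib_left algebra_simps)

lemma e8_b_sym: "e8_b x y = e8_b y x"
  unfolding e8_b_def by (simp add: algebra_simps)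

lemma e8_q_add: "e8_q (\<lambda>i. x i + y i) = e8_q x + e8_q y + e8_b x y"
  unfolding e8_b_def e8_q_def by (simp add: sum.distrib algebra_simps)

lemma e8_q_scale: "e8_q (\<lambda>i. r * x i) = r * r * e8_q x"
  unfolding e8_q_def by (simp add: sum_distrib_left algebra_simps)

lemma lat_b_add: "lat_b d (x + y) z = lat_b d x z + lat_b d y z"
  unfolding lat_b_def plus_fun_def e8_b_add by (simp add: sum.distrib algebra_simps)

lemma lat_b_scale: "lat_b d (scale_fun r x) z = r * lat_b d x z"
  unfolding lat_b_def scale_fun_def e8_b_scale by (simp add: sum_distrib_left algebra_simps)

lemma lat_b_sym: "lat_b d x y = lat_b d y x"
  unfolding lat_b_def by (simp add: e8_b_sym add.commute)

lemma lat_q_add: "lat_q d (x + y) = lat_q d x + lat_q d y + lat_b d x y"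
  unfolding lat_b_def lat_q_def plus_fun_def e8_q_add by (simp add: sum.distrib algebra_simps)

lemma lat_q_scale: "lat_q d (scale_fun r x) = r * r * lat_q d x"
  unfolding lat_q_def scale_fun_def e8_q_scale by (simp add: sum_distrib_left algebra_simps)

lemma module_scale_fun: "Modules.module scale_fun"
  by unfold_locales (auto simp: scale_fun_def fun_eq_iff algebra_simps)

text \<open>The Cartan matrix of E8 has determinant 1, so its inverse is integral and the eight
  equations are solved over every commutative ring at once. The test vectors carry the scalar
  \<open>u\<close>, hence it is \<open>u * x i\<close> that vanishes.\<close>

lemma e8_nondegenerate:
  fixes x :: "nat \<Rightarrow> 'a::comm_ring_1" and u :: 'a
  assumes "\<And>j. j < 8 \<Longrightarrow> e8_b x (\<lambda>i. if i = j then u else 0) = 0"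
    and "i < 8"
  shows "u * x i = 0"
proof -
  define y where "y i = u * x i" for i
  have sums: "(\<Sum>i<8. f i) = f 0 + f 1 + f 2 + f 3 + f 4 + f 5 + f 6 + f 7"
    "(\<Sum>i<6. f i) = f 0 + f 1 + f 2 + f 3 + f 4 + f 5" for f :: "nat \<Rightarrow> 'a"
    by (simp_all add: eval_nat_numeral)
  note eqs = assms(1)[of 0] assms(1)[of 1] assms(1)[of 2] assms(1)[of 3] assms(1)[of 4] assms(1)[of 5]
    assms(1)[of 6] assms(1)[of 7]
  have e: "2 * y 0 - y 1 = 0" "2 * y 1 - y 0 - y 2 = 0" "2 * y 2 - y 1 - y 3 - y 7 = 0" "2 * y 3 - y 2 - y 4 = 0" "2 * y 4 - y 3 - y 5 = 0" "2 * y 5 - y 4 - y 6 = 0" "2 * y 6 - y 5 = 0" "2 * y 7 - y 2 = 0"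
    using eqs unfolding e8_b_def sums y_def by (simp_all add: algebra_simps flip: numeral_2_eq_2)
  have y0: "y 0 = 0"
  proof -
    \<comment> \<open>The coefficients here and below form the inverse of the Cartan matrix.\<close>
    have "y 0 = 4 * (2 * y 0 - y 1) + 7 * (2 * y 1 - y 0 - y 2) + 10 * (2 * y 2 - y 1 - y 3 - y 7) + 8 * (2 * y 3 - y 2 - y 4) + 6 * (2 * y 4 - y 3 - y 5) + 4 * (2 * y 5 - y 4 - y 6) + 2 * (2 * y 6 - y 5) + 5 * (2 * y 7 - y 2)"
      by (simp add: algebra_simps)
    then show ?thesis unfolding e by simp
  qed
  have y1: "y 1 = 0"
  proof -
    have "y 1 = 7 * (2 * y 0 - y 1) + 14 * (2 * y 1 - y 0 - y 2) + 20 * (2 * y 2 - y 1 - y 3 - y 7) + 16 * (2 * y 3 - y 2 - y 4) + 12 * (2 * y 4 - y 3 - y 5) + 8 * (2 * y 5 - y 4 - y 6) + 4 * (2 * y 6 - y 5) + 10 * (2 * y 7 - y 2)"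
      by (simp add: algebra_simps)
    then show ?thesis unfolding e by simp
  qed
  have y2: "y 2 = 0"
  proof -
    have "y 2 = 10 * (2 * y 0 - y 1) + 20 * (2 * y 1 - y 0 - y 2) + 30 * (2 * y 2 - y 1 - y 3 - y 7) + 24 * (2 * y 3 - y 2 - y 4) + 18 * (2 * y 4 - y 3 - y 5) + 12 * (2 * y 5 - y 4 - y 6) + 6 * (2 * y 6 - y 5) + 15 * (2 * y 7 - y 2)"
      by (simp add: algebra_simps)
    then show ?thesis unfolding e by simp
  qed
  have y3: "y 3 = 0"
  proof -
    have "y 3 = 8 * (2 * y 0 - y 1) + 16 * (2 * y 1 - y 0 - y 2) + 24 * (2 * y 2 - y 1 - y 3 - y 7) + 20 * (2 * y 3 - y 2 - y 4) + 15 * (2 * y 4 - y 3 - y 5) + 10 * (2 * y 5 - y 4 - y 6) + 5 * (2 * y 6 - y 5) + 12 * (2 * y 7 - y 2)"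
      by (simp add: algebra_simps)
    then show ?thesis unfolding e by simp
  qed
  have y4: "y 4 = 0"
  proof -
    have "y 4 = 6 * (2 * y 0 - y 1) + 12 * (2 * y 1 - y 0 - y 2) + 18 * (2 * y 2 - y 1 - y 3 - y 7) + 15 * (2 * y 3 - y 2 - y 4) + 12 * (2 * y 4 - y 3 - y 5) + 8 * (2 * y 5 - y 4 - y 6) + 4 * (2 * y 6 - y 5) + 9 * (2 * y 7 - y 2)"
      by (simp add: algebra_simps)
    then show ?thesis unfolding e by simp
  qed
  have y5: "y 5 = 0"
  proof -
    have "y 5 = 4 * (2 * y 0 - y 1) + 8 * (2 * y 1 - y 0 - y 2) + 12 * (2 * y 2 - y 1 - y 3 - y 7) + 10 * (2 * y 3 - y 2 - y 4) + 8 * (2 * y 4 - y 3 - y 5) + 6 * (2 * y 5 - y 4 - y 6) + 3 * (2 * y 6 - y 5) + 6 * (2 * y 7 - y 2)"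
      by (simp add: algebra_simps)
    then show ?thesis unfolding e by simp
  qed
  have y6: "y 6 = 0"
  proof -
    have "y 6 = 2 * (2 * y 0 - y 1) + 4 * (2 * y 1 - y 0 - y 2) + 6 * (2 * y 2 - y 1 - y 3 - y 7) + 5 * (2 * y 3 - y 2 - y 4) + 4 * (2 * y 4 - y 3 - y 5) + 3 * (2 * y 5 - y 4 - y 6) + 2 * (2 * y 6 - y 5) + 3 * (2 * y 7 - y 2)"
      by (simp add: algebra_simps)
    then show ?thesis unfolding e by simp
  qed
  have y7: "y 7 = 0"
  proof -
    have "y 7 = 5 * (2 * y 0 - y 1) + 10 * (2 * y 1 - y 0 - y 2) + 15 * (2 * y 2 - y 1 - y 3 - y 7) + 12 * (2 * y 3 - y 2 - y 4) + 9 * (2 * y 4 - y 3 - y 5) + 6 * (2 * y 5 - y 4 - y 6) + 3 * (2 * y 6 - y 5) + 8 * (2 * y 7 - y 2)"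
      by (simp add: algebra_simps)
    then show ?thesis unfolding e by simp
  qed
  have "i = 0 \<or> i = 1 \<or> i = 2 \<or> i = 3 \<or> i = 4 \<or> i = 5 \<or> i = 6 \<or> i = 7" using assms(2) by linarith
  then have "y i = 0" using y0 y1 y2 y3 y4 y5 y6 y7 by auto
  then show ?thesis by (simp add: y_def)
qed

lemma e8_b_zero: "(\<And>i. i < 8 \<Longrightarrow> y i = 0) \<Longrightarrow> e8_b x y = 0"
  by (simp add: e8_b_def)

definition red_V :: "nat \<Rightarrow> nat \<Rightarrow> (nat \<Rightarrow> residue_product) set" where
  "red_V l N = {x. (\<forall>i<N. inc l 1 * x i = x i) \<and> (\<forall>i\<ge>N. x i = 0)}"

text \<open>The tests are \<open>inc l 1\<close> times unit vectors. A hyperbolic coordinate is read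
  off with its partner in the same plane; an E8 block reduces to
  \<open>e8_nondegenerate\<close>.\<close>

lemma lat_nondegenerate:
  assumes d: "d \<ge> 1" and x: "x \<in> red_V l (12 * d - 4)"
    and orth: "\<And>y. y \<in> red_V l (12 * d - 4) \<Longrightarrow> lat_b d x y = 0"
  shows "x = 0"
proof
  fix i
  define e where "e = inc l 1"
  have ee: "e * e = e" unfolding e_def by (simp flip: inc_mult)
  define y where "y j = (\<lambda>i. if i = j then e else 0)" for j :: nat
  have yV: "y j \<in> red_V l (12 * d - 4)" if "j < 12 * d - 4" for j
    using that ee by (auto simp: red_V_def y_def e_def)
  have ex: "e * x i = x i" if "i < 12 * d - 4" for i using x that by (auto simp: red_V_def e_def)
  define c where "c = 4 * d - 4"
  have c: "c = 2 * (2 * d - 2)" "c + 8 * d = 12 * d - 4" using d by (simp_all add: c_def)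
  have latb: "lat_b d x y = (\<Sum>i<2*d - 2. x (2*i) * y (2*i + 1) + y (2*i) * x (2*i + 1))
     - (\<Sum>k<d. e8_b (\<lambda>i. x (c + 8*k + i)) (\<lambda>i. y (c + 8*k + i)))" for y
    by (simp add: lat_b_def c_def)
  have hyp: "x j = 0" if j: "j < c" for j
  proof -
    have e8z: "e8_b (\<lambda>i. x (c + 8*k + i)) (\<lambda>i. y j' (c + 8*k + i)) = 0" if "j' < c" for j' k
      by (rule e8_b_zero) (use that in \<open>simp add: y_def\<close>)
    define i0 where "i0 = j div 2"
    have i0: "i0 < 2*d - 2" using j c by (auto simp: i0_def)
    show ?thesis
    proof (cases "even j")
      case True
      then have ji: "j = 2 * i0" by (auto simp: i0_def)
      have "2 * i0 + 1 < 12 * d - 4" using i0 c by linarith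
      then have "0 = lat_b d x (y (2 * i0 + 1))" using orth[OF yV] by simp
      also have "\<dots> = (\<Sum>i<2*d - 2. if i = i0 then x (2 * i) * e else 0)"
      proof -
        have "x (2*i) * y (2*i0+1) (2*i + 1) + y (2*i0+1) (2*i) * x (2*i + 1) = (if i = i0 then x (2 * i) * e else 0)" for i
          unfolding y_def by (auto; presburger)
        moreover have "2 * i0 < c" "2 * i0 + 1 < c" using i0 c by linarith+
        ultimately show ?thesis unfolding latb by (simp add: e8z)
      qed
      also have "\<dots> = e * x j" using i0 ji by (simp add: mult.commute)
      also have "\<dots> = x j" using ex[of j] j c by simp
      finally show ?thesis by simp
    next
      case False
      then have ji: "j = 2 * i0 + 1" by (auto simp: i0_def)
      have "2 * i0 < 12 * d - 4" using i0 c by linarith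
      then have "0 = lat_b d x (y (2 * i0))" using orth[OF yV] by simp
      also have "\<dots> = (\<Sum>i<2*d - 2. if i = i0 then e * x (2 * i + 1) else 0)"
      proof -
        have "x (2*i) * y (2*i0) (2*i + 1) + y (2*i0) (2*i) * x (2*i + 1) = (if i = i0 then e * x (2 * i + 1) else 0)" for i
          unfolding y_def by (auto; presburger)
        moreover have "2 * i0 < c" "2 * i0 + 1 < c" using i0 c by linarith+
        ultimately show ?thesis unfolding latb by (simp add: e8z)
      qed
      also have "\<dots> = e * x j" using i0 ji by simp
      also have "\<dots> = x j" using ex[of j] j c by simp
      finally show ?thesis by simp
    qed
  qed
  have blk: "x (c + 8 * k0 + i0) = 0" if k0: "k0 < d" and i0: "i0 < 8" for k0 i0
  proof -
    have "e8_b (\<lambda>i. x (c + 8*k0 + i)) (\<lambda>i. if i = j then e else 0) = 0" if j: "j < 8" for j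
    proof -
      let ?y = "y (c + 8 * k0 + j)"
      have "c + 8 * k0 + j < 12 * d - 4" using k0 j c by linarith
      then have "0 = lat_b d x ?y" using orth[OF yV] by simp
      also have "\<dots> = - (\<Sum>k<d. e8_b (\<lambda>i. x (c + 8*k + i)) (\<lambda>i. ?y (c + 8*k + i)))"
      proof -
        have "?y (2*i) = 0" "?y (2*i+1) = 0" if "i < 2*d - 2" for i using that c by (auto simp: y_def)
        then show ?thesis unfolding latb by simp
      qed
      also have "(\<Sum>k<d. e8_b (\<lambda>i. x (c + 8*k + i)) (\<lambda>i. ?y (c + 8*k + i)))
        = (\<Sum>k<d. if k = k0 then e8_b (\<lambda>i. x (c + 8*k + i)) (\<lambda>i. if i = j then e else 0) else 0)"
      proof (rule sum.cong)
        fix k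
        show "e8_b (\<lambda>i. x (c + 8*k + i)) (\<lambda>i. ?y (c + 8*k + i))
          = (if k = k0 then e8_b (\<lambda>i. x (c + 8*k + i)) (\<lambda>i. if i = j then e else 0) else 0)"
        proof (cases "k = k0")
          case False
          have "?y (c + 8*k + i) = 0" if "i < 8" for i using False that j by (auto simp: y_def)
          then show ?thesis using False by (simp add: e8_b_zero)
        next
          case True
          have "(\<lambda>i. ?y (c + 8*k0 + i)) = (\<lambda>i. if i = j then e else 0)" by (auto simp: y_def)
          then show ?thesis using True by simp
        qed
      qed simp
      also have "\<dots> = e8_b (\<lambda>i. x (c + 8*k0 + i)) (\<lambda>i. if i = j then e else 0)" using k0 by simp
      finally show ?thesis by simp
    qed
    then have "e * x (c + 8 * k0 + i0) = 0" using e8_nondegenerate[of "\<lambda>i. x (c + 8*k0 + i)" e i0] i0 by simp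
    moreover have "c + 8 * k0 + i0 < 12 * d - 4" using k0 i0 c by linarith
    ultimately show ?thesis using ex by simp
  qed
  consider "i < c" | "c \<le> i" "i < 12 * d - 4" | "i \<ge> 12 * d - 4" by linarith
  then show "x i = 0 i"
  proof cases
    case 1
    then show ?thesis using hyp by simp
  next
    case 2
    define k0 where "k0 = (i - c) div 8"
    define i0 where "i0 = (i - c) mod 8"
    have "i = c + 8 * k0 + i0" using 2 by (simp add: k0_def i0_def)
    moreover have "k0 < d" using 2 c by (auto simp: k0_def)
    moreover have "i0 < 8" by (simp add: i0_def)
    ultimately show ?thesis using blk by simp
  next
    case 3
    then show ?thesis using x by (simp add: red_V_def)
  qed
qed

definition to_red :: "nat \<Rightarrow> nat \<Rightarrow> (nat \<Rightarrow> int) \<Rightarrow> nat \<Rightarrow> residue_product" where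
  "to_red l N x = (\<lambda>i. if i < N then inc l (x i) else 0)"

lemma to_red_bij:
  assumes "l > 1"
  shows "bij_betw (to_red l N) ({..<N} \<rightarrow>\<^sub>E {0..int l - 1}) (red_V l N)"
proof (rule bij_betwI[where g = "\<lambda>y. \<lambda>i\<in>{..<N}. component l (y i)"])
  show "to_red l N \<in> ({..<N} \<rightarrow>\<^sub>E {0..int l - 1}) \<rightarrow> red_V l N"
    by (auto simp: to_red_def red_V_def simp flip: inc_mult)
  have comp: "component l r \<in> {0..int l - 1}" for r
  proof -
    have "0 \<le> component l r mod int l" "component l r mod int l < int l" using assms by simp_all
    then show ?thesis unfolding component_mod by simp
  qed
  then show "(\<lambda>y. \<lambda>i\<in>{..<N}. component l (y i)) \<in> red_V l N \<rightarrow> {..<N} \<rightarrow>\<^sub>E {0..int l - 1}" by auto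
  fix x assume x: "x \<in> {..<N} \<rightarrow>\<^sub>E {0..int l - 1}"
  show "(\<lambda>i\<in>{..<N}. component l (to_red l N x i)) = x"
  proof
    fix i
    show "(\<lambda>i\<in>{..<N}. component l (to_red l N x i)) i = x i"
    proof (cases "i < N")
      case True
      then have "x i \<in> {0..int l - 1}" using x by (auto simp: PiE_iff)
      then show ?thesis using True by (simp add: to_red_def component_inc)
    next
      case False
      then show ?thesis using x by (simp add: PiE_iff extensional_def)
    qed
  qed
next
  fix y assume y: "y \<in> red_V l N"
  show "to_red l N (\<lambda>i\<in>{..<N}. component l (y i)) = y"
    using y by (auto simp: to_red_def red_V_def fun_eq_iff inc_1_mult)
qed

lemma quad_space_red:
  assumes l: "prime l" and d: "d \<ge> 1"
  shows "quad_space scale_fun l (6 * d - 2) (inc l 1) (red_V l (12 * d - 4)) (lat_q d) (lat_b d)"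
proof -
  interpret Modules.module "scale_fun :: residue_product \<Rightarrow> _" by (rule module_scale_fun)
  have l1: "l > 1" using l prime_gt_1_nat by blast
  have N: "2 * (6 * d - 2) = 12 * d - 4" by simp
  show ?thesis
  proof
    show "prime l" by fact
    show "inc l 1 * inc l 1 = inc l 1" by (simp flip: inc_mult)
    have "range ((*) (inc l 1)) = inc l ` {0..<int l}"
    proof (intro equalityI subsetI)
      fix r assume "r \<in> range ((*) (inc l 1))"
      then obtain s where "r = inc l (component l s)" by (auto simp: inc_1_mult)
      moreover have "component l s \<in> {0..<int l}"
        using component_mod[of l s] pos_mod_sign[of "int l" "component l s"]
          pos_mod_bound[of "int l" "component l s"] l1 by simp
      ultimately show "r \<in> inc l ` {0..<int l}" by blast
    next
      fix r assume "r \<in> inc l ` {0..<int l}"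
      then obtain a where "r = inc l a" by auto
      then have "r = inc l 1 * r" by (simp flip: inc_mult)
      then show "r \<in> range ((*) (inc l 1))" by (rule range_eqI)
    qed
    moreover have "inj_on (inc l) {0..<int l}" by (auto simp: inj_on_def inc_eq_iff)
    ultimately show "card (range ((*) (inc l 1))) = l" by (simp add: card_image)
    show "\<exists>s. s * r = inc l 1" if "inc l 1 * r \<noteq> 0" for r
    proof -
      let ?a = "component l r"
      have "\<not> int l dvd ?a"
      proof
        assume "int l dvd ?a"
        then have "inc l ?a = inc l 0" unfolding inc_eq_iff by simp
        then show False using that by (simp add: inc_1_mult)
      qed
      then have "coprime ?a (int l)" using l by (metis coprime_commute prime_imp_coprime prime_nat_int_transfer)
      then obtain b where "[?a * b = 1] (mod int l)" using cong_solve_coprime_int by blast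
      then have "inc l (?a * b) = inc l 1" by (simp add: inc_eq_iff cong_def)
      then have "inc l b * inc l ?a = inc l 1" by (simp only: inc_mult mult.commute)
      then have "(inc l b * inc l 1) * r = inc l 1" by (simp only: mult.assoc inc_1_mult)
      then show ?thesis by blast
    qed
    show "subspace (red_V l (12 * d - 4))"
      by (auto simp: subspace_def red_V_def scale_fun_def algebra_simps)
    show "scale_fun (inc l 1) v = v" if "v \<in> red_V l (12 * d - 4)" for v
    proof
      fix i show "scale_fun (inc l 1) v i = v i"
        using that by (cases "i < 12 * d - 4") (auto simp: scale_fun_def red_V_def)
    qed
    have "card (red_V l (12 * d - 4)) = card ({..<12 * d - 4} \<rightarrow>\<^sub>E {0..int l - 1})"
      using to_red_bij[OF l1] by (metis bij_betw_same_card)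
    also have "\<dots> = l ^ (12 * d - 4)" by (subst card_PiE) auto
    finally show "card (red_V l (12 * d - 4)) = l ^ (2 * (6 * d - 2))" unfolding N .
    show "x = 0" if "x \<in> red_V l (12 * d - 4)" "\<And>y. y \<in> red_V l (12 * d - 4) \<Longrightarrow> lat_b d x y = 0" for x
      using lat_nondegenerate[OF d that] .
  qed (rule lat_b_add lat_b_scale lat_b_sym lat_q_add lat_q_scale)+
qed

section \<open>Transfer to the explicit carriers\<close>

text \<open>Coordinates with respect to a finite basis are unique. This connects the algebraic
  \<open>dim\<close> with the counting definition of \<open>fdim\<close>.\<close>

lemma (in vectorspace) card_eq_power_dim:
  assumes "finite (carrier K)" "finite (carrier V)"
  shows "card (carrier V) = card (carrier K) ^ dim"
proof -
  have "gen_set (carrier V)"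
    by (metis in_own_span order_refl span_is_subset2 subset_antisym)
  then have "fin_dim" unfolding fin_dim_def using assms(2) by blast
  then obtain A where A: "finite A" "basis A" using finite_basis_exists by blast
  have AV: "A \<subseteq> carrier V" using A by (simp add: basis_def)
  have uniq: "\<exists>! a. a \<in> A \<rightarrow>\<^sub>E carrier K \<and> lincomb a A = v" if "v \<in> carrier V" for v
    using basis_criterion[OF A(1) AV] A(2) that by blast
  have "bij_betw (\<lambda>a. lincomb a A) (A \<rightarrow>\<^sub>E carrier K) (carrier V)"
  proof (rule bij_betw_imageI)
    have closed: "lincomb a A \<in> carrier V" if "a \<in> A \<rightarrow>\<^sub>E carrier K" for a
      using that AV by (intro lincomb_closed) auto
    show "inj_on (\<lambda>a. lincomb a A) (A \<rightarrow>\<^sub>E carrier K)"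
    proof (rule inj_onI)
      fix a b assume "a \<in> A \<rightarrow>\<^sub>E carrier K" "b \<in> A \<rightarrow>\<^sub>E carrier K" "lincomb a A = lincomb b A"
      then show "a = b" using uniq[OF closed, of a] by metis
    qed
    show "(\<lambda>a. lincomb a A) ` (A \<rightarrow>\<^sub>E carrier K) = carrier V"
      using closed uniq by (auto simp: image_iff) metis
  qed
  then have "card (carrier V) = card (A \<rightarrow>\<^sub>E carrier K)" by (simp add: bij_betw_same_card)
  also have "\<dots> = card (carrier K) ^ card A" using A(1) by (simp add: card_PiE)
  also have "card A = dim" using dim_basis[OF A] by simp
  finally show ?thesis .
qed

lemma e8_q_inc:
  assumes "\<And>i. i < 8 \<Longrightarrow> y i = inc l (z i)"
  shows "e8_q y = inc l (e8_form z)"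
  using assms by (simp add: e8_q_def e8_form_def inc_diff inc_sum inc_mult power2_eq_square)

locale reduction =
  fixes l d :: nat
  assumes prime: "prime l" and d: "d \<ge> 2"
begin

abbreviation "F \<equiv> residue_ring (int l)"
abbreviation "W \<equiv> reduced_space l d"
abbreviation "QW \<equiv> reduced_form l d"
abbreviation "\<phi> \<equiv> to_red l (12 * d - 4)"
abbreviation "OW \<equiv> orthogonal_group F W QW"

sublocale R: residues_prime l F
  using prime by unfold_locales

sublocale qs: quad_space scale_fun l "6 * d - 2" "inc l 1" "red_V l (12 * d - 4)" "lat_q d" "lat_b d"
  by (rule quad_space_red) (use prime d in auto)

abbreviation "VV \<equiv> red_V l (12 * d - 4)"

lemma l1: "l > 1" using prime prime_gt_1_nat by blast

lemma W_simps:
  "carrier W = {..<12 * d - 4} \<rightarrow>\<^sub>E {0..int l - 1}"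
  "x \<oplus>\<^bsub>W\<^esub> y = (\<lambda>i\<in>{..<12 * d - 4}. (x i + y i) mod int l)"
  "c \<odot>\<^bsub>W\<^esub> x = (\<lambda>i\<in>{..<12 * d - 4}. (c * x i) mod int l)"
  "\<zero>\<^bsub>W\<^esub> = (\<lambda>i\<in>{..<12 * d - 4}. 0)"
  by (simp_all add: reduced_space_def R.func_space_def R.res_carrier_eq R.res_add_eq R.res_mult_eq R.res_zero_eq)

lemma module_W: "module F W"
  unfolding reduced_space_def by (rule R.func_space_is_module)

sublocale W: vectorspace F W
  using module_W R.is_field by (simp add: vectorspace_def)

lemma finite_W: "finite (carrier W)"
  by (simp add: W_simps finite_PiE)

lemma \<phi>_bij: "bij_betw \<phi> (carrier W) VV"
  unfolding W_simps using to_red_bij[OF l1] .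

lemma \<phi>_in: "x \<in> carrier W \<Longrightarrow> \<phi> x \<in> VV"
  using \<phi>_bij bij_betwE by blast

lemma \<phi>_inj: "x \<in> carrier W \<Longrightarrow> y \<in> carrier W \<Longrightarrow> \<phi> x = \<phi> y \<longleftrightarrow> x = y"
  using \<phi>_bij by (auto simp: bij_betw_def inj_on_def)

lemma \<phi>_surj: assumes "y \<in> VV" obtains x where "x \<in> carrier W" "y = \<phi> x"
  using \<phi>_bij assms by (auto simp: bij_betw_def)

lemma \<phi>_add: "\<phi> (x \<oplus>\<^bsub>W\<^esub> y) = \<phi> x + \<phi> y"
  by (auto simp: W_simps to_red_def fun_eq_iff inc_add)

lemma \<phi>_smult: "\<phi> (c \<odot>\<^bsub>W\<^esub> x) = scale_fun (inc l c) (\<phi> x)"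
  by (auto simp: W_simps to_red_def fun_eq_iff inc_mult scale_fun_def)

lemma \<phi>_zero: "\<phi> \<zero>\<^bsub>W\<^esub> = 0"
  by (auto simp: W_simps to_red_def fun_eq_iff)

lemma \<phi>_minus: assumes "x \<in> carrier W" "y \<in> carrier W" shows "\<phi> (x \<ominus>\<^bsub>W\<^esub> y) = \<phi> x - \<phi> y"
proof -
  have "\<phi> (\<ominus>\<^bsub>W\<^esub> y) + \<phi> y = 0"
    using W.M.l_neg[OF assms(2)] by (simp add: \<phi>_zero flip: \<phi>_add)
  then have "\<phi> (\<ominus>\<^bsub>W\<^esub> y) = - \<phi> y" by (rule eq_neg_iff_add_eq_0[THEN iffD2])
  then show ?thesis by (simp add: a_minus_def \<phi>_add)
qed

lemma \<phi>_Q: "lat_q d (\<phi> x) = inc l (QW x)"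
proof -
  have c: "4 * d - 4 = 2 * (2 * d - 2)" "4 * d - 4 + 8 * d = 12 * d - 4" using d by simp_all
  have e8: "e8_q (\<lambda>i. \<phi> x (4 * d - 4 + 8 * k + i)) = inc l (e8_form (\<lambda>i. x (4 * d - 4 + 8 * k + i)))"
    if k: "k < d" for k
  proof -
    have v: "\<phi> x (4 * d - 4 + 8 * k + i) = inc l (x (4 * d - 4 + 8 * k + i))" if "i < 8" for i
    proof -
      have "4 * d - 4 + 8 * k + i < 12 * d - 4" using k that c(2) by linarith
      then show ?thesis by (simp add: to_red_def)
    qed
    show ?thesis by (rule e8_q_inc) (rule v)
  qed
  have h: "\<phi> x (2 * i) = inc l (x (2 * i))" "\<phi> x (2 * i + 1) = inc l (x (2 * i + 1))" if "i < 2 * d - 2" for i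
  proof -
    have "2 * i < 12 * d - 4" "2 * i + 1 < 12 * d - 4" using that c by linarith+
    then show "\<phi> x (2 * i) = inc l (x (2 * i))" "\<phi> x (2 * i + 1) = inc l (x (2 * i + 1))"
      by (simp_all add: to_red_def)
  qed
  have "lat_q d (\<phi> x) = (\<Sum>i<2*d - 2. inc l (x (2*i)) * inc l (x (2*i + 1)))
      - (\<Sum>k<d. inc l (e8_form (\<lambda>i. x (4 * d - 4 + 8 * k + i))))"
    unfolding lat_q_def by (intro arg_cong2[of _ _ _ _ minus] sum.cong) (simp_all only: h e8 lessThan_iff)
  also have "\<dots> = inc l (QW x)"
    by (simp add: reduced_form_def lattice_form_def inc_diff inc_sum inc_mult)
  finally show ?thesis .
qed

lemma QW_in: "QW x \<in> carrier F"
  by (simp add: reduced_form_def)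

lemma inc_F:
  "inc l (a \<oplus>\<^bsub>F\<^esub> b) = inc l a + inc l b" "inc l (a \<otimes>\<^bsub>F\<^esub> b) = inc l a * inc l b"
  "inc l (\<ominus>\<^bsub>F\<^esub> a) = - inc l a" "inc l (a \<ominus>\<^bsub>F\<^esub> b) = inc l a - inc l b"
  by (simp_all add: a_minus_def R.res_add_eq R.res_mult_eq R.res_neg_eq inc_add inc_mult inc_minus)

lemma inc_inj: "a \<in> carrier F \<Longrightarrow> b \<in> carrier F \<Longrightarrow> inc l a = inc l b \<longleftrightarrow> a = b"
  by (auto simp: inc_eq_iff R.res_carrier_eq)

lemma inc_in_K: "inc l a \<in> qs.K"
  by (simp add: qs.K_def flip: inc_mult)

lemma K_inc: assumes "r \<in> qs.K" obtains a where "a \<in> carrier F" "r = inc l a"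
proof -
  have "r = inc l (component l r mod int l)" using assms by (simp add: qs.K_def inc_1_mult)
  then show ?thesis using that R.mod_in_carrier by blast
qed

lemma \<phi>_B: "lat_b d (\<phi> x) (\<phi> y) = inc l (polar_form F W QW x y)"
  using lat_q_add[of d "\<phi> x" "\<phi> y"] by (simp add: polar_form_def inc_F \<phi>_Q flip: \<phi>_add)

text \<open>On \<open>VV\<close> a scalar acts only through its component at \<open>l\<close>.
  Linearity over \<open>F\<close> therefore extends to all scalars of type
  \<open>residue_product\<close>, as \<open>qs.Og\<close> demands.\<close>

lemma scale_via_inc: "y \<in> VV \<Longrightarrow> scale_fun r y = scale_fun (inc l (component l r mod int l)) y"
  using qs.e_scale[of y] qs.scale_scale[of r "inc l 1" y] inc_1_mult[of l r]
  by (simp only: mult.commute[of r] inc_mod)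

definition \<psi> :: "(nat \<Rightarrow> residue_product) \<Rightarrow> nat \<Rightarrow> int" where
  "\<psi> = inv_into (carrier W) \<phi>"

lemma \<psi>_\<phi>: "x \<in> carrier W \<Longrightarrow> \<psi> (\<phi> x) = x"
  using \<phi>_bij by (simp add: \<psi>_def bij_betw_inv_into_left)

lemma \<phi>_\<psi>: "y \<in> VV \<Longrightarrow> \<phi> (\<psi> y) = y" and \<psi>_in: "y \<in> VV \<Longrightarrow> \<psi> y \<in> carrier W"
  using \<phi>_bij by (simp_all add: \<psi>_def bij_betw_inv_into_right bij_betw_def inv_into_into)

text \<open>Conjugation by the coordinate bijection, extended by the identity off \<open>VV\<close>
  to match \<open>qs.Og\<close>; elements of \<open>OW\<close> are instead \<open>undefined\<close>
  off \<open>carrier W\<close>.\<close>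

definition \<Phi> :: "((nat \<Rightarrow> int) \<Rightarrow> nat \<Rightarrow> int) \<Rightarrow> (nat \<Rightarrow> residue_product) \<Rightarrow> nat \<Rightarrow> residue_product" where
  "\<Phi> g = (\<lambda>y. if y \<in> VV then \<phi> (g (\<psi> y)) else y)"

lemma \<Phi>_\<phi>: "x \<in> carrier W \<Longrightarrow> \<Phi> g (\<phi> x) = \<phi> (g x)"
  by (simp add: \<Phi>_def \<phi>_in \<psi>_\<phi>)

lemma OW_iff: "g \<in> carrier OW \<longleftrightarrow> g \<in> Bij (carrier W) \<and> g \<in> module_hom F W W \<and> (\<forall>x\<in>carrier W. QW (g x) = QW x)"
  by (simp add: orthogonal_group_def)

lemma OW_in: "g \<in> carrier OW \<Longrightarrow> x \<in> carrier W \<Longrightarrow> g x \<in> carrier W"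
  by (auto simp: OW_iff module_hom_def)

lemma OW_ext: "g \<in> carrier OW \<Longrightarrow> g \<in> extensional (carrier W)"
  by (simp add: OW_iff Bij_def)

lemma OW_mult: "g \<in> carrier OW \<Longrightarrow> h \<in> carrier OW \<Longrightarrow> g \<otimes>\<^bsub>OW\<^esub> h = compose (carrier W) g h"
  by (simp add: orthogonal_group_def BijGroup_def)

lemma \<Phi>_in: assumes g: "g \<in> carrier OW" shows "\<Phi> g \<in> qs.Og"
  unfolding \<Phi>_def
proof (rule qs.Og_extend)
  have gh: "g \<in> module_hom F W W" using g by (simp add: OW_iff)
  fix y assume y: "y \<in> VV"
  have gy: "g (\<psi> y) \<in> carrier W" by (rule OW_in[OF g \<psi>_in[OF y]])
  show "\<phi> (g (\<psi> y)) \<in> VV" by (rule \<phi>_in[OF gy])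
  show "lat_q d (\<phi> (g (\<psi> y))) = lat_q d y"
  proof -
    have "QW (g (\<psi> y)) = QW (\<psi> y)" using g \<psi>_in[OF y] by (simp add: OW_iff)
    then show ?thesis using \<phi>_Q[of "\<psi> y"] \<phi>_Q[of "g (\<psi> y)"] by (simp add: \<phi>_\<psi>[OF y])
  qed
  show "\<phi> (g (\<psi> (scale_fun r y))) = scale_fun r (\<phi> (g (\<psi> y)))" for r
  proof -
    let ?c = "component l r mod int l"
    have c: "?c \<in> carrier F" by simp
    have "scale_fun r y = \<phi> (?c \<odot>\<^bsub>W\<^esub> \<psi> y)" using y by (simp add: \<phi>_smult \<phi>_\<psi> scale_via_inc[OF y, of r])
    then have "\<psi> (scale_fun r y) = ?c \<odot>\<^bsub>W\<^esub> \<psi> y" using \<psi>_in[OF y] c by (simp add: \<psi>_\<phi>)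
    then have "\<phi> (g (\<psi> (scale_fun r y))) = scale_fun (inc l ?c) (\<phi> (g (\<psi> y)))"
      using module_hom_smult[OF gh c \<psi>_in[OF y]] by (simp add: \<phi>_smult)
    also have "\<dots> = scale_fun r (\<phi> (g (\<psi> y)))"
      using scale_via_inc[OF \<phi>_in[OF gy], of r] by simp
    finally show ?thesis .
  qed
  fix z assume z: "z \<in> VV"
  have "y + z = \<phi> (\<psi> y \<oplus>\<^bsub>W\<^esub> \<psi> z)" using y z by (simp add: \<phi>_add \<phi>_\<psi>)
  then have "\<psi> (y + z) = \<psi> y \<oplus>\<^bsub>W\<^esub> \<psi> z" using \<psi>_in[OF y] \<psi>_in[OF z] by (simp add: \<psi>_\<phi>)
  then show "\<phi> (g (\<psi> (y + z))) = \<phi> (g (\<psi> y)) + \<phi> (g (\<psi> z))"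
    using module_hom_add[OF gh \<psi>_in[OF y] \<psi>_in[OF z]] by (simp add: \<phi>_add)
qed

lemma \<Phi>_inj: assumes "g \<in> carrier OW" "h \<in> carrier OW" "\<Phi> g = \<Phi> h" shows "g = h"
proof (rule extensionalityI[OF OW_ext OW_ext])
  fix x assume x: "x \<in> carrier W"
  have "\<phi> (g x) = \<phi> (h x)" using assms(3) \<Phi>_\<phi>[OF x] by metis
  then show "g x = h x" using \<phi>_inj[OF OW_in[OF assms(1) x] OW_in[OF assms(2) x]] by blast
qed (use assms in auto)

lemma \<Phi>_surj: assumes h: "h \<in> qs.Og" obtains g where "g \<in> carrier OW" "\<Phi> g = h"
proof -
  define g where "g = (\<lambda>x\<in>carrier W. \<psi> (h (\<phi> x)))"
  have hV: "h (\<phi> x) \<in> VV" if "x \<in> carrier W" for x using qs.OgD(5)[OF h \<phi>_in[OF that]] .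
  have \<phi>g: "\<phi> (g x) = h (\<phi> x)" if "x \<in> carrier W" for x using that hV by (simp add: g_def \<phi>_\<psi>)
  have gW: "g x \<in> carrier W" if "x \<in> carrier W" for x using that hV by (simp add: g_def \<psi>_in)
  have eqI: "x = y" if "x \<in> carrier W" "y \<in> carrier W" "\<phi> x = \<phi> y" for x y using that \<phi>_inj by blast
  have "inj_on g (carrier W)"
  proof (rule inj_onI)
    fix x y assume xy: "x \<in> carrier W" "y \<in> carrier W" "g x = g y"
    then have "h (\<phi> x) = h (\<phi> y)" using \<phi>g by metis
    then have "\<phi> x = \<phi> y" using qs.OgD(7)[OF h] by (simp add: inj_eq)
    then show "x = y" using eqI xy by blast
  qed
  then have "bij_betw g (carrier W) (carrier W)"
    using endo_inj_surj[OF finite_W] gW by (auto simp: bij_betw_def)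
  then have "g \<in> Bij (carrier W)" by (simp add: Bij_def g_def)
  moreover have "g \<in> module_hom F W W"
    unfolding module_hom_def
  proof (safe)
    fix x assume "x \<in> carrier W" then show "g x \<in> carrier W" by (rule gW)
  next
    fix x y assume xy: "x \<in> carrier W" "y \<in> carrier W"
    then have "\<phi> (g (x \<oplus>\<^bsub>W\<^esub> y)) = \<phi> (g x \<oplus>\<^bsub>W\<^esub> g y)"
      by (simp add: \<phi>g \<phi>_add qs.OgD(2)[OF h] \<phi>_in)
    then show "g (x \<oplus>\<^bsub>W\<^esub> y) = g x \<oplus>\<^bsub>W\<^esub> g y" using xy gW by (intro eqI) auto
  next
    fix r x assume r: "r \<in> carrier F" and x: "x \<in> carrier W"
    then have "\<phi> (g (r \<odot>\<^bsub>W\<^esub> x)) = \<phi> (r \<odot>\<^bsub>W\<^esub> g x)"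
      by (simp add: \<phi>g \<phi>_smult qs.OgD(3)[OF h] \<phi>_in)
    then show "g (r \<odot>\<^bsub>W\<^esub> x) = r \<odot>\<^bsub>W\<^esub> g x" using r x gW by (intro eqI) auto
  qed
  moreover have "QW (g x) = QW x" if x: "x \<in> carrier W" for x
  proof -
    have "inc l (QW (g x)) = inc l (QW x)"
      using qs.OgD(4)[OF h \<phi>_in[OF x]] \<phi>g[OF x] \<phi>_Q by metis
    then show ?thesis using inc_inj[OF QW_in QW_in] by blast
  qed
  ultimately have gO: "g \<in> carrier OW" by (simp add: OW_iff)
  have "\<Phi> g = h"
  proof
    fix y show "\<Phi> g y = h y"
      using \<phi>g \<psi>_in \<phi>_\<psi> qs.OgD(6)[OF h] by (cases "y \<in> VV") (auto simp: \<Phi>_def)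
  qed
  then show ?thesis using that gO by blast
qed

lemma \<Phi>_bij: "bij_betw \<Phi> (carrier OW) qs.Og"
proof (rule bij_betw_imageI)
  show "inj_on \<Phi> (carrier OW)" using \<Phi>_inj by (auto intro!: inj_onI)
  show "\<Phi> ` carrier OW = qs.Og"
  proof (intro equalityI subsetI)
    fix h assume "h \<in> qs.Og"
    then show "h \<in> \<Phi> ` carrier OW" using \<Phi>_surj by blast
  qed (auto intro: \<Phi>_in)
qed

lemma OW_comp: assumes "g \<in> carrier OW" "h \<in> carrier OW"
  shows "g \<otimes>\<^bsub>OW\<^esub> h \<in> carrier OW" "\<Phi> (g \<otimes>\<^bsub>OW\<^esub> h) = \<Phi> g \<circ> \<Phi> h"
proof -
  have eq: "\<Phi> (compose (carrier W) g h) = \<Phi> g \<circ> \<Phi> h"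
  proof
    fix y show "\<Phi> (compose (carrier W) g h) y = (\<Phi> g \<circ> \<Phi> h) y"
    proof (cases "y \<in> VV")
      case True
      have "h (\<psi> y) \<in> carrier W" by (rule OW_in[OF assms(2) \<psi>_in[OF True]])
      then show ?thesis using True by (simp add: \<Phi>_def compose_def \<psi>_in \<phi>_in \<psi>_\<phi>)
    qed (simp add: \<Phi>_def)
  qed
  then show "\<Phi> (g \<otimes>\<^bsub>OW\<^esub> h) = \<Phi> g \<circ> \<Phi> h" using OW_mult[OF assms] by simp
  \<comment> \<open>Closure of \<open>OW\<close> under products is pulled back from
    \<open>qs.Og\<close>: some \<open>k\<close> in \<open>OW\<close> has the right image, and
    injectivity of \<open>\<phi>\<close> identifies it with the composite.\<close>
  obtain k where k: "k \<in> carrier OW" "\<Phi> k = \<Phi> g \<circ> \<Phi> h"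
    using \<Phi>_surj[OF qs.Og_comp[OF \<Phi>_in[OF assms(1)] \<Phi>_in[OF assms(2)]]] .
  have "compose (carrier W) g h = k"
  proof (rule extensionalityI[OF compose_extensional OW_ext[OF k(1)]])
    fix x assume x: "x \<in> carrier W"
    have "\<phi> (k x) = \<phi> (g (h x))" using k(2) \<Phi>_\<phi>[OF x, of k] \<Phi>_\<phi>[OF x, of h] \<Phi>_\<phi>[OF OW_in[OF assms(2) x], of g] by simp
    then have "k x = g (h x)"
      using \<phi>_inj[OF OW_in[OF k(1) x] OW_in[OF assms(1) OW_in[OF assms(2) x]]] by blast
    then show "compose (carrier W) g h x = k x" using x by (simp add: compose_def)
  qed
  then show "g \<otimes>\<^bsub>OW\<^esub> h \<in> carrier OW" using k OW_mult[OF assms] by simp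
qed

lemma reflection_in: assumes v: "v \<in> carrier W" "QW v \<noteq> 0"
  shows "reflection F W QW v \<in> carrier OW" "\<Phi> (reflection F W QW v) = qs.refl (\<phi> v)"
    "lat_q d (\<phi> v) \<noteq> 0"
proof -
  show Q0: "lat_q d (\<phi> v) \<noteq> 0"
    using v(2) inc_inj[OF QW_in[of v] R.zero_closed] by (simp add: \<phi>_Q R.res_zero_eq)
  have unit: "QW v \<in> Units F" using v QW_in by (simp add: R.field_Units R.res_zero_eq)
  have "inc l (inv\<^bsub>F\<^esub> (QW v)) * inc l (QW v) = inc l 1"
    using R.Units_l_inv[OF unit] by (simp add: R.res_one_eq flip: inc_F)
  then have i1: "inc l (inv\<^bsub>F\<^esub> (QW v)) * lat_q d (\<phi> v) = inc l 1" by (simp add: \<phi>_Q)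
  have k: "qs.kinv (lat_q d (\<phi> v)) \<in> qs.K" "qs.kinv (lat_q d (\<phi> v)) * lat_q d (\<phi> v) = inc l 1"
    using qs.kinv[OF qs.Q_in_K[OF \<phi>_in[OF v(1)]] Q0] by auto
  have kinv: "inc l (inv\<^bsub>F\<^esub> (QW v)) = qs.kinv (lat_q d (\<phi> v))" (is "?a = ?k")
  proof -
    have "?a = ?a * inc l 1" by (simp flip: inc_mult)
    also have "\<dots> = ?a * (?k * lat_q d (\<phi> v))" by (simp only: k(2))
    also have "\<dots> = ?k * (?a * lat_q d (\<phi> v))" by (rule mult.left_commute)
    also have "\<dots> = ?k * inc l 1" by (simp only: i1)
    also have "\<dots> = ?k" using k(1) by (simp add: qs.K_def mult.commute)
    finally show ?thesis .
  qed
  have inK: "polar_form F W QW w v \<in> carrier F" for w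
    using QW_in by (simp add: polar_form_def)
  have \<phi>r: "\<phi> (reflection F W QW v w) = qs.refl (\<phi> v) (\<phi> w)" if w: "w \<in> carrier W" for w
  proof -
    have "reflection F W QW v w = w \<ominus>\<^bsub>W\<^esub> ((polar_form F W QW w v \<otimes>\<^bsub>F\<^esub> inv\<^bsub>F\<^esub> (QW v)) \<odot>\<^bsub>W\<^esub> v)"
      using w by (simp add: reflection_def)
    moreover have "(polar_form F W QW w v \<otimes>\<^bsub>F\<^esub> inv\<^bsub>F\<^esub> (QW v)) \<odot>\<^bsub>W\<^esub> v \<in> carrier W"
      using inK unit v by simp
    ultimately show ?thesis using w
      by (simp add: \<phi>_minus \<phi>_smult inc_F kinv qs.refl_def \<phi>_in \<phi>_B)
  qed
  have rO: "qs.refl (\<phi> v) \<in> qs.Og" by (rule qs.refl_in_Og[OF \<phi>_in[OF v(1)] Q0])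
  obtain g where g: "g \<in> carrier OW" "\<Phi> g = qs.refl (\<phi> v)" using \<Phi>_surj[OF rO] .
  have "reflection F W QW v = g"
  proof (rule extensionalityI[OF _ OW_ext[OF g(1)]])
    show "reflection F W QW v \<in> extensional (carrier W)" by (simp add: reflection_def)
    fix w assume w: "w \<in> carrier W"
    have "\<phi> (g w) = \<phi> (reflection F W QW v w)" using \<Phi>_\<phi>[OF w, of g] g(2) \<phi>r[OF w] by simp
    moreover have "reflection F W QW v w \<in> carrier W"
      using w inK unit v by (simp add: reflection_def)
    ultimately show "reflection F W QW v w = g w" using \<phi>_inj[OF OW_in[OF g(1) w]] by metis
  qed
  then show "reflection F W QW v \<in> carrier OW" "\<Phi> (reflection F W QW v) = qs.refl (\<phi> v)" using g by auto
qed

text \<open>\<open>\<phi>\<close> maps the kernel onto \<open>qs.Fix (\<Phi> g)\<close>. Both have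
  the same number of elements, and the dimension is the exponent of \<open>l\<close> in it.\<close>

lemma fixed_space_dim_eq:
  assumes g: "g \<in> carrier OW"
  shows "fixed_space_dim F W g = qs.fdim (\<Phi> g)"
proof -
  have gh: "g \<in> module_hom F W W" using g by (simp add: OW_iff)
  have "(\<lambda>x. g x \<ominus>\<^bsub>W\<^esub> x) \<in> module_hom F W W"
    unfolding module_hom_def
  proof safe
    fix x assume "x \<in> carrier W" then show "g x \<ominus>\<^bsub>W\<^esub> x \<in> carrier W" using OW_in[OF g] by simp
  next
    fix x y assume xy: "x \<in> carrier W" "y \<in> carrier W"
    have gxy: "g x \<in> carrier W" "g y \<in> carrier W" using OW_in[OF g] xy by auto
    have "\<phi> (g (x \<oplus>\<^bsub>W\<^esub> y) \<ominus>\<^bsub>W\<^esub> (x \<oplus>\<^bsub>W\<^esub> y)) = \<phi> (g x \<ominus>\<^bsub>W\<^esub> x \<oplus>\<^bsub>W\<^esub> (g y \<ominus>\<^bsub>W\<^esub> y))"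
      using xy gxy by (simp add: module_hom_add[OF gh] \<phi>_add \<phi>_minus)
    then show "g (x \<oplus>\<^bsub>W\<^esub> y) \<ominus>\<^bsub>W\<^esub> (x \<oplus>\<^bsub>W\<^esub> y) = g x \<ominus>\<^bsub>W\<^esub> x \<oplus>\<^bsub>W\<^esub> (g y \<ominus>\<^bsub>W\<^esub> y)"
      using \<phi>_inj xy gxy OW_in[OF g, of "x \<oplus>\<^bsub>W\<^esub> y"] by simp
  next
    fix r x assume r: "r \<in> carrier F" and x: "x \<in> carrier W"
    have gx: "g x \<in> carrier W" using OW_in[OF g] x by auto
    have "\<phi> (g (r \<odot>\<^bsub>W\<^esub> x) \<ominus>\<^bsub>W\<^esub> (r \<odot>\<^bsub>W\<^esub> x)) = \<phi> (r \<odot>\<^bsub>W\<^esub> (g x \<ominus>\<^bsub>W\<^esub> x))"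
      using r x gx by (simp add: module_hom_smult[OF gh] \<phi>_smult \<phi>_minus qs.scale_right_diff_distrib)
    then show "g (r \<odot>\<^bsub>W\<^esub> x) \<ominus>\<^bsub>W\<^esub> (r \<odot>\<^bsub>W\<^esub> x) = r \<odot>\<^bsub>W\<^esub> (g x \<ominus>\<^bsub>W\<^esub> x)"
      using \<phi>_inj r x gx OW_in[OF g, of "r \<odot>\<^bsub>W\<^esub> x"] by simp
  qed
  then interpret mh: mod_hom F W W "\<lambda>x. g x \<ominus>\<^bsub>W\<^esub> x"
    using module_W by (simp add: mod_hom_def mod_hom_axioms_def)
  have sub: "submodule F mh.ker W" by (rule mh.ker_is_submodule)
  interpret ker: vectorspace F "W\<lparr>carrier := mh.ker\<rparr>"
    by (rule W.subspace_is_vs) (simp add: VectorSpace.subspace_def sub W.vectorspace_axioms)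
  have kW: "mh.ker \<subseteq> carrier W" by (auto simp: mh.ker_def)
  have "\<phi> ` mh.ker = qs.Fix (\<Phi> g)"
  proof (intro equalityI subsetI)
    fix y assume "y \<in> \<phi> ` mh.ker"
    then obtain x where x: "y = \<phi> x" "x \<in> carrier W" "g x \<ominus>\<^bsub>W\<^esub> x = \<zero>\<^bsub>W\<^esub>" by (auto simp: mh.ker_def)
    then have "\<phi> (g x) - \<phi> x = 0" using \<phi>_minus[OF OW_in[OF g x(2)] x(2)] by (simp add: \<phi>_zero)
    then show "y \<in> qs.Fix (\<Phi> g)" using x by (simp add: qs.Fix_def \<Phi>_\<phi> \<phi>_in)
  next
    fix y assume y: "y \<in> qs.Fix (\<Phi> g)"
    then obtain x where x: "x \<in> carrier W" "y = \<phi> x" using \<phi>_surj by (auto simp: qs.Fix_def)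
    then have "\<phi> (g x \<ominus>\<^bsub>W\<^esub> x) = \<phi> \<zero>\<^bsub>W\<^esub>"
      using y \<phi>_minus[OF OW_in[OF g x(1)] x(1)] by (simp add: \<phi>_zero qs.Fix_def \<Phi>_\<phi>)
    then have "g x \<ominus>\<^bsub>W\<^esub> x = \<zero>\<^bsub>W\<^esub>" using \<phi>_inj OW_in[OF g x(1)] x by simp
    then show "y \<in> \<phi> ` mh.ker" using x by (auto simp: mh.ker_def)
  qed
  moreover have "inj_on \<phi> mh.ker" using \<phi>_bij kW by (auto simp: bij_betw_def inj_on_def)
  then have "card (\<phi> ` mh.ker) = card mh.ker" by (rule card_image)
  ultimately have "card mh.ker = card (qs.Fix (\<Phi> g))" by simp
  moreover have "card mh.ker = l ^ ker.dim"
    using ker.card_eq_power_dim finite_subset[OF kW finite_W] R.finite by (simp add: R.res_carrier_eq)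
  ultimately have "card (qs.Fix (\<Phi> g)) = l ^ ker.dim" by simp
  then have "qs.fdim (\<Phi> g) = ker.dim" by (rule qs.fdim_eqI)
  then show ?thesis by (simp add: fixed_space_dim_def)
qed

end

section \<open>Identification of the spinor norm\<close>

context reduction begin

section \<open>Square classes of the prime field\<close>

lemma Units_F: "a \<in> Units F \<longleftrightarrow> a \<in> carrier F \<and> a \<noteq> 0"
  by (simp add: R.field_Units R.res_zero_eq)

lemma inc_nonzero: "a \<in> Units F \<Longrightarrow> inc l a \<noteq> 0"
  using inc_inj[OF _ R.zero_closed, of a] by (auto simp: Units_F R.res_zero_eq)

sublocale U: comm_group "units_of F"
  by (rule R.units_comm_group)

lemma subgroup_squares: "subgroup (unit_squares F) (units_of F)"
proof (rule U.subgroupI)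
  show "unit_squares F \<subseteq> carrier (units_of F)" by (auto simp: unit_squares_def units_of_carrier)
  show "unit_squares F \<noteq> {}" by (auto simp: unit_squares_def)
  fix a assume "a \<in> unit_squares F"
  then obtain x where x: "x \<in> Units F" "a = x \<otimes>\<^bsub>F\<^esub> x" by (auto simp: unit_squares_def)
  have "inv\<^bsub>units_of F\<^esub> a = (inv\<^bsub>units_of F\<^esub> x) \<otimes>\<^bsub>F\<^esub> (inv\<^bsub>units_of F\<^esub> x)"
    using x U.inv_mult_group[of x x] by (simp add: units_of_carrier units_of_mult)
  moreover have "inv\<^bsub>units_of F\<^esub> x \<in> Units F" using x U.inv_closed[of x] by (simp add: units_of_carrier)
  ultimately show "inv\<^bsub>units_of F\<^esub> a \<in> unit_squares F" by (auto simp: unit_squares_def)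
  fix b assume "b \<in> unit_squares F"
  then obtain y where y: "y \<in> Units F" "b = y \<otimes>\<^bsub>F\<^esub> y" by (auto simp: unit_squares_def)
  have "a \<otimes>\<^bsub>F\<^esub> b = (x \<otimes>\<^bsub>F\<^esub> y) \<otimes>\<^bsub>F\<^esub> (x \<otimes>\<^bsub>F\<^esub> y)"
    using x y by (simp add: R.m_ac R.Units_closed)
  then show "a \<otimes>\<^bsub>units_of F\<^esub> b \<in> unit_squares F"
    using x y by (auto simp: unit_squares_def units_of_mult intro!: image_eqI[of _ _ "x \<otimes>\<^bsub>F\<^esub> y"])
qed

sublocale SQ: normal "unit_squares F" "units_of F"
  using subgroup_squares by (simp add: U.normal_iff_subgroup)

abbreviation "sc \<equiv> square_class F"

lemma sc_mult:
  assumes "a \<in> Units F" "b \<in> Units F"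
  shows "sc a \<otimes>\<^bsub>square_class_group F\<^esub> sc b = sc (a \<otimes>\<^bsub>F\<^esub> b)"
  using SQ.rcos_sum[of a b] assms
  by (simp add: square_class_group_def square_class_def FactGroup_def units_of_carrier units_of_mult)

lemma sc_carrier: "carrier (square_class_group F) = sc ` Units F"
  by (auto simp: square_class_group_def square_class_def FactGroup_def RCOSETS_def units_of_carrier)

lemma sc_eq:
  assumes "a \<in> Units F" "b \<in> Units F"
  shows "sc a = sc b \<longleftrightarrow> (\<exists>s\<in>Units F. a = s \<otimes>\<^bsub>F\<^esub> s \<otimes>\<^bsub>F\<^esub> b)"
proof
  assume "sc a = sc b"
  then have "a \<in> unit_squares F #>\<^bsub>units_of F\<^esub> b"
    using U.rcos_self[OF _ subgroup_squares, of a] assms by (simp add: square_class_def units_of_carrier)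
  then show "\<exists>s\<in>Units F. a = s \<otimes>\<^bsub>F\<^esub> s \<otimes>\<^bsub>F\<^esub> b"
    by (auto simp: r_coset_def unit_squares_def units_of_mult)
next
  assume "\<exists>s\<in>Units F. a = s \<otimes>\<^bsub>F\<^esub> s \<otimes>\<^bsub>F\<^esub> b"
  then have "a \<in> unit_squares F #>\<^bsub>units_of F\<^esub> b"
    by (auto simp: r_coset_def unit_squares_def units_of_mult)
  then show "sc a = sc b"
    using U.repr_independence[OF _ _ subgroup_squares, of a b] assms by (simp add: square_class_def units_of_carrier)
qed

lemma is_sq_inc:
  assumes "a \<in> Units F"
  shows "qs.is_sq (inc l a) \<longleftrightarrow> (\<exists>s\<in>Units F. a = s \<otimes>\<^bsub>F\<^esub> s)"
proof
  assume "qs.is_sq (inc l a)"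
  then obtain r where r: "r \<in> qs.K" "r * r = inc l a" by (auto simp: qs.is_sq_def)
  obtain s where s: "s \<in> carrier F" "r = inc l s" using K_inc[OF r(1)] .
  have "inc l (s \<otimes>\<^bsub>F\<^esub> s) = inc l a" using r s by (simp add: inc_F)
  then have "a = s \<otimes>\<^bsub>F\<^esub> s" using inc_inj s assms R.Units_closed by (metis R.m_closed)
  moreover have "s \<noteq> 0" using r(2) s inc_nonzero[OF assms] by auto
  ultimately show "\<exists>s\<in>Units F. a = s \<otimes>\<^bsub>F\<^esub> s" using s by (auto simp: Units_F)
next
  assume "\<exists>s\<in>Units F. a = s \<otimes>\<^bsub>F\<^esub> s"
  then obtain s where "a = s \<otimes>\<^bsub>F\<^esub> s" by blast
  then have "inc l s * inc l s = inc l a" by (simp add: inc_F)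
  then show "qs.is_sq (inc l a)" using inc_in_K by (auto simp: qs.is_sq_def)
qed

lemma one_unit: "1 \<in> Units F"
  using R.Units_one_closed by (simp add: R.res_one_eq)

lemma sc_one_iff: assumes "a \<in> Units F" shows "sc a = sc 1 \<longleftrightarrow> qs.is_sq (inc l a)"
proof -
  have "s \<otimes>\<^bsub>F\<^esub> s \<otimes>\<^bsub>F\<^esub> 1 = s \<otimes>\<^bsub>F\<^esub> s" if "s \<in> Units F" for s
    using R.r_one[of "s \<otimes>\<^bsub>F\<^esub> s"] that by (simp add: R.Units_closed R.res_one_eq)
  then show ?thesis using sc_eq[OF assms one_unit] is_sq_inc[OF assms] by auto
qed

definition nsq :: int where "nsq = (SOME b. b \<in> Units F \<and> \<not> qs.is_sq (inc l b))"

lemma nsq: assumes "odd l" shows "nsq \<in> Units F" "\<not> qs.is_sq (inc l nsq)"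
proof -
  obtain r where r: "r \<in> qs.K" "\<not> qs.is_sq r" using qs.nonsquare_exists[OF assms] .
  obtain b where b: "b \<in> carrier F" "r = inc l b" using K_inc[OF r(1)] .
  have "qs.is_sq 0" unfolding qs.is_sq_def by (intro bexI[of _ 0]) auto
  then have "b \<noteq> 0" using r b by auto
  then have "\<exists>b. b \<in> Units F \<and> \<not> qs.is_sq (inc l b)" using r b by (auto simp: Units_F)
  then have "nsq \<in> Units F \<and> \<not> qs.is_sq (inc l nsq)" unfolding nsq_def by (rule someI_ex)
  then show "nsq \<in> Units F" "\<not> qs.is_sq (inc l nsq)" by auto
qed

text \<open>Translates spinor signs into square classes; \<open>chi\<close> is the quadratic
  character, in the opposite direction. For \<open>l = 2\<close> the only sign is 1.\<close>

definition tau :: "int \<Rightarrow> int set" where "tau \<epsilon> = (if \<epsilon> = 1 then sc 1 else sc nsq)"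

definition chi :: "int \<Rightarrow> int" where "chi a = (if qs.is_sq (inc l a) then 1 else - 1)"

lemma l_even: assumes "even l" shows "l = 2"
  using assms prime prime_odd_nat[of l] l1 by (metis less_antisym numeral_2_eq_2 One_nat_def linorder_neqE_nat not_less_eq)

lemma is_sq_even: assumes "even l" shows "qs.is_sq (inc l a)"
proof -
  have "inc l a = 0 \<or> inc l a = inc l 1" using qs.two_e_zero(2)[OF l_even[OF assms]] inc_in_K[of a] by blast
  then have "inc l a * inc l a = inc l a" using qs.e_idem by auto
  then show ?thesis using inc_in_K by (auto simp: qs.is_sq_def)
qed

lemma chi_values: "chi a \<in> qs.sp_values"
  using is_sq_even by (auto simp: chi_def qs.sp_values_def)

text \<open>By \<open>nonsquare_ratio\<close> all nonsquares share the class of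
  \<open>nsq\<close>.\<close>

lemma sc_tau: assumes "a \<in> Units F" shows "sc a = tau (chi a)"
proof (cases "qs.is_sq (inc l a)")
  case True
  then show ?thesis using sc_one_iff[OF assms] by (simp add: tau_def chi_def)
next
  case False
  then have odd: "odd l" using is_sq_even by blast
  obtain r where r: "r \<in> qs.K" "r \<noteq> 0" "inc l a = inc l nsq * (r * r)"
    using qs.nonsquare_ratio[OF odd inc_in_K nsq(2)[OF odd] inc_in_K False] .
  obtain s where s: "s \<in> carrier F" "r = inc l s" using K_inc[OF r(1)] .
  have su: "s \<in> Units F" using s r by (auto simp: Units_F)
  have "inc l a = inc l (s \<otimes>\<^bsub>F\<^esub> s \<otimes>\<^bsub>F\<^esub> nsq)" using r s by (simp add: inc_F mult_ac)
  then have "a = s \<otimes>\<^bsub>F\<^esub> s \<otimes>\<^bsub>F\<^esub> nsq"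
    using inc_inj[of a "s \<otimes>\<^bsub>F\<^esub> s \<otimes>\<^bsub>F\<^esub> nsq"] assms s nsq(1)[OF odd] R.Units_closed by simp
  then have "sc a = sc nsq" using sc_eq[OF assms nsq(1)[OF odd]] su by blast
  then show ?thesis using False by (simp add: tau_def chi_def)
qed

lemma tau_in: assumes "\<epsilon> \<in> qs.sp_values" shows "\<exists>a\<in>Units F. tau \<epsilon> = sc a"
  using assms one_unit nsq(1) by (auto simp: tau_def qs.sp_values_def split: if_splits)

lemma sc_square: assumes "a \<in> Units F" shows "sc a \<otimes>\<^bsub>square_class_group F\<^esub> sc a = tau 1"
proof -
  have u: "a \<otimes>\<^bsub>F\<^esub> a \<in> Units F" using assms by simp
  have "sc (a \<otimes>\<^bsub>F\<^esub> a) = sc 1" using sc_one_iff[OF u] is_sq_inc[OF u] assms by blast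
  then show ?thesis using sc_mult[OF assms assms] by (simp add: tau_def)
qed

lemma sc_one_mult: assumes "a \<in> Units F"
  shows "sc a \<otimes>\<^bsub>square_class_group F\<^esub> tau 1 = sc a" "tau 1 \<otimes>\<^bsub>square_class_group F\<^esub> sc a = sc a"
proof -
  have "a \<otimes>\<^bsub>F\<^esub> 1 = a" "1 \<otimes>\<^bsub>F\<^esub> a = a"
    using R.r_one[of a] R.l_one[of a] assms by (simp_all add: R.Units_closed R.res_one_eq)
  then show "sc a \<otimes>\<^bsub>square_class_group F\<^esub> tau 1 = sc a" "tau 1 \<otimes>\<^bsub>square_class_group F\<^esub> sc a = sc a"
    using sc_mult[OF assms one_unit] sc_mult[OF one_unit assms] by (simp_all add: tau_def)
qed

lemma tau_mult:
  assumes "\<epsilon> \<in> qs.sp_values" "\<epsilon>' \<in> qs.sp_values"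
  shows "tau \<epsilon> \<otimes>\<^bsub>square_class_group F\<^esub> tau \<epsilon>' = tau (\<epsilon> * \<epsilon>')"
proof -
  have A: "tau \<epsilon> \<otimes>\<^bsub>square_class_group F\<^esub> tau 1 = tau \<epsilon>"
    "tau 1 \<otimes>\<^bsub>square_class_group F\<^esub> tau \<epsilon>' = tau \<epsilon>'"
    "tau \<epsilon> \<otimes>\<^bsub>square_class_group F\<^esub> tau \<epsilon> = tau 1"
    using tau_in[OF assms(1)] tau_in[OF assms(2)] sc_one_mult sc_square by metis+
  have "\<epsilon> = 1 \<or> \<epsilon> = - 1" "\<epsilon>' = 1 \<or> \<epsilon>' = - 1"
    using assms by (auto simp: qs.sp_values_def split: if_splits)
  then consider "\<epsilon> = 1" | "\<epsilon>' = 1" | "\<epsilon> = - 1" "\<epsilon>' = - 1" by blast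
  then show ?thesis
  proof cases
    case 1
    then show ?thesis using A(2) by simp
  next
    case 2
    then show ?thesis using A(1) by simp
  next
    case 3
    then have "\<epsilon>' = \<epsilon>" "\<epsilon> * \<epsilon>' = 1" by simp_all
    then show ?thesis using A(3) by (simp only:)
  qed
qed

lemma tau_inj: assumes "\<epsilon> \<in> qs.sp_values" "\<epsilon>' \<in> qs.sp_values" "tau \<epsilon> = tau \<epsilon>'" shows "\<epsilon> = \<epsilon>'"
proof (cases "odd l")
  case True
  have "sc nsq \<noteq> sc 1" using sc_one_iff[OF nsq(1)[OF True]] nsq(2)[OF True] by simp
  then show ?thesis using assms by (auto simp: tau_def qs.sp_values_def True split: if_splits)
qed (use assms in \<open>auto simp: qs.sp_values_def\<close>)

lemma sp_reflection:
  assumes v: "v \<in> carrier W" "QW v \<noteq> 0"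
  shows "tau (qs.sp (\<Phi> (reflection F W QW v))) = sc (\<ominus>\<^bsub>F\<^esub> QW v)"
proof -
  have u: "\<ominus>\<^bsub>F\<^esub> QW v \<in> Units F"
  proof -
    have "\<ominus>\<^bsub>F\<^esub> QW v \<noteq> \<zero>\<^bsub>F\<^esub>" using v(2) QW_in[of v] R.a_inv_closed R.minus_zero R.minus_minus R.res_zero_eq by metis
    then show ?thesis using QW_in[of v] by (simp add: Units_F R.res_zero_eq)
  qed
  have "qs.sp (qs.refl (\<phi> v)) = chi (\<ominus>\<^bsub>F\<^esub> QW v)"
  proof (cases "odd l")
    case True
    show ?thesis using qs.sp_refl[OF True \<phi>_in[OF v(1)] reflection_in(3)[OF v]]
      by (simp add: chi_def inc_F \<phi>_Q)
  next
    case False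
    then show ?thesis using is_sq_even by (simp add: chi_def qs.sp_def)
  qed
  then show ?thesis using sc_tau[OF u] reflection_in(2)[OF v] by simp
qed

section \<open>Existence and uniqueness of the spinor norm\<close>

definition is_spinor :: "(((nat \<Rightarrow> int) \<Rightarrow> nat \<Rightarrow> int) \<Rightarrow> int set) \<Rightarrow> bool" where
  "is_spinor s \<longleftrightarrow> s \<in> hom OW (square_class_group F) \<and> s \<in> extensional (carrier OW)
     \<and> (\<forall>v\<in>carrier W. QW v \<noteq> \<zero>\<^bsub>F\<^esub> \<longrightarrow> s (reflection F W QW v) = sc (\<ominus>\<^bsub>F\<^esub> QW v))"

lemma is_spinor_sp: "is_spinor (\<lambda>g\<in>carrier OW. tau (qs.sp (\<Phi> g)))"
proof -
  let ?s = "\<lambda>g\<in>carrier OW. tau (qs.sp (\<Phi> g))"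
  have "?s \<in> hom OW (square_class_group F)"
  proof (rule homI)
    fix g assume "g \<in> carrier OW"
    then show "?s g \<in> carrier (square_class_group F)"
      using tau_in[OF qs.sp_in_values, of "\<Phi> g"] by (auto simp: sc_carrier)
    fix h assume h: "h \<in> carrier OW"
    show "?s (g \<otimes>\<^bsub>OW\<^esub> h) = ?s g \<otimes>\<^bsub>square_class_group F\<^esub> ?s h"
      using \<open>g \<in> carrier OW\<close> h OW_comp[of g h] qs.sp_comp[OF \<Phi>_in \<Phi>_in, of g h]
      by (simp add: tau_mult[OF qs.sp_in_values qs.sp_in_values])
  qed
  moreover have "?s (reflection F W QW v) = sc (\<ominus>\<^bsub>F\<^esub> QW v)" if "v \<in> carrier W" "QW v \<noteq> \<zero>\<^bsub>F\<^esub>" for v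
    using reflection_in(1)[of v] sp_reflection[of v] that by (simp add: R.res_zero_eq)
  ultimately show ?thesis by (auto simp: is_spinor_def)
qed

text \<open>For even \<open>l\<close> every unit is a square and the target is trivial. For odd
  \<open>l\<close>, induction over \<open>R2\<close>: reflections are prescribed, and squares go to
  the trivial class because the target has exponent two.\<close>

lemma spinor_unique:
  assumes s: "is_spinor s" and g: "g \<in> carrier OW"
  shows "s g = tau (qs.sp (\<Phi> g))"
proof (cases "odd l")
  case False
  have "s g \<in> carrier (square_class_group F)" using s g by (auto simp: is_spinor_def hom_def)
  then obtain a where "a \<in> Units F" "s g = sc a" by (auto simp: sc_carrier)
  then show ?thesis using sc_one_iff is_sq_even False by (simp add: tau_def qs.sp_def)
next
  case True
  have s_mult: "s (a \<otimes>\<^bsub>OW\<^esub> b) = s a \<otimes>\<^bsub>square_class_group F\<^esub> s b" if "a \<in> carrier OW" "b \<in> carrier OW" for a b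
    using s that by (auto simp: is_spinor_def hom_def)
  have s_sq: "s a \<otimes>\<^bsub>square_class_group F\<^esub> s a = tau 1" if "a \<in> carrier OW" for a
  proof -
    have "s a \<in> carrier (square_class_group F)" using s that by (auto simp: is_spinor_def hom_def)
    then show ?thesis using sc_square by (auto simp: sc_carrier)
  qed
  have "\<forall>g\<in>carrier OW. \<Phi> g = h \<longrightarrow> s g = tau (qs.sp h)" if "h \<in> qs.R2" for h
    using that
  proof (induction rule: qs.R2.induct)
    case R2_id
    show ?case
    proof (intro ballI impI)
      fix g assume g: "g \<in> carrier OW" "\<Phi> g = id"
      \<comment> \<open>The neutral element is treated as an idempotent: its image equals its own
        square and is therefore trivial.\<close>
      have "g \<otimes>\<^bsub>OW\<^esub> g = g" using \<Phi>_inj[OF OW_comp(1)[OF g(1) g(1)] g(1)] OW_comp(2)[OF g(1) g(1)] g by simp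
      then have "s g = tau 1" using s_mult[OF g(1) g(1)] s_sq[OF g(1)] by simp
      moreover have "qs.sp id = 1" by (simp add: qs.sp_def)
      ultimately show "s g = tau (qs.sp id)" by simp
    qed
  next
    case (R2_refl h v)
    show ?case
    proof (intro ballI impI)
      fix g assume g: "g \<in> carrier OW" "\<Phi> g = qs.refl v \<circ> h"
      have hO: "h \<in> qs.Og" by (rule qs.R2_subset[OF R2_refl.hyps(1)])
      obtain k where k: "k \<in> carrier OW" "\<Phi> k = h" using \<Phi>_surj[OF hO] .
      obtain w where w: "w \<in> carrier W" "v = \<phi> w" using \<phi>_surj[OF R2_refl.hyps(2)] .
      have Qw: "QW w \<noteq> 0" using R2_refl.hyps(3) w by (auto simp: \<phi>_Q)
      note r = reflection_in[OF w(1) Qw]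
      have "g = reflection F W QW w \<otimes>\<^bsub>OW\<^esub> k"
        by (rule \<Phi>_inj[OF g(1) OW_comp(1)[OF r(1) k(1)]]) (simp add: OW_comp(2)[OF r(1) k(1)] r(2) g(2) k(2) w(2))
      then have "s g = s (reflection F W QW w) \<otimes>\<^bsub>square_class_group F\<^esub> s k" using s_mult[OF r(1) k(1)] by simp
      also have "s (reflection F W QW w) = tau (qs.sp (qs.refl v))"
        using s w Qw sp_reflection[OF w(1) Qw] r(2) by (auto simp: is_spinor_def R.res_zero_eq)
      also have "s k = tau (qs.sp h)" using R2_refl.IH k by blast
      also have "tau (qs.sp (qs.refl v)) \<otimes>\<^bsub>square_class_group F\<^esub> tau (qs.sp h) = tau (qs.sp (qs.refl v) * qs.sp h)"
        by (rule tau_mult[OF qs.sp_in_values qs.sp_in_values])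
      also have "qs.sp (qs.refl v) * qs.sp h = qs.sp (qs.refl v \<circ> h)"
        by (rule qs.sp_comp[symmetric, OF qs.refl_in_Og[OF R2_refl.hyps(2,3)] hO])
      finally show "s g = tau (qs.sp (qs.refl v \<circ> h))" .
    qed
  next
    case (R2_square h t)
    show ?case
    proof (intro ballI impI)
      fix g assume g: "g \<in> carrier OW" "\<Phi> g = t \<circ> t \<circ> h"
      have hO: "h \<in> qs.Og" by (rule qs.R2_subset[OF R2_square.hyps(1)])
      obtain k where k: "k \<in> carrier OW" "\<Phi> k = h" using \<Phi>_surj[OF hO] .
      obtain a where a: "a \<in> carrier OW" "\<Phi> a = t" using \<Phi>_surj[OF R2_square.hyps(2)] .
      note aa = OW_comp[OF a(1) a(1)]
      have "g = (a \<otimes>\<^bsub>OW\<^esub> a) \<otimes>\<^bsub>OW\<^esub> k"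
        by (rule \<Phi>_inj[OF g(1) OW_comp(1)[OF aa(1) k(1)]])
           (simp only: OW_comp(2)[OF aa(1) k(1)] aa(2) g(2) k(2) a(2))
      then have "s g = (s a \<otimes>\<^bsub>square_class_group F\<^esub> s a) \<otimes>\<^bsub>square_class_group F\<^esub> s k"
        using s_mult[OF aa(1) k(1)] s_mult[OF a(1) a(1)] by simp
      also have "\<dots> = tau 1 \<otimes>\<^bsub>square_class_group F\<^esub> tau (qs.sp h)"
        using s_sq[OF a(1)] R2_square.IH k by simp
      also have "\<dots> = tau (qs.sp h)"
        using tau_mult[OF _ qs.sp_in_values[of h], of 1] by (simp add: qs.sp_values_def)
      also have "qs.sp h = qs.sp (t \<circ> t \<circ> h)"
      proof -
        have "qs.sp (t \<circ> t \<circ> h) = qs.sp t * qs.sp t * qs.sp h"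
          using qs.sp_comp[OF qs.Og_comp[OF R2_square.hyps(2) R2_square.hyps(2)] hO]
            qs.sp_comp[OF R2_square.hyps(2) R2_square.hyps(2)] by (simp only:)
        then show ?thesis using qs.sp_cases[of t] by auto
      qed
      finally show "s g = tau (qs.sp (t \<circ> t \<circ> h))" .
    qed
  qed
  then show ?thesis using \<Phi>_in[OF g] qs.Og_eq_R2[OF True] g by blast
qed

lemma spinor_norm_eq: assumes "g \<in> carrier OW" shows "spinor_norm F W QW g = tau (qs.sp (\<Phi> g))"
proof -
  have "spinor_norm F W QW = (THE s. is_spinor s)" by (simp add: spinor_norm_def is_spinor_def)
  also have "\<dots> = (\<lambda>g\<in>carrier OW. tau (qs.sp (\<Phi> g)))"
  proof (rule the_equality)
    show "is_spinor (\<lambda>g\<in>carrier OW. tau (qs.sp (\<Phi> g)))" by (rule is_spinor_sp)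
    fix s assume s: "is_spinor s"
    show "s = (\<lambda>g\<in>carrier OW. tau (qs.sp (\<Phi> g)))"
      by (rule extensionalityI[where A = "carrier OW"]) (use s spinor_unique[OF s] in \<open>auto simp: is_spinor_def\<close>)
  qed
  finally show ?thesis using assms by simp
qed

text \<open>\<open>q\<close> enters only through the class of \<open>q ^ (d - 1)\<close>, a unit
  since \<open>q\<close> is prime to \<open>l\<close>. All later bounds are therefore uniform in
  \<open>q\<close>.\<close>

lemma H_set_eq:
  assumes "gcd q (2 * l) = 1"
  obtains \<epsilon> where "\<epsilon> \<in> qs.sp_values" "H_set l d q = {g \<in> carrier OW. qs.sp (\<Phi> g) = \<epsilon>}"
proof -
  define u where "u = int q ^ (d - 1) mod int l"
  have "coprime q l" using assms by (metis coprime_iff_gcd_eq_1 coprime_mult_right_iff)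
  then have "coprime (int q ^ (d - 1)) (int l)" by simp
  then have u: "u \<in> Units F" unfolding u_def using l1 by (intro R.mod_in_res_units) auto
  have "H_set l d q = {g \<in> carrier OW. qs.sp (\<Phi> g) = chi u}"
  proof -
    have "spinor_norm F W QW g = sc u \<longleftrightarrow> qs.sp (\<Phi> g) = chi u" if "g \<in> carrier OW" for g
      using spinor_norm_eq[OF that] sc_tau[OF u] tau_inj[OF qs.sp_in_values chi_values] by metis
    then show ?thesis by (auto simp: H_set_def u_def)
  qed
  then show ?thesis using that chi_values by blast
qed

text \<open>A spinor class consists of two parity classes of equal size, so the distribution is half
  of the one conditioned on the parity of \<open>v\<close>; hence the factor 2.\<close>

lemma pmf_fixed_dim:
  assumes "gcd q (2 * l) = 1"
  obtains \<epsilon> where "\<epsilon> \<in> qs.sp_values"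
    "\<And>v. pmf (fixed_dim_pmf l d q) v =
      real (card {g \<in> qs.cls \<epsilon> (even v). qs.fdim g = v}) / (2 * real (card (qs.cls \<epsilon> (even v))))"
proof -
  obtain \<epsilon> where \<epsilon>: "\<epsilon> \<in> qs.sp_values" "H_set l d q = {g \<in> carrier OW. qs.sp (\<Phi> g) = \<epsilon>}"
    using H_set_eq[OF assms] .
  let ?H = "H_set l d q" and ?H' = "{h \<in> qs.Og. qs.sp h = \<epsilon>}"
  have inj: "inj_on \<Phi> (carrier OW)" using \<Phi>_bij by (simp add: bij_betw_def)
  have card_eq: "card {g \<in> ?H. P (\<Phi> g)} = card {h \<in> ?H'. P h}" for P
  proof -
    have "\<Phi> ` {g \<in> ?H. P (\<Phi> g)} = {h \<in> ?H'. P h}"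
      unfolding \<epsilon>(2) using \<Phi>_in \<Phi>_surj by (auto simp: image_iff) (metis \<Phi>_surj)
    moreover have "inj_on \<Phi> {g \<in> ?H. P (\<Phi> g)}" using inj unfolding \<epsilon>(2) by (rule inj_on_subset) auto
    then have "card (\<Phi> ` {g \<in> ?H. P (\<Phi> g)}) = card {g \<in> ?H. P (\<Phi> g)}" by (rule card_image)
    ultimately show ?thesis by simp
  qed
  have npos: "6 * d - 2 > 0" using d by simp
  have H'_split: "card ?H' = 2 * card (qs.cls \<epsilon> \<delta>)" for \<delta>
  proof -
    have "?H' = qs.cls \<epsilon> True \<union> qs.cls \<epsilon> False" by (auto simp: qs.cls_def)
    then have "card ?H' = card (qs.cls \<epsilon> True) + card (qs.cls \<epsilon> False)"
      using card_Un_disjoint[OF qs.finite_cls[of \<epsilon> True] qs.finite_cls[of \<epsilon> False]]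
      by (simp only:) (auto simp: qs.cls_def)
    moreover have eq: "card (qs.cls \<epsilon> \<delta>') = card (qs.cls \<epsilon> \<delta>)" for \<delta>'
    proof -
      have "2 * card qs.sp_values * card (qs.cls \<epsilon> \<delta>') = 2 * card qs.sp_values * card (qs.cls \<epsilon> \<delta>)"
        using qs.card_cls[OF \<epsilon>(1) npos] by simp
      moreover have "card qs.sp_values > 0" by (simp add: qs.sp_values_def)
      ultimately show ?thesis by simp
    qed
    ultimately show ?thesis using eq[of True] eq[of False] by linarith
  qed
  have "card qs.Og > 0" using qs.finite_Og qs.Og_id by (auto simp: card_gt_0_iff)
  then have "card (qs.cls \<epsilon> True) > 0" using qs.card_cls[OF \<epsilon>(1) npos, of True] by (metis mult_0_right not_gr_zero)
  then have H'pos: "card ?H' > 0" using H'_split[of True] by simp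
  have cardH: "card ?H = card ?H'" using card_eq[of "\<lambda>_. True"] by simp
  then have "card ?H > 0" using H'pos by linarith
  then have finH: "finite ?H" and neH: "?H \<noteq> {}" unfolding card_gt_0_iff by blast+
  have "pmf (fixed_dim_pmf l d q) v =
      real (card {g \<in> qs.cls \<epsilon> (even v). qs.fdim g = v}) / (2 * real (card (qs.cls \<epsilon> (even v))))" for v
  proof -
    have "pmf (fixed_dim_pmf l d q) v = measure (pmf_of_set ?H) (fixed_space_dim F W -` {v})"
      unfolding fixed_dim_pmf_def by (simp add: pmf_map)
    also have "\<dots> = real (card (?H \<inter> fixed_space_dim F W -` {v})) / real (card ?H)"
      by (rule measure_pmf_of_set[OF neH finH])
    also have "?H \<inter> fixed_space_dim F W -` {v} = {g \<in> ?H. qs.fdim (\<Phi> g) = v}"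
      unfolding \<epsilon>(2) using fixed_space_dim_eq by auto
    also have "card \<dots> = card {h \<in> ?H'. qs.fdim h = v}" by (rule card_eq)
    also have "{h \<in> ?H'. qs.fdim h = v} = {g \<in> qs.cls \<epsilon> (even v). qs.fdim g = v}"
      by (auto simp: qs.cls_def)
    finally show ?thesis unfolding cardH H'_split[of "even v"] by simp
  qed
  then show ?thesis using that \<epsilon>(1) by blast
qed

end

section \<open>The limiting distribution\<close>

text \<open>\<open>P_infty\<close> without its normalising infinite product.\<close>

definition weight :: "nat \<Rightarrow> nat \<Rightarrow> real" where
  "weight l v = 1 / (real l ^ (v * (v - 1) div 2) * (\<Prod>i=1..v. 1 - 1 / real l ^ i))"

definition tri :: "nat \<Rightarrow> nat" where
  "tri m = m * (m + 1) div 2"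

lemma tri_Suc: "tri (Suc m) = tri m + Suc m"
proof -
  have "Suc m * (Suc m + 1) = m * (m + 1) + Suc m * 2" by (simp add: algebra_simps)
  then show ?thesis unfolding tri_def by simp
qed

lemma tri_double: "2 * tri m = m * (m + 1)"
  by (simp add: tri_def)

lemma tri_pred: "v * (v - 1) div 2 = tri (v - 1)"
  by (cases v) (simp_all add: tri_def mult.commute)

text \<open>The factors grow with \<open>l\<close>, so 2 is the worst case. There the induction
  needs the slack \<open>1 / 2 ^ Suc v\<close>, with equality at \<open>v = 1\<close>, to survive
  the next factor.\<close>

lemma pochhammer_lower:
  assumes "l \<ge> 2"
  shows "(\<Prod>i=1..v. 1 - 1 / real l ^ i) \<ge> 1 / 4"
proof -
  have two: "(\<Prod>i=1..v. 1 - 1 / (2::real) ^ i) \<ge> 1 / 4 + 1 / 2 ^ Suc v" if "v \<ge> 1" for v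
    using that
  proof (induction v rule: dec_induct)
    case (step v)
    define t where "t = 1 / (2::real) ^ Suc v"
    have t: "0 < t" "t \<le> 1 / 4"
    proof -
      have "(2::real) ^ 2 \<le> 2 ^ Suc v" using step.hyps by (intro power_increasing) auto
      then show "t \<le> 1 / 4" by (simp add: t_def field_simps)
    qed (simp add: t_def)
    have "1 / 4 + 1 / 2 ^ Suc (Suc v) = 1 / 4 + t / 2" by (simp add: t_def)
    also have "\<dots> \<le> (1 / 4 + t) * (1 - t)"
    proof -
      have "(1 / 4 + t) * (1 - t) - (1 / 4 + t / 2) = t * (1 / 4 - t)" by (simp add: field_simps)
      moreover have "t * (1 / 4 - t) \<ge> 0" using t by simp
      ultimately show ?thesis by simp
    qed
    also have "\<dots> \<le> (\<Prod>i=1..v. 1 - 1 / (2::real) ^ i) * (1 - t)"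
      using step.IH t by (intro mult_right_mono) (auto simp: t_def)
    finally show ?case by (simp add: t_def)
  qed simp
  have "1 / 4 \<le> (\<Prod>i=1..v. 1 - 1 / (2::real) ^ i)"
  proof (cases "v \<ge> 1")
    case True
    have "(0::real) < 1 / 2 ^ Suc v" by simp
    then show ?thesis using two[OF True] by linarith
  qed simp
  also have "\<dots> \<le> (\<Prod>i=1..v. 1 - 1 / real l ^ i)"
  proof (rule prod_mono, intro conjI)
    fix i assume "i \<in> {1..v}"
    have "(2::real) ^ i \<le> real l ^ i" using assms by (intro power_mono) auto
    then show "1 - 1 / (2::real) ^ i \<le> 1 - 1 / real l ^ i" using assms by (simp add: frac_le)
    show "0 \<le> 1 - 1 / (2::real) ^ i" by simp
  qed
  finally show ?thesis .
qed

context
  fixes l :: nat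
  assumes l2: "l \<ge> 2"
begin

lemma L2: "real l \<ge> 2" using l2 by simp

lemma weight_pos: "weight l v > 0"
  using pochhammer_lower[OF l2, of v] L2 by (simp add: weight_def)

lemma weight_le: "weight l v \<le> 4 / real l ^ tri (v - 1)"
proof -
  have "weight l v = (1 / real l ^ tri (v - 1)) * (1 / (\<Prod>i=1..v. 1 - 1 / real l ^ i))"
    unfolding weight_def tri_pred by simp
  also have "\<dots> \<le> (1 / real l ^ tri (v - 1)) * 4"
    using pochhammer_lower[OF l2, of v] L2 by (intro mult_left_mono) (auto simp: field_simps)
  finally show ?thesis by simp
qed

lemma weight_0: "weight l 0 = 1"
  by (simp add: weight_def)

lemma weight_Suc: "weight l (Suc v) * (1 - 1 / real l ^ Suc v) = weight l v / real l ^ v"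
proof -
  have "tri v = tri (v - 1) + v"
  proof (cases v)
    case 0
    then show ?thesis by (simp add: tri_def)
  qed (simp add: tri_Suc)
  moreover have "1 - 1 / real l ^ Suc v \<noteq> 0"
  proof -
    have "1 < real l ^ Suc v" using L2 by (intro one_less_power) auto
    then show ?thesis by simp
  qed
  moreover define c where "c = 1 - 1 / real l ^ Suc v"
  moreover define P where "P = (\<Prod>i=1..v. 1 - 1 / real l ^ i)"
  moreover have "(\<Prod>i=1..Suc v. 1 - 1 / real l ^ i) = P * c"
    unfolding c_def P_def by (simp add: mult.commute)
  ultimately have "c \<noteq> 0" "weight l (Suc v) = 1 / (real l ^ (tri (v - 1) + v) * (P * c))"
    "weight l v = 1 / (real l ^ tri (v - 1) * P)"
    unfolding weight_def tri_pred by simp_all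
  then show ?thesis unfolding c_def[symmetric] by (simp add: power_add)
qed

text \<open>The product cancels factors of the denominator of \<open>weight\<close> and leaves a
  shift by \<open>m\<close>. The \<open>m\<close>-th moment of the weights is then
  \<open>l ^ tri m\<close> times their total, which after normalisation is the value in
  \<open>cls_moment\<close>.\<close>

lemma weight_moment:
  "weight l (m + u) * (\<Prod>i<m. real l ^ (m + u) - real l ^ i) = real l ^ tri m * weight l u"
proof (induction m)
  case (Suc m)
  let ?N = "m + u"
  have L0: "real l \<noteq> 0" using L2 by simp
  have "(\<Prod>i<Suc m. real l ^ Suc ?N - real l ^ i) = (real l ^ Suc ?N - 1) * (\<Prod>i<m. real l ^ Suc ?N - real l ^ Suc i)"
    by (simp only: prod.lessThan_Suc_shift power_0)
  also have "(\<Prod>i<m. real l ^ Suc ?N - real l ^ Suc i) = (\<Prod>i<m. real l * (real l ^ ?N - real l ^ i))"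
    by (simp add: algebra_simps)
  also have "\<dots> = real l ^ m * (\<Prod>i<m. real l ^ ?N - real l ^ i)"
    by (simp add: prod.distrib)
  finally have pr: "(\<Prod>i<Suc m. real l ^ Suc ?N - real l ^ i) = (real l ^ Suc ?N - 1) * (real l ^ m * (\<Prod>i<m. real l ^ ?N - real l ^ i))" .
  have "weight l (Suc ?N) * (real l ^ Suc ?N - 1) = real l ^ Suc ?N * (weight l (Suc ?N) * (1 - 1 / real l ^ Suc ?N))"
    using L0 by (simp add: field_simps)
  also have "\<dots> = real l * weight l ?N" unfolding weight_Suc using L0 by simp
  finally have w: "weight l (Suc ?N) * (real l ^ Suc ?N - 1) = real l * weight l ?N" .
  have "weight l (Suc m + u) * (\<Prod>i<Suc m. real l ^ (Suc m + u) - real l ^ i)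
      = (weight l (Suc ?N) * (real l ^ Suc ?N - 1)) * (real l ^ m * (\<Prod>i<m. real l ^ ?N - real l ^ i))"
    unfolding add_Suc pr by (simp only: mult.assoc)
  also have "\<dots> = real l ^ Suc m * (weight l ?N * (\<Prod>i<m. real l ^ ?N - real l ^ i))" unfolding w by simp
  also have "\<dots> = real l ^ tri (Suc m) * weight l u" unfolding Suc.IH by (simp add: tri_Suc power_add)
  finally show ?case .
qed (simp add: tri_def)

lemma summable_weight: "summable (weight l)"
proof (rule summable_comparison_test')
  show "summable (\<lambda>v. 8 * (1 / 2 :: real) ^ v)" by (intro summable_mult summable_geometric) simp
  fix v :: nat
  have "v - 1 \<le> tri (v - 1)" by (cases "v - 1") (simp_all add: tri_Suc)
  then have "real l ^ (v - 1) \<le> real l ^ tri (v - 1)" using L2 by (intro power_increasing) auto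
  moreover have "2 ^ (v - 1) \<le> real l ^ (v - 1)" using L2 by (intro power_mono) auto
  ultimately have "2 ^ (v - 1) \<le> real l ^ tri (v - 1)" by linarith
  then have "4 / real l ^ tri (v - 1) \<le> 4 / 2 ^ (v - 1)" by (intro frac_le) auto
  also have "\<dots> \<le> 8 * (1 / 2) ^ v" by (cases v) (auto simp: power_divide)
  finally show "norm (weight l v) \<le> 8 * (1 / 2) ^ v" using weight_le[of v] weight_pos[of v] by simp
qed

definition weight_total :: real where "weight_total = suminf (weight l)"

lemma weight_sums: "weight l sums weight_total"
  using summable_weight unfolding weight_total_def by (rule summable_sums)

lemma weight_total_ge_1: "weight_total \<ge> 1"
  using sum_le_suminf[OF summable_weight, of "{0}"] weight_pos weight_0 by (simp add: weight_total_def less_imp_le)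

text \<open>Generating function of the weights; Euler's identity evaluates it as the product of
  \<open>1 + z / real l ^ j\<close> over all \<open>j\<close>.\<close>

definition euler :: "real \<Rightarrow> real" where "euler z = (\<Sum>u. weight l u * z ^ u)"

lemma summable_euler: assumes "0 \<le> z" "z \<le> 1" shows "summable (\<lambda>u. weight l u * z ^ u)"
proof (rule summable_comparison_test'[OF summable_weight])
  fix u
  have "weight l u * z ^ u \<le> weight l u * 1" using assms weight_pos[of u] by (intro mult_left_mono power_le_one) auto
  then show "norm (weight l u * z ^ u) \<le> weight l u" using assms weight_pos[of u] by simp
qed

text \<open>By the recursion \<open>weight_Suc\<close>, the series of
  \<open>euler z - euler (z / real l)\<close> is, after an index shift, \<open>z\<close> times that
  of \<open>euler (z / real l)\<close>. Iteration peels off the factors of Euler's product.\<close>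

lemma euler_step: assumes "0 \<le> z" "z \<le> 1" shows "euler z = (1 + z) * euler (z / real l)"
proof -
  have zL: "0 \<le> z / real l" "z / real l \<le> 1" using assms L2 by (auto simp: field_simps)
  have s: "summable (\<lambda>u. weight l u * z ^ u)" "summable (\<lambda>u. weight l u * (z / real l) ^ u)"
    using summable_euler assms zL by auto
  have L0: "real l \<noteq> 0" using L2 by simp
  have "euler z - euler (z / real l) = (\<Sum>u. weight l u * z ^ u - weight l u * (z / real l) ^ u)"
    unfolding euler_def by (rule suminf_diff[OF s])
  also have "\<dots> = (\<Sum>u. weight l (Suc u) * z ^ Suc u - weight l (Suc u) * (z / real l) ^ Suc u)"
    using suminf_split_head[OF summable_diff[OF s]] by simp
  also have "\<dots> = (\<Sum>u. z * (weight l u * (z / real l) ^ u))"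
  proof (rule suminf_cong)
    fix u
    have "weight l (Suc u) * z ^ Suc u - weight l (Suc u) * (z / real l) ^ Suc u
       = (weight l (Suc u) * (1 - 1 / real l ^ Suc u)) * z ^ Suc u"
      by (simp add: power_divide algebra_simps)
    also have "\<dots> = z * (weight l u * (z / real l) ^ u)" unfolding weight_Suc by (simp add: power_divide)
    finally show "weight l (Suc u) * z ^ Suc u - weight l (Suc u) * (z / real l) ^ Suc u = z * (weight l u * (z / real l) ^ u)" .
  qed
  also have "\<dots> = z * euler (z / real l)" unfolding euler_def using s by (intro suminf_mult) auto
  finally show ?thesis by (simp add: algebra_simps)
qed

text \<open>Squeezes \<open>euler\<close> to 1 near 0, so that the remainder in
  \<open>euler_product\<close> disappears in the limit.\<close>

lemma euler_bounds: assumes "0 \<le> z" "z \<le> 1" shows "1 \<le> euler z" "euler z \<le> 1 + z * weight_total"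
proof -
  have s: "summable (\<lambda>u. weight l (Suc u) * z ^ Suc u)"
    using summable_euler[OF assms] by (subst summable_Suc_iff)
  have sw: "summable (\<lambda>u. weight l (Suc u))" using summable_weight by (subst summable_Suc_iff)
  have eq: "euler z = 1 + (\<Sum>u. weight l (Suc u) * z ^ Suc u)"
    unfolding euler_def using suminf_split_head[OF summable_euler[OF assms]] by (simp add: weight_0)
  have "0 \<le> (\<Sum>u. weight l (Suc u) * z ^ Suc u)"
    using assms weight_pos by (intro suminf_nonneg[OF s]) (simp add: less_imp_le)
  then show "1 \<le> euler z" using eq by simp
  have "(\<Sum>u. weight l (Suc u) * z ^ Suc u) \<le> (\<Sum>u. z * weight l (Suc u))"
  proof (rule suminf_le[OF _ s summable_mult[OF sw]])
    fix u
    have "weight l (Suc u) * z ^ u \<le> weight l (Suc u) * 1"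
      using assms weight_pos[of "Suc u"] by (intro mult_left_mono power_le_one) auto
    from mult_left_mono[OF this assms(1)]
    have "z * (weight l (Suc u) * z ^ u) \<le> z * (weight l (Suc u) * 1)" .
    then show "weight l (Suc u) * z ^ Suc u \<le> z * weight l (Suc u)" by (simp add: mult_ac)
  qed
  also have "\<dots> = z * (\<Sum>u. weight l (Suc u))" by (rule suminf_mult[OF sw])
  also have "\<dots> \<le> z * weight_total"
    using assms suminf_split_head[OF summable_weight] by (intro mult_left_mono) (auto simp: weight_total_def weight_0)
  finally show "euler z \<le> 1 + z * weight_total" using eq by simp
qed

lemma euler_product: "weight_total = (\<Prod>j<J. 1 + 1 / real l ^ j) * euler (1 / real l ^ J)"
proof (induction J)
  case 0
  show ?case by (simp add: weight_total_def euler_def)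
next
  case (Suc J)
  have "1 / real l ^ J \<le> 1" using L2 by simp
  then have "euler (1 / real l ^ J) = (1 + 1 / real l ^ J) * euler (1 / real l ^ Suc J)"
    using euler_step[of "1 / real l ^ J"] by (simp add: mult.commute)
  then show ?case using Suc.IH by simp
qed

text \<open>Euler's product at \<open>z = 1\<close> is the total weight, so the infinite product in
  \<open>P_infty\<close> is exactly the normalising factor.\<close>

lemma P_infty_eq: "P_infty l v = weight l v / weight_total"
proof -
  have lim0: "(\<lambda>J. 1 / real l ^ J) \<longlonglongrightarrow> 0"
  proof -
    have "(\<lambda>J. (1 / real l) ^ J) \<longlonglongrightarrow> 0" using L2 by (intro LIMSEQ_power_zero) simp
    then show ?thesis by (simp add: power_divide)
  qed
  have "(\<lambda>J. euler (1 / real l ^ J)) \<longlonglongrightarrow> 1"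
  proof (rule tendsto_sandwich)
    show "\<forall>\<^sub>F J in sequentially. 1 \<le> euler (1 / real l ^ J)"
      using L2 by (intro always_eventually allI euler_bounds) auto
    show "\<forall>\<^sub>F J in sequentially. euler (1 / real l ^ J) \<le> 1 + 1 / real l ^ J * weight_total"
      using L2 by (intro always_eventually allI euler_bounds) auto
    show "(\<lambda>J. 1 + 1 / real l ^ J * weight_total) \<longlonglongrightarrow> 1"
      using tendsto_add[OF tendsto_const[of 1] tendsto_mult[OF lim0 tendsto_const[of weight_total]]] by simp
  qed simp
  then have "(\<lambda>J. euler (1 / real l ^ J) / weight_total) \<longlonglongrightarrow> 1 / weight_total"
    using weight_total_ge_1 by (intro tendsto_divide tendsto_const) auto
  moreover have "euler (1 / real l ^ J) / weight_total = (\<Prod>j<J. inverse (1 + 1 / real l ^ j))" for J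
  proof -
    have pos: "(\<Prod>j<J. 1 + 1 / real l ^ j) > 0" using L2 by (intro prod_pos) (auto intro!: add_pos_nonneg)
    have "1 / real l ^ J \<le> 1" using L2 by simp
    then have "euler (1 / real l ^ J) \<ge> 1" by (intro euler_bounds) auto
    then have "euler (1 / real l ^ J) / ((\<Prod>j<J. 1 + 1 / real l ^ j) * euler (1 / real l ^ J)) = inverse (\<Prod>j<J. 1 + 1 / real l ^ j)"
      by (simp add: inverse_eq_divide)
    then have "euler (1 / real l ^ J) / weight_total = inverse (\<Prod>j<J. 1 + 1 / real l ^ j)"
      unfolding euler_product[of J, symmetric] .
    then show ?thesis using prod_inversef[of "\<lambda>j. 1 + 1 / real l ^ j" "{..<J}"] by (simp add: o_def)
  qed
  ultimately have "(\<lambda>J. \<Prod>j<J. inverse (1 + 1 / real l ^ j)) \<longlonglongrightarrow> 1 / weight_total" by simp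
  then have "prodinf (\<lambda>j. inverse (1 + 1 / real l ^ j)) = 1 / weight_total"
    using weight_total_ge_1 by (intro prodinf_eq_prod_lim') auto
  moreover have "v\<^sup>2 - v = v * (v - 1)" by (simp add: power2_eq_square diff_mult_distrib2)
  ultimately show ?thesis by (simp add: P_infty_def weight_def)
qed

text \<open>Euler's product has the factor \<open>1 + z\<close>, which vanishes at -1. The proof
  uses a closed form of the partial sums, which telescope by \<open>weight_Suc\<close>.\<close>

lemma alternating_weight_sums: "(\<lambda>u. (- 1) ^ u * weight l u) sums 0"
proof -
  have L0: "real l \<noteq> 0" using L2 by simp
  have part: "(\<Sum>u<Suc U. (- 1) ^ u * weight l u) = (- 1) ^ U * (weight l U / real l ^ U)" for U
  proof (induction U)
    case (Suc U)
    have "weight l U / real l ^ U = weight l (Suc U) * (1 - 1 / real l ^ Suc U)" by (rule weight_Suc[symmetric])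
    then have eq: "weight l U / real l ^ U = weight l (Suc U) - weight l (Suc U) / real l ^ Suc U"
      by (simp add: right_diff_distrib)
    have "(\<Sum>u<Suc (Suc U). (- 1) ^ u * weight l u) = (- 1) ^ U * (weight l U / real l ^ U) + (- 1) ^ Suc U * weight l (Suc U)"
      by (simp only: sum.lessThan_Suc[of _ "Suc U"] Suc.IH)
    also have "\<dots> = (- 1) ^ Suc U * (weight l (Suc U) / real l ^ Suc U)"
      unfolding eq by (simp add: right_diff_distrib)
    finally show ?case .
  qed (simp add: weight_0)
  have "(\<lambda>U. weight l U / real l ^ U) \<longlonglongrightarrow> 0"
  proof (rule tendsto_sandwich[OF _ _ tendsto_const summable_LIMSEQ_zero[OF summable_weight]])
    show "\<forall>\<^sub>F U in sequentially. 0 \<le> weight l U / real l ^ U" using weight_pos L2 by (simp add: less_imp_le)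
    have "weight l U / real l ^ U \<le> weight l U" for U
    proof -
      have "1 \<le> real l ^ U" using L2 by simp
      then have "weight l U / real l ^ U \<le> weight l U / 1" using weight_pos[of U] L2 by (intro divide_left_mono) auto
      then show ?thesis by simp
    qed
    then show "\<forall>\<^sub>F U in sequentially. weight l U / real l ^ U \<le> weight l U" by simp
  qed
  moreover have "norm ((- 1) ^ U * (weight l U / real l ^ U)) = weight l U / real l ^ U" for U
    using weight_pos[of U] by (simp add: abs_mult power_abs)
  ultimately have "(\<lambda>U. norm ((- 1) ^ U * (weight l U / real l ^ U))) \<longlonglongrightarrow> 0" by (simp only:)
  then have "(\<lambda>U. (- 1) ^ U * (weight l U / real l ^ U)) \<longlonglongrightarrow> 0" by (rule tendsto_norm_zero_cancel)
  then have "(\<lambda>U. \<Sum>u<Suc U. (- 1) ^ u * weight l u) \<longlonglongrightarrow> 0" unfolding part .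
  then show ?thesis unfolding sums_def by (rule LIMSEQ_imp_Suc)
qed

text \<open>The alternating moments vanish too, since \<open>weight_moment\<close> turns them into a
  shifted alternating sum. Half the sum and half the difference of the plain and the alternating
  series isolate the two parities.\<close>

lemma parity_moment_sums:
  assumes "\<pi> < 2"
  shows "(\<lambda>k. weight l (2 * k + \<pi>) * (\<Prod>i<m. real l ^ (2 * k + \<pi>) - real l ^ i)) sums (real l ^ tri m * weight_total / 2)"
proof -
  define c where "c = (\<lambda>v. weight l v * (\<Prod>i<m. real l ^ v - real l ^ i))"
  have c0: "c v = 0" if "v < m" for v using that by (auto simp: c_def intro!: prod_zero)
  have cm: "c (u + m) = real l ^ tri m * weight l u" for u
    using weight_moment[of m u] by (simp add: c_def add.commute)
  have "(\<lambda>u. c (u + m)) sums (real l ^ tri m * weight_total)" unfolding cm by (intro sums_mult weight_sums)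
  then have 1: "c sums (real l ^ tri m * weight_total)" using c0 by (subst (asm) sums_iff_shift) simp
  have "(\<lambda>u. (- 1) ^ (u + m) * c (u + m)) sums ((- 1) ^ m * real l ^ tri m * 0)"
  proof -
    have "(\<lambda>u. (- 1) ^ m * real l ^ tri m * ((- 1) ^ u * weight l u)) sums ((- 1) ^ m * real l ^ tri m * 0)"
      by (intro sums_mult alternating_weight_sums)
    then show ?thesis unfolding cm power_add by (simp add: mult_ac)
  qed
  then have 2: "(\<lambda>v. (- 1) ^ v * c v) sums 0" using c0 by (subst (asm) sums_iff_shift) simp
  have 3: "(\<lambda>v. (c v + (- 1) ^ \<pi> * ((- 1) ^ v * c v)) / 2) sums ((real l ^ tri m * weight_total + (- 1) ^ \<pi> * 0) / 2)"
    by (intro sums_divide sums_add sums_mult 1 2)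
  \<comment> \<open>In each pair of neighbouring indices only the one of parity \<open>\<pi>\<close>
    survives.\<close>
  have "(\<lambda>k. \<Sum>v\<in>{k * 2..<k * 2 + 2}. (c v + (- 1) ^ \<pi> * ((- 1) ^ v * c v)) / 2) sums (real l ^ tri m * weight_total / 2)"
    using sums_group[OF 3, of 2] by simp
  moreover have "(\<Sum>v\<in>{k * 2..<k * 2 + 2}. (c v + (- 1) ^ \<pi> * ((- 1) ^ v * c v)) / 2) = c (2 * k + \<pi>)" for k
  proof -
    have "{k * 2..<k * 2 + 2} = {2 * k, 2 * k + 1}" by auto
    moreover have "\<pi> = 0 \<or> \<pi> = 1" using assms by auto
    ultimately show ?thesis by (auto simp: power_mult)
  qed
  ultimately show ?thesis by (simp add: c_def)
qed

end

section \<open>Comparison by interpolation\<close>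

text \<open>Writing \<open>X k - a j\<close> as \<open>(X k - b m) + (b m - a j)\<close> exchanges
  the nodes \<open>b\<close> for arbitrary nodes \<open>a\<close> one at a time, while the degree
  stays below \<open>n\<close>.\<close>

lemma annihilated_products:
  fixes \<delta> :: "nat \<Rightarrow> real" and X :: "nat \<Rightarrow> real" and b :: "nat \<Rightarrow> real"
  assumes "\<And>m. m < n \<Longrightarrow> (\<lambda>k. \<delta> k * (\<Prod>i<m. X k - b i)) sums 0"
    and "finite I" "card I < n"
  shows "(\<lambda>k. \<delta> k * (\<Prod>i\<in>I. X k - a i)) sums 0"
proof -
  have "(\<lambda>k. \<delta> k * ((\<Prod>i<m. X k - b i) * (\<Prod>i\<in>I. X k - a i))) sums 0" if "m + card I < n" for m
    using \<open>finite I\<close> that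
  proof (induction I arbitrary: m rule: finite_induct)
    case empty
    then show ?case using assms(1)[of m] by simp
  next
    case (insert j I)
    have 1: "(\<lambda>k. \<delta> k * ((\<Prod>i<Suc m. X k - b i) * (\<Prod>i\<in>I. X k - a i))) sums 0"
      by (rule insert.IH) (use insert in simp)
    have 2: "(\<lambda>k. (b m - a j) * (\<delta> k * ((\<Prod>i<m. X k - b i) * (\<Prod>i\<in>I. X k - a i)))) sums ((b m - a j) * 0)"
      by (rule sums_mult, rule insert.IH) (use insert in simp)
    have "(\<lambda>k. \<delta> k * ((\<Prod>i<Suc m. X k - b i) * (\<Prod>i\<in>I. X k - a i))
        + (b m - a j) * (\<delta> k * ((\<Prod>i<m. X k - b i) * (\<Prod>i\<in>I. X k - a i)))) sums (0 + (b m - a j) * 0)"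
      by (rule sums_add[OF 1 2])
    moreover have "\<delta> k * ((\<Prod>i<Suc m. X k - b i) * (\<Prod>i\<in>I. X k - a i))
        + (b m - a j) * (\<delta> k * ((\<Prod>i<m. X k - b i) * (\<Prod>i\<in>I. X k - a i)))
        = \<delta> k * ((\<Prod>i<m. X k - b i) * (\<Prod>i\<in>insert j I. X k - a i))" for k
      using insert.hyps by (simp add: algebra_simps)
    ultimately show ?case by simp
  qed
  from this[of 0] show ?thesis using assms(3) by simp
qed

text \<open>Order of the Lagrange denominator: the difference of the nodes \<open>k\<close> and
  \<open>i\<close> has the size of the larger one, with exponent about twice
  \<open>max k i\<close>.\<close>

lemma sum_max_nodes:
  fixes k n :: nat
  assumes "k < n"
  shows "(\<Sum>i\<in>{..<n} - {k}. 2 * int (max k i)) = int n * (int n - 1) + int k * int k - int k"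
  using assms
proof (induction n rule: less_induct)
  case (less n)
  show ?case
  proof (cases "n = Suc k")
    case True
    have "{..<Suc k} - {k} = {..<k}" by auto
    then show ?thesis unfolding True by (simp add: algebra_simps)
  next
    case False
    then obtain m where n: "n = Suc m" and m: "k < m" using less.prems by (cases n) auto
    have "{..<Suc m} - {k} = insert m ({..<m} - {k})" using m by auto
    then have "(\<Sum>i\<in>{..<n} - {k}. 2 * int (max k i)) = 2 * int m + (\<Sum>i\<in>{..<m} - {k}. 2 * int (max k i))"
      unfolding n using m by simp
    also have "\<dots> = 2 * int m + (int m * (int m - 1) + int k * int k - int k)"
      using less.IH[of m] n m by simp
    finally show ?thesis unfolding n by (simp add: algebra_simps)
  qed
qed

text \<open>Compares the decay \<open>j * (2 * j - 1)\<close> of the tail at \<open>j\<close> with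
  the growth of the Lagrange coefficient of \<open>k\<close>. The surplus contains
  \<open>n\<^sup>2\<close>, the final rate, and also \<open>j - n\<close> and \<open>k - 1\<close>,
  which make the bounds summable over \<open>j\<close> and \<open>k\<close>.\<close>

lemma node_exponent:
  fixes k n j :: nat
  assumes "k < n" "n \<le> j"
  shows "n\<^sup>2 + (j - n) + (k - 1) + (\<Sum>i\<in>{..<n} - {k}. 2 * (j - max k i)) \<le> j * (2 * j - 1)"
proof -
  have "int (\<Sum>i\<in>{..<n} - {k}. 2 * (j - max k i)) = (\<Sum>i\<in>{..<n} - {k}. 2 * int j - 2 * int (max k i))"
    unfolding of_nat_sum using assms by (intro sum.cong) (auto simp: of_nat_diff)
  also have "\<dots> = 2 * int j * (int n - 1) - (int n * (int n - 1) + int k * int k - int k)"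
    using assms sum_max_nodes[OF assms(1)] by (simp add: sum_subtractf of_nat_diff algebra_simps)
  finally have s: "int (\<Sum>i\<in>{..<n} - {k}. 2 * (j - max k i))
      = 2 * int j * (int n - 1) - (int n * (int n - 1) + int k * int k - int k)" .
  define i where "i = j - n"
  have j: "int j = int n + int i" using assms by (simp add: i_def of_nat_diff)
  have jj: "int (j * (2 * j - 1)) = int j * (2 * int j - 1)"
    using assms by (simp add: of_nat_diff)
  have k: "int (k - 1) \<le> int k * int k - int k"
  proof (cases k)
    case (Suc k')
    then show ?thesis by (simp add: algebra_simps)
  qed simp
  have "0 \<le> 2 * (int n * int i) + 2 * (int i * int i)" by simp
  then have "int (n\<^sup>2 + (j - n) + (k - 1) + (\<Sum>i\<in>{..<n} - {k}. 2 * (j - max k i))) \<le> int (j * (2 * j - 1))"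
  proof -
    have "int j * (2 * int j - 1) - ((int n)\<^sup>2 + int i
        + (2 * int j * (int n - 1) - (int n * (int n - 1) + int k * int k - int k)))
      = 2 * (int n * int i) + 2 * (int i * int i) + (int k * int k - int k)"
      unfolding j by (simp add: power2_eq_square algebra_simps)
    then show ?thesis unfolding of_nat_add s jj i_def[symmetric] of_nat_power
      using k \<open>0 \<le> 2 * (int n * int i) + 2 * (int i * int i)\<close> by linarith
  qed
  then show ?thesis by (simp only: of_nat_le_iff)
qed

text \<open>Strengthened for the induction by a term that shrinks with \<open>N\<close>. The base 4
  arises because consecutive nodes differ by the factor \<open>L\<^sup>2\<close>, which is at least
  4.\<close>

lemma one_minus_quarter_prod:
  "(\<Prod>r=1..N. 1 - 1 / (4::real) ^ r) \<ge> 2 / 3"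
proof -
  have "(\<Prod>r=1..N. 1 - 1 / (4::real) ^ r) \<ge> 2 / 3 + 1 / 4 ^ N / 3"
  proof (induction N)
    case (Suc N)
    define t where "t = 1 / (4::real) ^ N"
    have t: "0 \<le> t" "t \<le> 1" by (simp_all add: t_def)
    have "(2 / 3 + t / 3) * (1 - t / 4) - (2 / 3 + t / 4 / 3) = t * (1 - t) / 12"
      by (simp add: field_simps)
    moreover have "t * (1 - t) / 12 \<ge> 0" using t by simp
    ultimately have "2 / 3 + t / 4 / 3 \<le> (2 / 3 + t / 3) * (1 - t / 4)" by linarith
    also have "\<dots> \<le> (\<Prod>r=1..N. 1 - 1 / (4::real) ^ r) * (1 - t / 4)"
    proof (rule mult_right_mono)
      show "0 \<le> 1 - t / 4" using t by simp
    qed (use Suc in \<open>simp add: t_def\<close>)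
    finally show ?case by (simp add: t_def mult.commute)
  qed simp
  moreover have "0 \<le> 1 / (4::real) ^ N / 3" by simp
  ultimately show ?thesis by linarith
qed

lemma prod_distance_ge:
  fixes k n :: nat
  assumes "k < n"
  shows "(\<Prod>i\<in>{..<n} - {k}. 1 - 1 / (4::real) ^ (max k i - min k i)) \<ge> 4 / 9"
proof -
  have un: "{..<n} - {k} = {..<k} \<union> {k<..<n}" using assms by auto
  have "(\<Prod>i\<in>{..<n} - {k}. 1 - 1 / (4::real) ^ (max k i - min k i))
     = (\<Prod>i<k. 1 - 1 / (4::real) ^ (max k i - min k i)) * (\<Prod>i\<in>{k<..<n}. 1 - 1 / (4::real) ^ (max k i - min k i))"
    unfolding un by (rule prod.union_disjoint) auto
  also have "(\<Prod>i<k. 1 - 1 / (4::real) ^ (max k i - min k i)) = (\<Prod>r=1..k. 1 - 1 / (4::real) ^ r)"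
    by (rule prod.reindex_bij_witness[of _ "\<lambda>r. k - r" "\<lambda>i. k - i"]) (auto simp: max_def min_def)
  also have "(\<Prod>i\<in>{k<..<n}. 1 - 1 / (4::real) ^ (max k i - min k i)) = (\<Prod>r=1..n - Suc k. 1 - 1 / (4::real) ^ r)"
    by (rule prod.reindex_bij_witness[of _ "\<lambda>r. k + r" "\<lambda>i. i - k"]) (auto simp: max_def min_def)
  finally have eq: "(\<Prod>i\<in>{..<n} - {k}. 1 - 1 / (4::real) ^ (max k i - min k i))
     = (\<Prod>r=1..k. 1 - 1 / (4::real) ^ r) * (\<Prod>r=1..n - Suc k. 1 - 1 / (4::real) ^ r)" .
  have "2 / 3 * (2 / 3) \<le> (\<Prod>r=1..k. 1 - 1 / (4::real) ^ r) * (\<Prod>r=1..n - Suc k. 1 - 1 / (4::real) ^ r)"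
    using one_minus_quarter_prod[of k] one_minus_quarter_prod[of "n - Suc k"] by (intro mult_mono) auto
  then show ?thesis unfolding eq by simp
qed

text \<open>Each numerator factor is at most \<open>X j\<close>; each denominator factor is at least
  \<open>X (max k i)\<close> up to a factor close to 1. The constant 9/4 is the inverse of the bound
  in \<open>prod_distance_ge\<close>, itself 2/3 for the nodes on either side of
  \<open>k\<close>.\<close>

lemma lagrange_ratio:
  fixes L :: real and k n j \<pi> :: nat
  assumes L: "L \<ge> 2" and k: "k < n" "n \<le> j"
  defines "X \<equiv> \<lambda>i. L ^ (2 * i + \<pi>)"
  shows "\<bar>\<Prod>i\<in>{..<n} - {k}. X j - X i\<bar> \<le> 9 / 4 * L ^ (\<Sum>i\<in>{..<n} - {k}. 2 * (j - max k i)) * \<bar>\<Prod>i\<in>{..<n} - {k}. X k - X i\<bar>"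
    and "(\<Prod>i\<in>{..<n} - {k}. X k - X i) \<noteq> 0"
proof -
  let ?I = "{..<n} - {k}"
  have Xpos: "X i > 0" for i using L by (simp add: X_def)
  have Xmono: "X i \<le> X i'" if "i \<le> i'" for i i' using L that by (auto simp: X_def intro!: power_increasing)
  have num: "\<bar>\<Prod>i\<in>?I. X j - X i\<bar> \<le> (\<Prod>i\<in>?I. X j)"
    unfolding abs_prod
  proof (rule prod_mono, intro conjI)
    fix i assume "i \<in> ?I"
    then have "X i \<le> X j" using k by (intro Xmono) auto
    then show "\<bar>X j - X i\<bar> \<le> X j" using Xpos[of i] by simp
  qed simp
  have split: "X j = L ^ (2 * (j - max k i)) * X (max k i)" if "i \<in> ?I" for i
  proof -
    have "2 * j + \<pi> = 2 * (j - max k i) + (2 * max k i + \<pi>)" using that k by auto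
    then show ?thesis unfolding X_def by (metis power_add)
  qed
  have dist: "\<bar>X k - X i\<bar> \<ge> X (max k i) * (1 - 1 / 4 ^ (max k i - min k i))" for i
  proof -
    let ?a = "max k i" and ?b = "min k i"
    have "\<bar>X k - X i\<bar> = X ?a - X ?b" using Xmono[of ?b ?a] by (auto simp: max_def min_def)
    moreover have "X ?b \<le> X ?a / 4 ^ (?a - ?b)"
    proof -
      have "2 * ?a + \<pi> = 2 * (?a - ?b) + (2 * ?b + \<pi>)" by auto
      then have "X ?a = L ^ (2 * (?a - ?b)) * X ?b" unfolding X_def by (metis power_add)
      moreover have "(4::real) ^ (?a - ?b) \<le> L ^ (2 * (?a - ?b))"
      proof -
        have "(2::real)\<^sup>2 \<le> L\<^sup>2" using L by (intro power_mono) auto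
        then have "(4::real) ^ (?a - ?b) \<le> (L\<^sup>2) ^ (?a - ?b)" by (intro power_mono) auto
        then show ?thesis by (simp add: power_mult)
      qed
      ultimately have "4 ^ (?a - ?b) * X ?b \<le> X ?a" using Xpos[of ?b] by (simp add: mult_right_mono)
      then show ?thesis by (simp add: field_simps)
    qed
    ultimately show ?thesis by (simp add: right_diff_distrib)
  qed
  have den: "4 / 9 * (\<Prod>i\<in>?I. X (max k i)) \<le> \<bar>\<Prod>i\<in>?I. X k - X i\<bar>"
  proof -
    have "4 / 9 * (\<Prod>i\<in>?I. X (max k i)) \<le> (\<Prod>i\<in>?I. 1 - 1 / 4 ^ (max k i - min k i)) * (\<Prod>i\<in>?I. X (max k i))"
      using prod_distance_ge[OF k(1)] Xpos by (intro mult_right_mono prod_nonneg) (auto simp: less_imp_le)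
    also have "\<dots> = (\<Prod>i\<in>?I. X (max k i) * (1 - 1 / 4 ^ (max k i - min k i)))"
      by (simp add: prod.distrib mult.commute)
    also have "\<dots> \<le> (\<Prod>i\<in>?I. \<bar>X k - X i\<bar>)"
      using dist Xpos by (intro prod_mono) (auto simp: less_imp_le)
    finally show ?thesis by (simp add: abs_prod)
  qed
  have pos: "(\<Prod>i\<in>?I. X (max k i)) > 0" using Xpos by (intro prod_pos) auto
  show "(\<Prod>i\<in>?I. X k - X i) \<noteq> 0"
  proof
    assume z: "(\<Prod>i\<in>?I. X k - X i) = 0"
    have "4 / 9 * (\<Prod>i\<in>?I. X (max k i)) \<le> 0" using den unfolding z by simp
    then show False using pos by linarith
  qed
  have "\<bar>\<Prod>i\<in>?I. X j - X i\<bar> \<le> (\<Prod>i\<in>?I. L ^ (2 * (j - max k i)) * X (max k i))"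
    using num split by (metis (no_types, lifting) prod.cong)
  also have "\<dots> = L ^ (\<Sum>i\<in>?I. 2 * (j - max k i)) * (\<Prod>i\<in>?I. X (max k i))"
    by (simp only: prod.distrib power_sum)
  also have "\<dots> \<le> L ^ (\<Sum>i\<in>?I. 2 * (j - max k i)) * (9 / 4 * \<bar>\<Prod>i\<in>?I. X k - X i\<bar>)"
    using den L by (intro mult_left_mono) auto
  finally show "\<bar>\<Prod>i\<in>?I. X j - X i\<bar> \<le> 9 / 4 * L ^ (\<Sum>i\<in>?I. 2 * (j - max k i)) * \<bar>\<Prod>i\<in>?I. X k - X i\<bar>"
    by (simp add: mult_ac)
qed

text \<open>Profile of the deviation at the node \<open>k\<close>. The factor 9/2 is 9/4 from
  \<open>lagrange_ratio\<close> times 2 from the geometric series over the tail.\<close>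

definition tail_bound :: "nat \<Rightarrow> nat \<Rightarrow> real" where
  "tail_bound n k = (if k < n then 9 / 2 * (1 / 2) ^ (k - 1) else (1 / 2) ^ (k - n))"

text \<open>For \<open>k \<ge> n\<close> the tail hypothesis suffices. For \<open>k < n\<close>, the
  polynomial vanishing at all other nodes below \<open>n\<close> has degree \<open>n - 1\<close>, so
  \<open>\<delta>\<close> annihilates it, and the value at \<open>k\<close> is expressed by the tail
  alone.\<close>

lemma deviation_bound:
  fixes L D :: real and n \<pi> :: nat and \<delta> :: "nat \<Rightarrow> real"
  assumes L: "L \<ge> 2" and n: "n > 0" and D: "D \<ge> 0"
    and mom: "\<And>m. m < n \<Longrightarrow> (\<lambda>k. \<delta> k * (\<Prod>i<m. L ^ (2 * k + \<pi>) - L ^ i)) sums 0"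
    and tail: "\<And>j. j \<ge> n \<Longrightarrow> \<bar>\<delta> j\<bar> \<le> D / L ^ (j * (2 * j - 1))"
  shows "\<bar>\<delta> k\<bar> \<le> D / L ^ n\<^sup>2 * tail_bound n k"
proof (cases "k < n")
  case False
  then have k: "n \<le> k" by simp
  have "n\<^sup>2 + (k - n) \<le> k * (2 * k - 1)"
  proof -
    have "int (n\<^sup>2 + (k - n)) \<le> int (k * (2 * k - 1))"
    proof -
      define i where "i = k - n"
      have ki: "k = n + i" using k by (simp add: i_def)
      have "1 \<le> int n" using n by simp
      then have "0 \<le> int n * (int n - 1)" by simp
      moreover have "int i \<le> 2 * int n * int i" using \<open>1 \<le> int n\<close> by (simp add: mult_le_cancel_right1)
      ultimately have "0 \<le> int n * (int n - 1) + 2 * (2 * int n * int i - int i) + 2 * int i * int i"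
        by (intro add_nonneg_nonneg) (auto simp: mult_ac)
      moreover have "(int n + int i) * (2 * (int n + int i) - 1) - ((int n)\<^sup>2 + int i)
        = int n * (int n - 1) + 2 * (2 * int n * int i - int i) + 2 * int i * int i"
        by (simp add: power2_eq_square algebra_simps)
      ultimately have "(int n)\<^sup>2 + int i \<le> (int n + int i) * (2 * (int n + int i) - 1)"
        by (metis diff_ge_0_iff_ge)
      moreover have "int (k * (2 * k - 1)) = (int n + int i) * (2 * (int n + int i) - 1)"
        using n unfolding ki by (simp add: of_nat_diff)
      moreover have "int (n\<^sup>2 + (k - n)) = (int n)\<^sup>2 + int i" by (simp add: i_def)
      ultimately show ?thesis by (simp only:)
    qed
    then show ?thesis by (simp only: of_nat_le_iff)
  qed
  then have "L ^ (n\<^sup>2 + (k - n)) \<le> L ^ (k * (2 * k - 1))" using L by (intro power_increasing) auto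
  moreover have "L ^ n\<^sup>2 * 2 ^ (k - n) \<le> L ^ (n\<^sup>2 + (k - n))"
    unfolding power_add using L by (intro mult_left_mono power_mono) auto
  ultimately have "L ^ n\<^sup>2 * 2 ^ (k - n) \<le> L ^ (k * (2 * k - 1))" by linarith
  then have "D / L ^ (k * (2 * k - 1)) \<le> D / (L ^ n\<^sup>2 * 2 ^ (k - n))"
    using D L by (intro divide_left_mono mult_pos_pos) auto
  then show ?thesis using tail[OF k] False by (simp add: tail_bound_def power_divide)
next
  case True
  let ?I = "{..<n} - {k}"
  let ?X = "\<lambda>i. L ^ (2 * i + \<pi>)"
  define F where "F = (\<lambda>j. \<Prod>i\<in>?I. ?X j - ?X i)"
  have Fk: "F k \<noteq> 0" unfolding F_def using lagrange_ratio(2)[OF L True order_refl] .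
  have "card ?I < n" using True by simp
  then have sums: "(\<lambda>j. \<delta> j * F j) sums 0"
    unfolding F_def using annihilated_products[of n \<delta> ?X "\<lambda>i. L ^ i" ?I ?X] mom by blast
  have F0: "F j = 0" if "j < n" "j \<noteq> k" for j unfolding F_def using that by (intro prod_zero) auto
  have "(\<Sum>j<n. \<delta> j * F j) = \<delta> k * F k"
    using sum.remove[of "{..<n}" k "\<lambda>j. \<delta> j * F j"] True F0 by simp
  then have tail_sums: "(\<lambda>i. \<delta> (i + n) * F (i + n)) sums (- (\<delta> k * F k))"
    using sums by (subst sums_iff_shift) simp
  let ?c = "D / L ^ n\<^sup>2 * (9 / 4) * (1 / 2) ^ (k - 1) * \<bar>F k\<bar>"
  have terms: "\<bar>\<delta> (i + n) * F (i + n)\<bar> \<le> ?c * (1 / 2) ^ i" for i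
  proof -
    let ?j = "i + n" and ?s = "\<Sum>i'\<in>?I. 2 * ((i + n) - max k i')"
    have "\<bar>\<delta> ?j * F ?j\<bar> \<le> (D / L ^ (?j * (2 * ?j - 1))) * (9 / 4 * L ^ ?s * \<bar>F k\<bar>)"
      unfolding abs_mult F_def using lagrange_ratio(1)[OF L True, of ?j \<pi>] tail[of ?j] D L
      by (intro mult_mono) (auto simp: F_def)
    also have "\<dots> = D * (9 / 4) * \<bar>F k\<bar> * (L ^ ?s / L ^ (?j * (2 * ?j - 1)))" by (simp add: mult_ac)
    also have "\<dots> \<le> D * (9 / 4) * \<bar>F k\<bar> * (1 / (L ^ n\<^sup>2 * 2 ^ i * 2 ^ (k - 1)))"
    proof (rule mult_left_mono)
      have "L ^ (n\<^sup>2 + i + (k - 1) + ?s) \<le> L ^ (?j * (2 * ?j - 1))"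
        using node_exponent[OF True, of ?j] L by (intro power_increasing) auto
      moreover have "L ^ n\<^sup>2 * 2 ^ i * 2 ^ (k - 1) * L ^ ?s \<le> L ^ n\<^sup>2 * L ^ i * L ^ (k - 1) * L ^ ?s"
        using L by (intro mult_mono power_mono order_refl mult_nonneg_nonneg) auto
      ultimately have "L ^ n\<^sup>2 * 2 ^ i * 2 ^ (k - 1) * L ^ ?s \<le> L ^ (?j * (2 * ?j - 1))"
        by (simp add: power_add)
      then show "L ^ ?s / L ^ (?j * (2 * ?j - 1)) \<le> 1 / (L ^ n\<^sup>2 * 2 ^ i * 2 ^ (k - 1))"
        using L by (simp add: field_simps)
    qed (use D in simp)
    also have "\<dots> = ?c * (1 / 2) ^ i" by (simp add: power_divide)
    finally show ?thesis .
  qed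
  have geo: "(\<lambda>i. ?c * (1 / 2) ^ i) sums (?c * 2)"
    using geometric_sums[of "1/2::real"] by (intro sums_mult) simp
  have "\<bar>- (\<delta> k * F k)\<bar> \<le> ?c * 2"
  proof -
    have sm: "summable (\<lambda>i. \<bar>\<delta> (i + n) * F (i + n)\<bar>)"
      by (rule summable_comparison_test'[OF sums_summable[OF geo]]) (use terms in auto)
    have "\<bar>\<Sum>i. \<delta> (i + n) * F (i + n)\<bar> \<le> (\<Sum>i. \<bar>\<delta> (i + n) * F (i + n)\<bar>)"
      by (rule summable_rabs[OF sm])
    also have "\<dots> \<le> (\<Sum>i. ?c * (1 / 2) ^ i)" by (rule suminf_le[OF terms sm sums_summable[OF geo]])
    finally show ?thesis using sums_unique[OF tail_sums] sums_unique[OF geo] by simp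
  qed
  then have "\<bar>\<delta> k\<bar> * \<bar>F k\<bar> \<le> (D / L ^ n\<^sup>2 * (9 / 2 * (1 / 2) ^ (k - 1))) * \<bar>F k\<bar>" by (simp add: abs_mult mult_ac)
  then have "\<bar>\<delta> k\<bar> \<le> D / L ^ n\<^sup>2 * (9 / 2 * (1 / 2) ^ (k - 1))"
    by (rule mult_right_le_imp_le) (use Fk in simp)
  then show ?thesis using True by (simp add: tail_bound_def)
qed

lemma tail_bound_nonneg: "tail_bound n k \<ge> 0"
  by (simp add: tail_bound_def)

lemma tail_bound_sums: "summable (tail_bound n)" "suminf (tail_bound n) \<le> 16"
proof -
  have "(\<lambda>k. tail_bound n (k + n)) sums 2"
    using geometric_sums[of "1/2::real"] by (simp add: tail_bound_def)
  then have s: "tail_bound n sums (2 + (\<Sum>k<n. tail_bound n k))" by (simp add: sums_iff_shift)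
  then show "summable (tail_bound n)" by (rule sums_summable)
  have "(\<Sum>k<n. (1 / 2 :: real) ^ (k - 1)) \<le> 3"
  proof -
    have "(\<Sum>k<n. (1 / 2 :: real) ^ (k - 1)) \<le> (\<Sum>k<Suc n. (1 / 2 :: real) ^ (k - 1))" by simp
    also have "\<dots> = 1 + (\<Sum>k<n. (1 / 2) ^ k)" by (subst sum.lessThan_Suc_shift) simp
    also have "(\<Sum>k<n. (1 / 2 :: real) ^ k) \<le> 2"
      using sum_le_suminf[OF summable_geometric[of "1/2::real"], of "{..<n}"] by (simp add: suminf_geometric)
    finally show ?thesis by simp
  qed
  moreover have "(\<Sum>k<n. tail_bound n k) = 9 / 2 * (\<Sum>k<n. (1 / 2) ^ (k - 1))"
    by (simp add: tail_bound_def sum_distrib_left)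
  \<comment> \<open>The total is at most \<open>2 + 9 / 2 * 3 = 31 / 2\<close>, rounded up to
    16.\<close>
  ultimately show "suminf (tail_bound n) \<le> 16" using sums_unique[OF s] by simp
qed

section \<open>Total variation bounds\<close>

text \<open>If \<open>k < m\<close>, both products contain the zero factor \<open>i = k\<close>,
  which absorbs the truncated subtractions.\<close>

lemma real_prod_power_diff:
  assumes "l \<ge> (1::nat)"
  shows "real (\<Prod>i<m. l ^ k - l ^ i) = (\<Prod>i<m. real l ^ k - real l ^ i)"
proof (cases "m \<le> k")
  case True
  have "real (l ^ k - l ^ i) = real l ^ k - real l ^ i" if "i < m" for i
  proof -
    have "l ^ i \<le> l ^ k" using that True assms by (intro power_increasing) auto
    then show ?thesis by (simp add: of_nat_diff)
  qed
  then show ?thesis by (simp add: of_nat_prod)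
next
  case False
  then have "k \<in> {..<m}" by simp
  then have "(\<Prod>i<m. l ^ k - l ^ i) = 0" "(\<Prod>i<m. real l ^ k - real l ^ i) = 0"
    by (auto intro!: prod_zero bexI[of _ k])
  then show ?thesis by (simp only: of_nat_0)
qed

lemma half_eq_iff:
  fixes a k p :: nat
  assumes "even a = even p" "p < 2"
  shows "a div 2 = k \<longleftrightarrow> a = 2 * k + p"
proof -
  have "a mod 2 = p mod 2" using assms(1) by (simp only: mod_2_eq_odd)
  also have "p mod 2 = p" using assms(2) by simp
  finally have "a = 2 * (a div 2) + p" using mult_div_mod_eq[of 2 a] by simp
  then show ?thesis using assms(2) by auto
qed

text \<open>The product is the order of the general linear group; extracting
  \<open>real l ^ N\<close> from each factor leaves the product of
  \<open>pochhammer_lower\<close>.\<close>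

lemma GL_lower:
  assumes "l \<ge> (2::nat)"
  shows "real (\<Prod>i<N. l ^ N - l ^ i) \<ge> real l ^ (N * N) / 4"
proof -
  have L: "real l \<noteq> 0" using assms by simp
  have "real (\<Prod>i<N. l ^ N - l ^ i) = (\<Prod>i<N. real l ^ N - real l ^ i)"
    using assms by (intro real_prod_power_diff) simp
  also have "\<dots> = (\<Prod>i<N. real l ^ N * (1 - 1 / real l ^ (N - i)))"
    using L by (intro prod.cong) (auto simp: right_diff_distrib power_diff)
  also have "\<dots> = real l ^ (N * N) * (\<Prod>i<N. 1 - 1 / real l ^ (N - i))"
    by (simp add: prod.distrib power_mult)
  also have "(\<Prod>i<N. 1 - 1 / real l ^ (N - i)) = (\<Prod>i=1..N. 1 - 1 / real l ^ i)"
    by (rule prod.reindex_bij_witness[of _ "\<lambda>r. N - r" "\<lambda>i. N - i"]) auto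
  finally have eq: "real (\<Prod>i<N. l ^ N - l ^ i) = real l ^ (N * N) * (\<Prod>i=1..N. 1 - 1 / real l ^ i)" .
  have "real l ^ (N * N) * (1 / 4) \<le> real l ^ (N * N) * (\<Prod>i=1..N. 1 - 1 / real l ^ i)"
    using pochhammer_lower[OF assms, of N] by (intro mult_left_mono) auto
  then show ?thesis using eq by simp
qed

context reduction begin

abbreviation "n \<equiv> 6 * d - 2"

text \<open>The exponent is \<open>4 * n\<^sup>2 - n * (2 * n + 1)\<close>, from
  \<open>GL_lower\<close> and \<open>card_Og_lower\<close>. The inverse of the bound has the order
  of \<open>weight l (2 * n)\<close>, so the identity weighs no more than the limit does there, up
  to a constant.\<close>

lemma card_Og_ge: "real (card qs.Og) \<ge> real l ^ (n * (2 * n - 1)) / 4"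
proof -
  have l2: "l \<ge> 2" using l1 by simp
  have npos: "n > 0" using d by simp
  have "real l ^ (2 * n * (2 * n)) / 4 \<le> real (\<Prod>i<2*n. l ^ (2*n) - l ^ i)" by (rule GL_lower[OF l2])
  also have "\<dots> \<le> real (l ^ (n * (2 * n + 1)) * card qs.Og)"
    using qs.card_Og_lower by (simp only: of_nat_le_iff)
  also have "\<dots> = real l ^ (n * (2 * n + 1)) * real (card qs.Og)" by simp
  finally have 1: "real l ^ (2 * n * (2 * n)) / 4 \<le> real l ^ (n * (2 * n + 1)) * real (card qs.Og)" .
  have "2 * m * (2 * m) = m * (2 * m + 1) + m * (2 * m - 1)" if "m > 0" for m :: nat
    using that by (cases m) (simp_all add: algebra_simps)
  from this[OF npos]
  have "real l ^ (2 * n * (2 * n)) = real l ^ (n * (2 * n + 1)) * real l ^ (n * (2 * n - 1))"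
    by (simp only: power_add)
  then have "real l ^ (n * (2 * n + 1)) * (real l ^ (n * (2 * n - 1)) / 4) \<le> real l ^ (n * (2 * n + 1)) * real (card qs.Og)"
    using 1 by simp
  then show ?thesis by (rule mult_left_le_imp_le) (use l1 in simp)
qed

text \<open>Conditioned on a parity the limit is \<open>2 * P_infty\<close>, as each parity carries
  half its mass. The moments below \<open>n\<close> agree by \<open>cls_moment\<close> and
  \<open>parity_moment_sums\<close>, so \<open>deviation_bound\<close> applies with
  \<open>D = 16\<close>.\<close>

lemma class_deviation:
  assumes \<epsilon>: "\<epsilon> \<in> qs.sp_values" and \<pi>: "\<pi> < 2"
  shows "\<bar>real (card {g \<in> qs.cls \<epsilon> (even \<pi>). qs.fdim g = 2 * k + \<pi>}) / real (card (qs.cls \<epsilon> (even \<pi>)))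
      - 2 * P_infty l (2 * k + \<pi>)\<bar> \<le> 16 / real l ^ n\<^sup>2 * tail_bound n k"
proof -
  let ?C = "qs.cls \<epsilon> (even \<pi>)" and ?L = "real l"
  have l2: "l \<ge> 2" using l1 by simp
  have L2: "?L \<ge> 2" using l2 by simp
  have npos: "n > 0" using d by simp
  define c where "c = real (card ?C)"
  define p where "p = (\<lambda>k. real (card {g \<in> ?C. qs.fdim g = 2 * k + \<pi>}) / c)"
  have cO: "2 * real (card qs.sp_values) * c = real (card qs.Og)"
    using arg_cong[OF qs.card_cls[OF \<epsilon> npos, of "even \<pi>"], of real] by (simp add: c_def)
  have Opos: "real (card qs.Og) > 0" using qs.finite_Og qs.Og_id by (auto simp: card_gt_0_iff)
  have cpos: "c > 0" using cO Opos by (metis c_def less_eq_real_def mult_zero_right of_nat_0_le_iff)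
  have c_ge: "c \<ge> ?L ^ (n * (2 * n - 1)) / 16"
  proof -
    \<comment> \<open>At most two spinor signs and two parities give a factor 4, and
      \<open>card_Og_ge\<close> another 4.\<close>
    have "real (card qs.sp_values) \<le> 2" by (simp add: qs.sp_values_def)
    then have "2 * real (card qs.sp_values) * c \<le> 4 * c" using cpos by (intro mult_right_mono) auto
    then show ?thesis using card_Og_ge cO by linarith
  qed
  have fle: "qs.fdim g \<le> 2 * n" if "g \<in> ?C" for g using qs.fdim_le[of g] that by (simp add: qs.cls_def)
  have p0: "p k = 0" if "2 * k + \<pi> > 2 * n" for k
  proof -
    have "qs.fdim g \<noteq> 2 * k + \<pi>" if "g \<in> ?C" for g using fle[OF that] \<open>2 * k + \<pi> > 2 * n\<close> by linarith
    then have "{g \<in> ?C. qs.fdim g = 2 * k + \<pi>} = {}" by blast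
    then show ?thesis unfolding p_def by (simp only: card.empty of_nat_0 div_0)
  qed
  have pmom: "(\<lambda>k. p k * (\<Prod>i<m. ?L ^ (2 * k + \<pi>) - ?L ^ i)) sums (?L ^ tri m)" if m: "m < n" for m
  proof -
    let ?f = "\<lambda>v. \<Prod>i<m. ?L ^ v - ?L ^ i"
    have "(\<lambda>k. p k * ?f (2 * k + \<pi>)) sums (\<Sum>k\<le>n. p k * ?f (2 * k + \<pi>))"
    proof (rule sums_finite)
      fix k assume "k \<notin> {..n}"
      then have "2 * k + \<pi> > 2 * n" by simp
      then show "p k * ?f (2 * k + \<pi>) = 0" by (simp only: p0 mult_zero_left)
    qed simp
    also have "(\<Sum>k\<le>n. p k * ?f (2 * k + \<pi>)) = (\<Sum>k\<le>n. \<Sum>g\<in>{g \<in> ?C. qs.fdim g div 2 = k}. ?f (qs.fdim g)) / c"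
    proof (subst sum_divide_distrib, rule sum.cong)
      fix k
      have eq: "{g \<in> ?C. qs.fdim g div 2 = k} = {g \<in> ?C. qs.fdim g = 2 * k + \<pi>}"
      proof -
        have "qs.fdim g div 2 = k \<longleftrightarrow> qs.fdim g = 2 * k + \<pi>" if "g \<in> ?C" for g
        proof -
          have "even (qs.fdim g) = even \<pi>" using that by (simp add: qs.cls_def)
          then show ?thesis using \<pi> by (rule half_eq_iff)
        qed
        then show ?thesis by blast
      qed
      have "(\<Sum>g\<in>{g \<in> ?C. qs.fdim g = 2 * k + \<pi>}. ?f (qs.fdim g)) = real (card {g \<in> ?C. qs.fdim g = 2 * k + \<pi>}) * ?f (2 * k + \<pi>)"
        by simp
      then show "p k * ?f (2 * k + \<pi>) = (\<Sum>g\<in>{g \<in> ?C. qs.fdim g div 2 = k}. ?f (qs.fdim g)) / c"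
        unfolding eq by (simp add: p_def)
    qed simp
    also have "(\<Sum>k\<le>n. \<Sum>g\<in>{g \<in> ?C. qs.fdim g div 2 = k}. ?f (qs.fdim g)) = (\<Sum>g\<in>?C. ?f (qs.fdim g))"
    proof (rule sum.group[OF qs.finite_cls])
      show "(\<lambda>g. qs.fdim g div 2) ` ?C \<subseteq> {..n}"
      proof (simp only: image_subset_iff atMost_iff, intro ballI)
        fix g assume "g \<in> ?C"
        then have "qs.fdim g div 2 \<le> (2 * n) div 2" using fle[of g] by (intro div_le_mono)
        then show "qs.fdim g div 2 \<le> n" by simp
      qed
    qed simp
    also have "(\<Sum>g\<in>?C. ?f (qs.fdim g)) = real (\<Sum>g\<in>?C. \<Prod>i<m. l ^ qs.fdim g - l ^ i)"
      unfolding of_nat_sum by (rule sum.cong[OF HOL.refl], rule real_prod_power_diff[symmetric]) (use l2 in simp)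
    also have "\<dots> = ?L ^ tri m * c"
      unfolding qs.cls_moment[OF \<epsilon> m] tri_def c_def by simp
    also have "?L ^ tri m * c / c = ?L ^ tri m" using cpos by simp
    finally show ?thesis .
  qed
  let ?T = "weight_total l"
  have T1: "?T \<ge> 1" by (rule weight_total_ge_1[OF l2])
  define \<delta> where "\<delta> = (\<lambda>k. p k - 2 * P_infty l (2 * k + \<pi>))"
  have Pq: "P_infty l v = weight l v / ?T" for v by (rule P_infty_eq[OF l2])
  have mom: "(\<lambda>k. \<delta> k * (\<Prod>i<m. ?L ^ (2 * k + \<pi>) - ?L ^ i)) sums 0" if m: "m < n" for m
  proof -
    have "(\<lambda>k. 2 / ?T * (weight l (2 * k + \<pi>) * (\<Prod>i<m. ?L ^ (2 * k + \<pi>) - ?L ^ i))) sums (2 / ?T * (?L ^ tri m * ?T / 2))"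
      by (intro sums_mult parity_moment_sums[OF l2 \<pi>])
    also have "2 / ?T * (?L ^ tri m * ?T / 2) = ?L ^ tri m" using T1 by simp
    finally have "(\<lambda>k. p k * (\<Prod>i<m. ?L ^ (2 * k + \<pi>) - ?L ^ i)
        - 2 / ?T * (weight l (2 * k + \<pi>) * (\<Prod>i<m. ?L ^ (2 * k + \<pi>) - ?L ^ i))) sums (?L ^ tri m - ?L ^ tri m)"
      by (intro sums_diff pmom[OF m])
    then show ?thesis by (simp add: \<delta>_def Pq left_diff_distrib mult.assoc)
  qed
  \<comment> \<open>Both terms of the difference lie between 0 and the bound, hence so does their
    distance. On the group side only the identity can have \<open>fdim\<close> as large as
    \<open>2 * n\<close>.\<close>
  have tail: "\<bar>\<delta> j\<bar> \<le> 16 / ?L ^ (j * (2 * j - 1))" if j: "j \<ge> n" for j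
  proof -
    let ?D = "?L ^ (j * (2 * j - 1))"
    have Dpos: "?D > 0" using L2 by simp
    have P: "0 \<le> 2 * P_infty l (2 * j + \<pi>)" "2 * P_infty l (2 * j + \<pi>) \<le> 16 / ?D"
    proof -
      have w0: "weight l (2 * j + \<pi>) > 0" by (rule weight_pos[OF l2])
      show "0 \<le> 2 * P_infty l (2 * j + \<pi>)" unfolding Pq using w0 T1 by simp
      have "weight l (2 * j + \<pi>) / ?T \<le> weight l (2 * j + \<pi>) / 1"
        using w0 T1 by (intro divide_left_mono) auto
      also have "\<dots> \<le> 4 / ?L ^ tri (2 * j + \<pi> - 1)" using weight_le[OF l2] by simp
      also have "\<dots> \<le> 4 / ?D"
      proof -
        have jpos: "j > 0" using j npos by simp
        have "2 * (j * (2 * j - 1)) \<le> 2 * tri (2 * j + \<pi> - 1)"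
        proof -
          have "(2 * j - 1) * (2 * j) \<le> (2 * j + \<pi> - 1) * (2 * j + \<pi> - 1 + 1)" by (intro mult_mono) auto
          then show ?thesis unfolding tri_double by (simp add: mult_ac)
        qed
        then have "?D \<le> ?L ^ tri (2 * j + \<pi> - 1)" using L2 by (intro power_increasing) auto
        then show ?thesis using Dpos by (intro divide_left_mono) auto
      qed
      finally have "2 * P_infty l (2 * j + \<pi>) \<le> 8 / ?D" unfolding Pq by simp
      also have "\<dots> \<le> 16 / ?D" using Dpos by (intro divide_right_mono) auto
      finally show "2 * P_infty l (2 * j + \<pi>) \<le> 16 / ?D" .
    qed
    have p: "0 \<le> p j" "p j \<le> 16 / ?D"
    proof -
      show "0 \<le> p j" unfolding p_def using cpos by simp
      show "p j \<le> 16 / ?D"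
      proof (cases "2 * j + \<pi> > 2 * n")
        case True
        then show ?thesis using p0[OF True] Dpos by simp
      next
        case False
        then have "j = n \<and> \<pi> = 0" using j by linarith
        then have jn: "j = n" and j0: "2 * j + \<pi> = 2 * n" by simp_all
        have "card {g \<in> ?C. qs.fdim g = 2 * j + \<pi>} \<le> 1" unfolding j0 by (rule qs.card_full_fdim)
        then have "p j \<le> 1 / c" unfolding p_def using cpos by (intro divide_right_mono) auto
        also have "\<dots> \<le> 1 / (?D / 16)" 
        proof (rule divide_left_mono)
          show "?D / 16 \<le> c" using c_ge unfolding jn .
          show "0 < c * (?D / 16)" using cpos Dpos by (intro mult_pos_pos) simp_all
        qed simp
        finally show ?thesis by simp
      qed
    qed
    show ?thesis unfolding \<delta>_def using P p by linarith
  qed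
  have "\<bar>\<delta> k\<bar> \<le> 16 / ?L ^ n\<^sup>2 * tail_bound n k"
    by (rule deviation_bound[OF L2 npos _ mom tail]) auto
  then show ?thesis by (simp add: \<delta>_def p_def c_def)
qed

text \<open>Half of the bound in \<open>class_deviation\<close>, because
  \<open>pmf_fixed_dim\<close> halves the class distribution; \<open>2 * k\<close> and
  \<open>2 * k + 1\<close> share one value.\<close>

definition err :: "nat \<Rightarrow> real" where
  "err v = 8 / real l ^ n\<^sup>2 * tail_bound n (v div 2)"

lemma pmf_deviation:
  assumes "gcd q (2 * l) = 1"
  shows "\<bar>pmf (fixed_dim_pmf l d q) v - P_infty l v\<bar> \<le> err v"
proof -
  obtain \<epsilon> where \<epsilon>: "\<epsilon> \<in> qs.sp_values" and pmf: "\<And>v. pmf (fixed_dim_pmf l d q) v =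
      real (card {g \<in> qs.cls \<epsilon> (even v). qs.fdim g = v}) / (2 * real (card (qs.cls \<epsilon> (even v))))"
    using pmf_fixed_dim[OF assms] by blast
  define \<pi> where "\<pi> = v mod 2"
  define k where "k = v div 2"
  have v: "v = 2 * k + \<pi>" "\<pi> < 2" "even \<pi> = even v" by (auto simp: \<pi>_def k_def)
  define a where "a = real (card {g \<in> qs.cls \<epsilon> (even v). qs.fdim g = v}) / real (card (qs.cls \<epsilon> (even v)))"
  have "\<bar>a - 2 * P_infty l v\<bar> \<le> 16 / real l ^ n\<^sup>2 * tail_bound n k"
    using class_deviation[OF \<epsilon> v(2), of k] unfolding v(3) v(1)[symmetric] a_def .
  moreover have "pmf (fixed_dim_pmf l d q) v = a / 2" unfolding pmf a_def by simp
  moreover have "16 / real l ^ n\<^sup>2 * tail_bound n k = 2 * err v" by (simp add: err_def k_def)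
  ultimately show ?thesis unfolding abs_le_iff by linarith
qed

text \<open>On the trivial filter \<open>Limsup\<close> would lie below \<open>Liminf\<close>. Large
  primes not dividing \<open>2 * l\<close> are admissible values of \<open>q\<close>.\<close>

lemma q_filter_nontrivial: "q_filter l \<noteq> bot"
proof -
  have "\<exists>\<^sub>F q in at_top. primepow q \<and> gcd q (2 * l) = 1"
    unfolding frequently_sequentially
  proof
    fix m :: nat
    obtain p where p: "prime p" "p > m + 2 * l" using bigger_prime by blast
    have "\<not> p dvd 2 * l" using p l1 by (auto dest!: dvd_imp_le)
    then have "coprime p (2 * l)" using p prime_imp_coprime by blast
    then have g: "gcd p (2 * l) = 1" by (rule coprime_imp_gcd_eq_1)
    have pp: "primepow p" using p(1) by (rule primepow_prime)
    have mp: "m \<le> p" using p(2) by linarith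
    show "\<exists>q\<ge>m. primepow q \<and> gcd q (2 * l) = 1" by (rule exI[of _ p]) (intro conjI mp pp g)
  qed
  moreover have "\<forall>\<^sub>F q in at_top. \<not> (primepow q \<and> gcd q (2 * l) = 1)" if "q_filter l = bot"
  proof -
    have "\<forall>\<^sub>F q in q_filter l. False" unfolding that by (rule eventually_bot)
    then show ?thesis unfolding q_filter_def eventually_inf_principal mem_Collect_eq by (simp only: not_def)
  qed
  ultimately show ?thesis unfolding frequently_def by blast
qed

lemma eventually_pmf_deviation:
  "\<forall>\<^sub>F q in q_filter l. \<bar>pmf (fixed_dim_pmf l d q) v - P_infty l v\<bar> \<le> err v"
  unfolding q_filter_def eventually_inf_principal
  by (rule always_eventually) (auto intro: pmf_deviation)

text \<open>\<open>pmf_deviation\<close> has the same bound for every admissible \<open>q\<close>,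
  so both limits lie in one finite interval, on which \<open>real_of_ereal\<close> is
  faithful.\<close>

lemma limit_deviation:
  "\<bar>X_sup l d v - P_infty l v\<bar> \<le> err v" "\<bar>X_inf l d v - P_infty l v\<bar> \<le> err v"
proof -
  let ?f = "\<lambda>q. ereal (pmf (fixed_dim_pmf l d q) v)"
  have lo: "\<forall>\<^sub>F q in q_filter l. ereal (P_infty l v - err v) \<le> ?f q"
    using eventually_pmf_deviation[of v] by eventually_elim (simp add: abs_le_iff)
  have hi: "\<forall>\<^sub>F q in q_filter l. ?f q \<le> ereal (P_infty l v + err v)"
    using eventually_pmf_deviation[of v] by eventually_elim (simp add: abs_le_iff)
  have 1: "ereal (P_infty l v - err v) \<le> Liminf (q_filter l) ?f" by (rule Liminf_bounded[OF lo])
  have 2: "Limsup (q_filter l) ?f \<le> ereal (P_infty l v + err v)" by (rule Limsup_bounded[OF hi])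
  have 3: "Liminf (q_filter l) ?f \<le> Limsup (q_filter l) ?f" by (rule Liminf_le_Limsup[OF q_filter_nontrivial])
  have bound: "\<bar>real_of_ereal x - P_infty l v\<bar> \<le> err v"
    if "ereal (P_infty l v - err v) \<le> x" "x \<le> ereal (P_infty l v + err v)" for x
    using that by (cases x) (auto simp: abs_le_iff)
  show "\<bar>X_sup l d v - P_infty l v\<bar> \<le> err v" unfolding X_sup_def
    by (rule bound[OF order_trans[OF 1 3] 2])
  show "\<bar>X_inf l d v - P_infty l v\<bar> \<le> err v" unfolding X_inf_def
    by (rule bound[OF 1 order_trans[OF 3 2]])
qed

lemma err_nonneg: "err v \<ge> 0"
  by (simp add: err_def tail_bound_nonneg)

text \<open>Pairing \<open>2 * k\<close> with \<open>2 * k + 1\<close> gives 16 for each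
  \<open>k\<close>, and \<open>tail_bound_sums\<close> another 16; this is the constant of the
  theorem.\<close>

lemma sum_err: assumes "finite A" shows "(\<Sum>v\<in>A. err v) \<le> 256 / real l ^ n\<^sup>2"
proof -
  obtain M where M: "A \<subseteq> {..<M}" using finite_nat_iff_bounded[THEN iffD1, OF assms] ..
  have "(\<Sum>v\<in>A. err v) \<le> (\<Sum>v<M * 2. err v)" using M err_nonneg by (intro sum_mono2) auto
  also have "\<dots> = (\<Sum>k<M. \<Sum>v\<in>{k * 2..<k * 2 + 2}. err v)" by (rule sum.nat_group[symmetric])
  also have "\<dots> = (\<Sum>k<M. 16 / real l ^ n\<^sup>2 * tail_bound n k)"
  proof (rule sum.cong)
    fix k :: nat
    have "{k * 2..<k * 2 + 2} = {2 * k, 2 * k + 1}" by auto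
    then show "(\<Sum>v\<in>{k * 2..<k * 2 + 2}. err v) = 16 / real l ^ n\<^sup>2 * tail_bound n k" by (simp add: err_def)
  qed simp
  also have "\<dots> = 16 / real l ^ n\<^sup>2 * (\<Sum>k<M. tail_bound n k)" by (simp add: sum_distrib_left)
  also have "\<dots> \<le> 16 / real l ^ n\<^sup>2 * 16"
  proof (rule mult_left_mono)
    have "(\<Sum>k<M. tail_bound n k) \<le> suminf (tail_bound n)"
      using tail_bound_sums(1) tail_bound_nonneg by (intro sum_le_suminf) auto
    then show "(\<Sum>k<M. tail_bound n k) \<le> 16" using tail_bound_sums(2)[of n] by linarith
  qed simp
  finally show ?thesis by simp
qed

text \<open>In the extended nonnegative reals an infinite sum is bounded as soon as its finite
  partial sums are, so \<open>sum_err\<close> suffices.\<close>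

lemma tv_dist_bound:
  assumes "\<And>v. \<bar>X v - P_infty l v\<bar> \<le> err v"
  shows "tv_dist X (P_infty l) \<le> ennreal (256 / real l ^ n\<^sup>2)"
proof -
  have "(\<Sum>\<^sub>\<infinity>v. ennreal \<bar>X v - P_infty l v\<bar>) \<le> ennreal (256 / real l ^ n\<^sup>2)"
  proof (rule infsum_le_finite_sums)
    show "(\<lambda>v. ennreal \<bar>X v - P_infty l v\<bar>) summable_on UNIV" by (rule nonneg_summable_on_complete) simp
    fix A :: "nat set" assume "finite A"
    have "(\<Sum>v\<in>A. ennreal \<bar>X v - P_infty l v\<bar>) \<le> (\<Sum>v\<in>A. ennreal (err v))"
      using assms by (intro sum_mono ennreal_leI)
    also have "\<dots> = ennreal (\<Sum>v\<in>A. err v)" using err_nonneg by (intro sum_ennreal) auto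
    also have "\<dots> \<le> ennreal (256 / real l ^ n\<^sup>2)" using sum_err[OF \<open>finite A\<close>] by (rule ennreal_leI)
    finally show "(\<Sum>v\<in>A. ennreal \<bar>X v - P_infty l v\<bar>) \<le> ennreal (256 / real l ^ n\<^sup>2)" .
  qed
  then have "tv_dist X (P_infty l) \<le> ennreal (256 / real l ^ n\<^sup>2) / 2"
    unfolding tv_dist_def by (rule divide_right_mono_ennreal)
  also have "\<dots> = ennreal (256 / real l ^ n\<^sup>2 / 2)" by (rule ennreal_divide_numeral) simp
  also have "\<dots> \<le> ennreal (256 / real l ^ n\<^sup>2)" by (rule ennreal_leI) (simp add: divide_right_mono)
  finally show ?thesis .
qed

end

theorem theorem4p23:
  shows "(\<exists>C::real. \<forall>l d::nat. prime l \<longrightarrow> d \<ge> 2 \<longrightarrow>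
            tv_dist (X_sup l d) (P_infty l) \<le> ennreal (C / real l ^ ((6 * d - 2)\<^sup>2))) \<and>
         (\<exists>C::real. \<forall>l d::nat. prime l \<longrightarrow> d \<ge> 2 \<longrightarrow>
            tv_dist (X_inf l d) (P_infty l) \<le> ennreal (C / real l ^ ((6 * d - 2)\<^sup>2)))"
proof (intro conjI exI[of _ 256] allI impI)
  fix l d :: nat assume "prime l" "d \<ge> 2"
  then interpret reduction l d by unfold_locales
  show "tv_dist (X_sup l d) (P_infty l) \<le> ennreal (256 / real l ^ ((6 * d - 2)\<^sup>2))"
    by (rule tv_dist_bound, rule limit_deviation)
  show "tv_dist (X_inf l d) (P_infty l) \<le> ennreal (256 / real l ^ ((6 * d - 2)\<^sup>2))"
    by (rule tv_dist_bound, rule limit_deviation)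
qed

end
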